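(* Let $N\ge 2$ and let $\Omega\subset\mathbb{R}^N$ be a bounded domain with strong Lipschitz boundary $\Gamma=\Gamma_{\mathsf t}\cup\Gamma_{\mathsf n}$ decomposed as in the context. Then there exists $c>0$ such that for all $v\in\mathring{H}^1_{\mathsf{t,n}}(\Omega)$ with $\nabla v\perp\mathcal{K}$ (orthogonality in $L^2(\Omega)$) $$\|\nabla v\|_{L^2(\Omega)}\le c\,\|\operatorname{sym}\nabla v\|_{L^2(\Omega)}.$$ Equivalently, there exists $c>0$ such that for all $v\in\mathring{H}^1_{\mathsf{t,n}}(\Omega)$ $$\|\nabla v-\pi_{\mathcal{K}}\nabla v\|_{L^2(\Omega)}\le c\,\|\operatorname{sym}\nabla v\|_{L^2(\Omega)},$$ where $\pi_{\mathcal{K}}$ denotes the $L^2(\Omega)$-orthogonal projector onto $\mathcal{K}$.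
   Context: A domain is a nonempty open connected set. Strong Lipschitz boundary means that $\Gamma:=\partial\Omega$ is locally, after a rigid change of coordinates, the graph of a Lipschitz function with $\Omega$ locally on one side. The outer unit normal $\nu$ exists a.e. on $\Gamma$ with respect to the surface measure. For a vector field $v$ set, a.e. on $\Gamma$, $v_{\mathsf n}:=\nu\cdot v|_\Gamma$ (normal component) and $v_{\mathsf t}:=v|_\Gamma-v_{\mathsf n}\nu$ (tangential component). $\Gamma$ is decomposed into a relatively open subset $\Gamma_{\mathsf t}\subset\Gamma$ and $\Gamma_{\mathsf n}:=\Gamma\setminus\overline{\Gamma_{\mathsf t}}$. The space $\mathring{H}^1_{\mathsf{t,n}}(\Omega)$ is the closure in $H^1(\Omega)=H^1(\Omega;\mathbb{R}^N)$ of $$\{v|_\Omega: v\in C_c^\infty(\mathbb{R}^N;\mathbb{R}^N),\ v_{\mathsf t}|_{\Gamma_{\mathsf t}}=0,\ v_{\mathsf n}|_{\Gamma_{\mathsf n}}=0\}.$$ $\nabla v$ is the transpose of the Jacobian matrix of $v$, and $\operatorname{sym}$ is the symmetric part of a matrix. $L^2(\Omega)$ norms, inner products and orthogonality of vector and matrix fields are taken componentwise (Frobenius). $\mathfrak{so}$ is the space of constant real skew-symmetric $N\times N$ matrices, and $\mathcal{R}:=\{x\mapsto Sx+a: S\in\mathfrak{so},\ a\in\mathbb{R}^N\}$ is the space of rigid motions. Finally $$\mathcal{K}:=\{\nabla v: v\in\mathring{H}^1_{\mathsf{t,n}}(\Omega),\ \operatorname{sym}\nabla v=0\}=\nabla(\mathcal{R}\cap\mathring{H}^1_{\mathsf{t,n}}(\Omega))=\mathfrak{so}\cap\nabla\mathring{H}^1_{\mathsf{t,n}}(\Omega).$$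 *)

theory Defs
  imports "HOL-Analysis.Analysis"
begin

section \<open>Smooth functions with compact support\<close>

text \<open>
  \<open>C_k k f\<close>: \<open>f\<close> is \<open>k\<close> times continuously differentiable. Total differentiability is required at
  every stage, since \<open>frechet_derivative\<close> is meaningful only then; it follows from continuity of the
  partial derivatives, so the class is the usual one.
\<close>

definition partial_deriv :: "'n::finite \<Rightarrow> (real^'n \<Rightarrow> 'b::real_normed_vector) \<Rightarrow> real^'n \<Rightarrow> 'b" where
  "partial_deriv i f x = frechet_derivative f (at x) (axis i 1)"

fun C_k :: "nat \<Rightarrow> (real^'n::finite \<Rightarrow> 'b::real_normed_vector) \<Rightarrow> bool" where
  "C_k 0 f \<longleftrightarrow> continuous_on UNIV f"
| "C_k (Suc k) f \<longleftrightarrow> (\<forall>x. f differentiable (at x)) \<and> (\<forall>i. C_k k (partial_deriv i f))"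

definition C_infinity :: "(real^'n::finite \<Rightarrow> 'b::real_normed_vector) \<Rightarrow> bool" where
  "C_infinity f \<longleftrightarrow> (\<forall>k. C_k k f)"

definition supp :: "(real^'n::finite \<Rightarrow> 'b::real_normed_vector) \<Rightarrow> (real^'n) set" where
  "supp f = closure {x. f x \<noteq> 0}"

definition Cc_infinity :: "(real^'n::finite) set \<Rightarrow> (real^'n \<Rightarrow> 'b::real_normed_vector) set" where
  "Cc_infinity \<Omega> = {f. C_infinity f \<and> compact (supp f) \<and> supp f \<subseteq> \<Omega>}"

section \<open>Square integrable fields\<close>

text \<open>
  Elements of Lebesgue and Sobolev spaces are represented by functions on the whole space; only their
  values almost everywhere in \<open>\<Omega>\<close> matter. On \<open>real^'n^'n\<close> the inner product \<open>\<bullet>\<close> and the norm are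
  those of Frobenius.
\<close>

definition L2 :: "(real^'n::finite) set \<Rightarrow> (real^'n \<Rightarrow> 'b::euclidean_space) set" where
  "L2 \<Omega> = {f. f \<in> borel_measurable (lebesgue_on \<Omega>) \<and>
              integrable (lebesgue_on \<Omega>) (\<lambda>x. (norm (f x))\<^sup>2)}"

definition l2_inner ::
  "(real^'n::finite) set \<Rightarrow> (real^'n \<Rightarrow> 'b::euclidean_space) \<Rightarrow> (real^'n \<Rightarrow> 'b) \<Rightarrow> real" where
  "l2_inner \<Omega> f g = integral\<^sup>L (lebesgue_on \<Omega>) (\<lambda>x. f x \<bullet> g x)"

definition l2_norm :: "(real^'n::finite) set \<Rightarrow> (real^'n \<Rightarrow> 'b::euclidean_space) \<Rightarrow> real" where
  "l2_norm \<Omega> f = sqrt (l2_inner \<Omega> f f)"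

text \<open>
  Orthogonal projection in \<open>L2 \<Omega>\<close> onto a subspace \<open>V\<close> that is closed under equality almost
  everywhere: \<open>l2_proj \<Omega> V f\<close> is a representative of the projection, which is unique up to null sets.
\<close>

definition is_l2_projection ::
  "(real^'n::finite) set \<Rightarrow> (real^'n \<Rightarrow> 'b::euclidean_space) set \<Rightarrow> (real^'n \<Rightarrow> 'b) \<Rightarrow> (real^'n \<Rightarrow> 'b) \<Rightarrow> bool"
where
  "is_l2_projection \<Omega> V f p \<longleftrightarrow> p \<in> V \<and> (\<forall>q\<in>V. l2_inner \<Omega> (\<lambda>x. f x - p x) q = 0)"

definition l2_proj ::
  "(real^'n::finite) set \<Rightarrow> (real^'n \<Rightarrow> 'b::euclidean_space) set \<Rightarrow> (real^'n \<Rightarrow> 'b) \<Rightarrow> (real^'n \<Rightarrow> 'b)"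
where
  "l2_proj \<Omega> V f = (SOME p. is_l2_projection \<Omega> V f p)"

section \<open>The Sobolev space of vector fields\<close>

definition sym_part :: "real^'n^'n \<Rightarrow> real^'n^'n::finite" where
  "sym_part A = (1/2) *\<^sub>R (A + transpose A)"

text \<open>The gradient is the transposed Jacobian: \<open>G x $ i $ j\<close> is the \<open>i\<close>-th derivative of \<open>v $ j\<close>.\<close>

definition has_weak_gradient ::
  "(real^'n::finite) set \<Rightarrow> (real^'n \<Rightarrow> real^'n) \<Rightarrow> (real^'n \<Rightarrow> real^'n^'n) \<Rightarrow> bool" where
  "has_weak_gradient \<Omega> v G \<longleftrightarrow>
     (\<forall>\<phi>::real^'n \<Rightarrow> real. \<phi> \<in> Cc_infinity \<Omega> \<longrightarrow> (\<forall>i j.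
        integral\<^sup>L (lebesgue_on \<Omega>) (\<lambda>x. v x $ j * partial_deriv i \<phi> x)
        = - integral\<^sup>L (lebesgue_on \<Omega>) (\<lambda>x. G x $ i $ j * \<phi> x)))"

definition H1 :: "(real^'n::finite) set \<Rightarrow> (real^'n \<Rightarrow> real^'n) set" where
  "H1 \<Omega> = {v \<in> L2 \<Omega>. \<exists>G\<in>L2 \<Omega>. has_weak_gradient \<Omega> v G}"

text \<open>A representative of the weak gradient, which is unique up to null sets.\<close>

definition weak_grad ::
  "(real^'n::finite) set \<Rightarrow> (real^'n \<Rightarrow> real^'n) \<Rightarrow> real^'n \<Rightarrow> real^'n^'n" where
  "weak_grad \<Omega> v = (SOME G. G \<in> L2 \<Omega> \<and> has_weak_gradient \<Omega> v G)"

definition h1_norm :: "(real^'n::finite) set \<Rightarrow> (real^'n \<Rightarrow> real^'n) \<Rightarrow> real" where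
  "h1_norm \<Omega> v = sqrt ((l2_norm \<Omega> v)\<^sup>2 + (l2_norm \<Omega> (weak_grad \<Omega> v))\<^sup>2)"

section \<open>Strong Lipschitz boundary, outer unit normal, surface measure\<close>

text \<open>
  Rigid coordinates are given by a unit vector \<open>e\<close>, the direction of the last axis; the origin is
  absorbed into the graph function \<open>g\<close>, which depends only on the coordinates orthogonal to \<open>e\<close>.
\<close>

definition lipschitz_chart ::
  "(real^'n::finite) set \<Rightarrow> (real^'n) set \<Rightarrow> real^'n \<Rightarrow> (real^'n \<Rightarrow> real) \<Rightarrow> bool" where
  "lipschitz_chart \<Omega> U e g \<longleftrightarrow>
     open U \<and> norm e = 1 \<and> (\<forall>y t. g (y + t *\<^sub>R e) = g y) \<and> (\<exists>L. L-lipschitz_on UNIV g) \<and>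
     frontier \<Omega> \<inter> U = {y \<in> U. y \<bullet> e = g y} \<and>
     \<Omega> \<inter> U = {y \<in> U. y \<bullet> e < g y}"

definition strong_lipschitz_boundary :: "(real^'n::finite) set \<Rightarrow> bool" where
  "strong_lipschitz_boundary \<Omega> \<longleftrightarrow> (\<forall>x\<in>frontier \<Omega>. \<exists>U e g. x \<in> U \<and> lipschitz_chart \<Omega> U e g)"

text \<open>
  At a boundary point where the graph function \<open>g\<close> is differentiable with gradient \<open>p\<close>, which is then
  orthogonal to \<open>e\<close>, the outer unit normal is \<open>(e - p) / sqrt (1 + \<bar>p\<bar>\<^sup>2)\<close>. It does not depend on the
  chart. Where no chart is differentiable, \<open>outer_normal\<close> is unspecified; by Rademacher's theorem these
  points form a null set of the surface measure.
\<close>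

definition is_outer_normal :: "(real^'n::finite) set \<Rightarrow> real^'n \<Rightarrow> real^'n \<Rightarrow> bool" where
  "is_outer_normal \<Omega> x n \<longleftrightarrow> x \<in> frontier \<Omega> \<and>
     (\<exists>U e g p. x \<in> U \<and> lipschitz_chart \<Omega> U e g \<and>
        (g has_derivative (\<lambda>h. p \<bullet> h)) (at x) \<and> n = (1 / norm (e - p)) *\<^sub>R (e - p))"

definition outer_normal :: "(real^'n::finite) set \<Rightarrow> real^'n \<Rightarrow> real^'n" where
  "outer_normal \<Omega> x = (SOME n. is_outer_normal \<Omega> x n)"

definition normal_part :: "(real^'n::finite) set \<Rightarrow> (real^'n \<Rightarrow> real^'n) \<Rightarrow> real^'n \<Rightarrow> real" where
  "normal_part \<Omega> v x = outer_normal \<Omega> x \<bullet> v x"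

definition tangential_part :: "(real^'n::finite) set \<Rightarrow> (real^'n \<Rightarrow> real^'n) \<Rightarrow> real^'n \<Rightarrow> real^'n" where
  "tangential_part \<Omega> v x = v x - normal_part \<Omega> v x *\<^sub>R outer_normal \<Omega> x"

text \<open>
  Hausdorff outer measure of integer dimension \<open>s \<ge> 1\<close>, normalised so that for \<open>s = CARD('n) - 1\<close> it is
  the surface measure on Lipschitz graphs. Boundedness of the covering sets is required explicitly
  because \<open>diameter\<close> is unspecified on unbounded sets.
\<close>

definition hausdorff_outer :: "nat \<Rightarrow> 'a::metric_space set \<Rightarrow> ennreal" where
  "hausdorff_outer s A =
     (SUP \<delta>\<in>{0::real<..}.
        INF C\<in>{C :: nat \<Rightarrow> 'a set. A \<subseteq> (\<Union>i. C i) \<and> (\<forall>i. bounded (C i) \<and> diameter (C i) \<le> \<delta>)}.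
          (\<Sum>i. ennreal (unit_ball_vol (real s) * (diameter (C i) / 2) ^ s)))"

definition surface_ae :: "(real^'n::finite) set \<Rightarrow> (real^'n \<Rightarrow> bool) \<Rightarrow> bool" where
  "surface_ae S P \<longleftrightarrow> hausdorff_outer (CARD('n) - 1) {x \<in> S. \<not> P x} = 0"

section \<open>Mixed boundary conditions\<close>

definition smooth_tn :: "(real^'n::finite) set \<Rightarrow> (real^'n) set \<Rightarrow> (real^'n) set \<Rightarrow> (real^'n \<Rightarrow> real^'n) set"
where
  "smooth_tn \<Omega> \<Gamma>t \<Gamma>n =
     {v \<in> Cc_infinity UNIV.
        surface_ae \<Gamma>t (\<lambda>x. tangential_part \<Omega> v x = 0) \<and>
        surface_ae \<Gamma>n (\<lambda>x. normal_part \<Omega> v x = 0)}"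

definition H1_tn :: "(real^'n::finite) set \<Rightarrow> (real^'n) set \<Rightarrow> (real^'n) set \<Rightarrow> (real^'n \<Rightarrow> real^'n) set"
where
  "H1_tn \<Omega> \<Gamma>t \<Gamma>n =
     {v \<in> H1 \<Omega>. \<forall>\<epsilon>>0. \<exists>w\<in>smooth_tn \<Omega> \<Gamma>t \<Gamma>n. h1_norm \<Omega> (\<lambda>x. v x - w x) < \<epsilon>}"

definition rigid_gradients ::
  "(real^'n::finite) set \<Rightarrow> (real^'n) set \<Rightarrow> (real^'n) set \<Rightarrow> (real^'n \<Rightarrow> real^'n^'n) set" where
  "rigid_gradients \<Omega> \<Gamma>t \<Gamma>n =
     {F \<in> L2 \<Omega>. \<exists>v\<in>H1_tn \<Omega> \<Gamma>t \<Gamma>n.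
        (AE x in lebesgue_on \<Omega>. F x = weak_grad \<Omega> v x) \<and>
        (AE x in lebesgue_on \<Omega>. sym_part (weak_grad \<Omega> v x) = 0)}"

end

theory Submission
  imports Defs
begin

text \<open>
  Why the inequality holds. The statement about \<open>H1_tn\<close> is a finite-dimensional consequence of
  Korn's second inequality modulo rigid motions (\<open>korn_modulo_rigid\<close>): for every smooth field \<open>v\<close> there is
  a rigid motion \<open>r\<close> with \<open>\<parallel>v - r\<parallel> + \<parallel>\<nabla>(v - r)\<parallel> \<le> C \<parallel>sym \<nabla>v\<parallel>\<close> on \<open>\<Omega>\<close>. If \<open>v\<close> is close to the closed subspace
  \<open>V = H1_tn\<close>, then so is \<open>r\<close>, up to a multiple of \<open>\<parallel>sym \<nabla>v\<parallel>\<close>. The rigid motions form a finite-dimensional space, so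
  on it the distance to \<open>V\<close> controls the distance to the rigid motions in \<open>V\<close>, by compactness of the unit
  sphere (\<open>rigid_coercive\<close>, \<open>rigid_distance\<close>). Hence \<open>r\<close> can be replaced by a rigid motion that
  satisfies the boundary conditions, and its gradient belongs to \<open>rigid_gradients\<close>. That \<open>V\<close> is a
  subspace reflects the linearity of the boundary conditions. Since elements of \<open>V\<close> are limits of smooth fields,
  estimates are carried with an arbitrarily small error rather than passed to the limit.

  Korn's second inequality is proved locally first. For \<open>x\<close> and \<open>y\<close> in a ball,
  \<open>(v x - v y) \<bullet> (x - y)\<close> is the integral along the segment of a quadratic form in \<open>sym \<nabla>v\<close>. Its
  derivative with respect to \<open>y\<close> contains \<open>v x\<close>, a first-order polynomial in \<open>x\<close>, and nothing else, so integration by parts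
  against a cutoff function represents \<open>v\<close>, up to an affine field, by an integral with a bounded kernel
  (\<open>korn_poincare_identity\<close>). This bounds \<open>v\<close> minus an affine field in \<open>L2\<close>; a cutoff and Korn's first
  inequality, \<open>\<parallel>\<nabla>u\<parallel>\<^sup>2 \<le> 2 \<parallel>sym \<nabla>u\<parallel>\<^sup>2\<close> for compactly supported \<open>u\<close> (\<open>korn_first\<close>), then give
  the gradient (\<open>korn_ball\<close>).

  The passage from balls to \<open>\<Omega>\<close> (\<open>local_to_global\<close>) concerns any \<open>f\<close> whose oscillation on balls is
  controlled by \<open>\<epsilon>\<close>. In the interior, overlapping balls are chained. Near the boundary, let \<open>T\<close>
  multiply the height \<open>\<tau>\<close> below the Lipschitz graph by a factor slightly larger than one. A point and its
  image lie in a common interior ball of radius comparable with \<open>\<tau>\<close>, so averaging the local estimates gives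
  \<open>\<parallel>f - f \<circ> T\<parallel> \<le> C \<parallel>\<epsilon>\<parallel>\<close> on a boundary layer (\<open>vertical_increment_energy\<close>). On the other hand \<open>T\<close> expands
  volume, so \<open>\<parallel>f \<circ> T\<parallel>\<^sup>2\<close> on a layer is at most \<open>\<theta> < 1\<close> times \<open>\<parallel>f\<parallel>\<^sup>2\<close> on a slightly thicker layer
  (\<open>nn_integral_vertical_dilation\<close>). The two together absorb the layer into the interior
  (\<open>boundary_estimate\<close>). Applied to \<open>\<nabla>v\<close>, and then to \<open>v\<close> minus a linear field, this gives
  Korn's second inequality.
\<close>

section \<open>Energies and averages over segments\<close>

lemma nn_integral_affine:
  fixes f :: "'a::euclidean_space \<Rightarrow> ennreal"
  assumes [measurable]: "f \<in> borel_measurable borel" and c: "c > 0"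
  shows "(\<integral>\<^sup>+x. f x \<partial>lborel) = ennreal (c ^ DIM('a)) * (\<integral>\<^sup>+x. f (t + c *\<^sub>R x) \<partial>lborel)"
proof -
  have "(\<integral>\<^sup>+x. f x \<partial>lborel) = (\<integral>\<^sup>+x. f x \<partial>density (distr lborel borel (\<lambda>x. t + c *\<^sub>R x)) (\<lambda>_. ennreal (\<bar>c\<bar> ^ DIM('a))))"
    using lborel_affine[of c t] c by simp
  also have "\<dots> = ennreal (c ^ DIM('a)) * (\<integral>\<^sup>+x. f (t + c *\<^sub>R x) \<partial>lborel)"
    using c by (simp add: nn_integral_density nn_integral_distr nn_integral_cmult)
  finally show ?thesis .
qed

lemma nn_integral_translate:
  fixes f :: "'a::euclidean_space \<Rightarrow> ennreal"
  assumes [measurable]: "f \<in> borel_measurable borel"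
  shows "(\<integral>\<^sup>+x. f (x + t) \<partial>lborel) = (\<integral>\<^sup>+x. f x \<partial>lborel)"
  using nn_integral_affine[of f 1 t] by (simp add: add.commute)

text \<open>
  The square of the \<open>L2\<close> norm, valued in \<open>ennreal\<close> so that monotonicity and Tonelli's theorem apply
  without integrability conditions.
\<close>

definition energy :: "'a::euclidean_space set \<Rightarrow> ('a \<Rightarrow> 'b::real_normed_vector) \<Rightarrow> ennreal" where
  "energy S f = (\<integral>\<^sup>+x\<in>S. ennreal ((norm (f x))\<^sup>2) \<partial>lborel)"

text \<open>
  For \<open>s \<ge> 1/2\<close> and fixed \<open>y\<close>, the map \<open>x \<mapsto> y + s (x - y)\<close> contracts \<open>B\<close> into itself
  with Jacobian \<open>s ^ n \<ge> 2 ^ - n\<close>.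
\<close>

lemma segment_average_fixed:
  fixes F :: "'a::euclidean_space \<Rightarrow> ennreal"
  assumes [measurable]: "F \<in> borel_measurable borel" "B \<in> sets borel" and "convex B"
    and s: "1/2 \<le> s" "s \<le> 1"
  shows "(\<integral>\<^sup>+y\<in>B. (\<integral>\<^sup>+x\<in>B. F (y + s *\<^sub>R (x - y)) \<partial>lborel) \<partial>lborel)
    \<le> ennreal (2 ^ DIM('a)) * emeasure lborel B * (\<integral>\<^sup>+z\<in>B. F z \<partial>lborel)"
proof -
  define I where "I = (\<integral>\<^sup>+z\<in>B. F z \<partial>lborel)"
  have inner: "(\<integral>\<^sup>+x\<in>B. F (y + s *\<^sub>R (x - y)) \<partial>lborel) \<le> ennreal (2 ^ DIM('a)) * I" if y: "y \<in> B" for y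
  proof -
    have "(\<integral>\<^sup>+x\<in>B. F (y + s *\<^sub>R (x - y)) \<partial>lborel)
      \<le> (\<integral>\<^sup>+x. (\<lambda>z. F z * indicator B z) (((1 - s) *\<^sub>R y) + s *\<^sub>R x) \<partial>lborel)"
    proof (rule nn_integral_mono)
      fix x :: 'a
      have e: "y + s *\<^sub>R (x - y) = (1 - s) *\<^sub>R y + s *\<^sub>R x" by (simp add: algebra_simps)
      have "x \<in> B \<Longrightarrow> (1 - s) *\<^sub>R y + s *\<^sub>R x \<in> B"
        using \<open>convex B\<close> y s by (intro convexD) auto
      then show "F (y + s *\<^sub>R (x - y)) * indicator B x \<le> (\<lambda>z. F z * indicator B z) (((1 - s) *\<^sub>R y) + s *\<^sub>R x)"
        unfolding e by (auto simp: indicator_def)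
    qed
    also have "\<dots> \<le> ennreal (2 ^ DIM('a)) * (ennreal (s ^ DIM('a)) * (\<integral>\<^sup>+x. (\<lambda>z. F z * indicator B z) (((1 - s) *\<^sub>R y) + s *\<^sub>R x) \<partial>lborel))"
    proof -
      have "1 \<le> (2 * s) ^ DIM('a)" using s by (intro one_le_power) auto
      then have "1 \<le> ennreal (2 ^ DIM('a)) * ennreal (s ^ DIM('a))"
        using s by (simp add: ennreal_mult[symmetric] power_mult_distrib)
      from mult_right_mono[OF this, of "\<integral>\<^sup>+x. (\<lambda>z. F z * indicator B z) (((1 - s) *\<^sub>R y) + s *\<^sub>R x) \<partial>lborel"]
      show ?thesis by (simp add: mult.assoc)
    qed
    also have "\<dots> = ennreal (2 ^ DIM('a)) * I"
      unfolding I_def using s nn_integral_affine[of "\<lambda>z. F z * indicator B z" s "(1 - s) *\<^sub>R y"] by simp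
    finally show ?thesis .
  qed
  have "(\<integral>\<^sup>+y\<in>B. (\<integral>\<^sup>+x\<in>B. F (y + s *\<^sub>R (x - y)) \<partial>lborel) \<partial>lborel) \<le> (\<integral>\<^sup>+y. (ennreal (2 ^ DIM('a)) * I) * indicator B y \<partial>lborel)"
    by (rule nn_integral_mono) (use inner in \<open>auto simp: indicator_def\<close>)
  also have "\<dots> = ennreal (2 ^ DIM('a)) * I * emeasure lborel B"
    by (simp add: nn_integral_cmult_indicator)
  finally show ?thesis by (simp add: I_def mult_ac)
qed

text \<open>
  For \<open>s < 1/2\<close> the roles of the end points are exchanged, which replaces \<open>s\<close> by \<open>1 - s\<close>.
\<close>

lemma segment_average:
  fixes F :: "'a::euclidean_space \<Rightarrow> ennreal"
  assumes [measurable]: "F \<in> borel_measurable borel" "B \<in> sets borel" and B: "convex B"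
  shows "(\<integral>\<^sup>+y\<in>B. (\<integral>\<^sup>+x\<in>B. (\<integral>\<^sup>+s\<in>{0..1}. F (y + s *\<^sub>R (x - y)) \<partial>lborel) \<partial>lborel) \<partial>lborel)
    \<le> ennreal (2 ^ DIM('a)) * emeasure lborel B * (\<integral>\<^sup>+z\<in>B. F z \<partial>lborel)" (is "?L \<le> ?R")
proof -
  have fixed: "(\<integral>\<^sup>+y\<in>B. (\<integral>\<^sup>+x\<in>B. F (y + s *\<^sub>R (x - y)) \<partial>lborel) \<partial>lborel) \<le> ?R" if s: "s \<in> {0..1}" for s :: real
  proof (cases "s \<ge> 1/2")
    case True
    then show ?thesis using segment_average_fixed[OF _ _ B, of F s] s by simp
  next
    case False
    have "(\<integral>\<^sup>+y\<in>B. (\<integral>\<^sup>+x\<in>B. F (y + s *\<^sub>R (x - y)) \<partial>lborel) \<partial>lborel)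
      = (\<integral>\<^sup>+y. (\<integral>\<^sup>+x. F (y + s *\<^sub>R (x - y)) * indicator B x * indicator B y \<partial>lborel) \<partial>lborel)"
      by (intro nn_integral_cong) (simp add: nn_integral_multc)
    also have "\<dots> = (\<integral>\<^sup>+x. (\<integral>\<^sup>+y. F (y + s *\<^sub>R (x - y)) * indicator B x * indicator B y \<partial>lborel) \<partial>lborel)"
      by (rule lborel_pair.Fubini'[symmetric]) measurable
    also have "\<dots> = (\<integral>\<^sup>+x\<in>B. (\<integral>\<^sup>+y\<in>B. F (x + (1 - s) *\<^sub>R (y - x)) \<partial>lborel) \<partial>lborel)"
    proof (intro nn_integral_cong)
      fix x :: 'a
      have e: "y + s *\<^sub>R (x - y) = x + (1 - s) *\<^sub>R (y - x)" for y by (simp add: algebra_simps)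
      have "(\<integral>\<^sup>+y. F (y + s *\<^sub>R (x - y)) * indicator B x * indicator B y \<partial>lborel)
        = (\<integral>\<^sup>+y. F (x + (1 - s) *\<^sub>R (y - x)) * indicator B y * indicator B x \<partial>lborel)"
        by (intro nn_integral_cong) (simp add: e mult_ac)
      also have "\<dots> = (\<integral>\<^sup>+y\<in>B. F (x + (1 - s) *\<^sub>R (y - x)) \<partial>lborel) * indicator B x"
        by (rule nn_integral_multc) measurable
      finally show "(\<integral>\<^sup>+y. F (y + s *\<^sub>R (x - y)) * indicator B x * indicator B y \<partial>lborel) = (\<integral>\<^sup>+y\<in>B. F (x + (1 - s) *\<^sub>R (y - x)) \<partial>lborel) * indicator B x" .
    qed
    also have "\<dots> \<le> ?R" using segment_average_fixed[OF _ _ B, of F "1 - s"] s False by simp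
    finally show ?thesis .
  qed
  have "?L = (\<integral>\<^sup>+y. (\<integral>\<^sup>+x. (\<integral>\<^sup>+s. F (y + s *\<^sub>R (x - y)) * indicator {0..1} s * indicator B x * indicator B y \<partial>lborel) \<partial>lborel) \<partial>lborel)"
    by (intro nn_integral_cong) (simp add: nn_integral_multc)
  also have "\<dots> = (\<integral>\<^sup>+y. (\<integral>\<^sup>+s. (\<integral>\<^sup>+x. F (y + s *\<^sub>R (x - y)) * indicator {0..1} s * indicator B x * indicator B y \<partial>lborel) \<partial>lborel) \<partial>lborel)"
    by (intro nn_integral_cong lborel_pair.Fubini') measurable
  also have "\<dots> = (\<integral>\<^sup>+s. (\<integral>\<^sup>+y. (\<integral>\<^sup>+x. F (y + s *\<^sub>R (x - y)) * indicator {0..1} s * indicator B x * indicator B y \<partial>lborel) \<partial>lborel) \<partial>lborel)"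
    by (rule lborel_pair.Fubini') measurable
  also have "\<dots> \<le> (\<integral>\<^sup>+(s::real). ?R * indicator {0..1} s \<partial>lborel)"
  proof (rule nn_integral_mono)
    fix s :: real
    have "(\<integral>\<^sup>+y. (\<integral>\<^sup>+x. F (y + s *\<^sub>R (x - y)) * indicator {0..1} s * indicator B x * indicator B y \<partial>lborel) \<partial>lborel)
      = (\<integral>\<^sup>+y. (\<integral>\<^sup>+x. F (y + s *\<^sub>R (x - y)) * indicator B x * indicator B y * indicator {0..1} s \<partial>lborel) \<partial>lborel)"
      by (simp add: mult_ac)
    also have "\<dots> = (\<integral>\<^sup>+y\<in>B. (\<integral>\<^sup>+x\<in>B. F (y + s *\<^sub>R (x - y)) \<partial>lborel) \<partial>lborel) * indicator {0..1} s"
      by (simp add: nn_integral_multc)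
    also have "\<dots> \<le> ?R * indicator {0..1} s"
      using fixed[of s] by (auto simp: indicator_def)
    finally show "(\<integral>\<^sup>+y. (\<integral>\<^sup>+x. F (y + s *\<^sub>R (x - y)) * indicator {0..1} s * indicator B x * indicator B y \<partial>lborel) \<partial>lborel) \<le> ?R * indicator {0..1} s" .
  qed
  also have "\<dots> = ?R" by (simp add: nn_integral_cmult_indicator)
  finally show ?thesis .
qed

text \<open>
  A continuously differentiable field with its gradient; as in \<open>has_weak_gradient\<close>, the rows of \<open>G x\<close>
  are the partial derivatives.
\<close>

definition has_gradient :: "(real^'n::finite \<Rightarrow> real^'n) \<Rightarrow> (real^'n \<Rightarrow> real^'n^'n) \<Rightarrow> bool" where
  "has_gradient v G \<longleftrightarrow> continuous_on UNIV G \<and> (\<forall>x. (v has_derivative (\<lambda>h. h v* G x)) (at x))"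

text \<open>
  Expand the integral of \<open>(k - m)\<^sup>2 \<ge> 0\<close>, where \<open>m\<close> is the mean of \<open>k\<close>.
\<close>

lemma square_integral_le:
  fixes k :: "real \<Rightarrow> real"
  assumes "continuous_on {0..1} k"
  shows "(integral {0..1} k)\<^sup>2 \<le> integral {0..1} (\<lambda>s. (k s)\<^sup>2)"
proof -
  define m where "m = integral {0..1} k"
  have i: "k integrable_on {0..1}" "(\<lambda>s. (k s)\<^sup>2) integrable_on {0..1}"
    by (rule integrable_continuous_real, intro continuous_intros assms)+
  have "((\<lambda>s. (k s)\<^sup>2 - (2 * m) * k s + m\<^sup>2) has_integral (integral {0..1} (\<lambda>s. (k s)\<^sup>2) - (2 * m) * m + (1 - 0) *\<^sub>R m\<^sup>2)) {0..1}"
    using i has_integral_const_real[of "m\<^sup>2" 0 1]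
    by (intro has_integral_add has_integral_diff has_integral_mult_right) (auto simp: m_def integrable_integral)
  moreover have "(k s)\<^sup>2 - (2 * m) * k s + m\<^sup>2 = (k s - m)\<^sup>2" for s
    by (simp add: power2_eq_square algebra_simps)
  ultimately have "0 \<le> integral {0..1} (\<lambda>s. (k s)\<^sup>2) - (2 * m) * m + (1 - 0) *\<^sub>R m\<^sup>2"
    using has_integral_nonneg by (metis (lifting) zero_le_power2)
  then show ?thesis by (simp add: m_def power2_eq_square)
qed

lemma increment_square_le:
  fixes \<phi> :: "real \<Rightarrow> real"
  assumes d: "\<And>s. s \<in> {0..1} \<Longrightarrow> (\<phi> has_real_derivative \<phi>' s) (at s within {0..1})"
    and c: "continuous_on {0..1} \<phi>'"
  shows "ennreal ((\<phi> 1 - \<phi> 0)\<^sup>2) \<le> (\<integral>\<^sup>+s\<in>{0..1}. ennreal ((\<phi>' s)\<^sup>2) \<partial>lborel)"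
proof -
  have "(\<phi>' has_integral \<phi> 1 - \<phi> 0) {0..1}"
    by (rule fundamental_theorem_of_calculus) (use d in \<open>auto simp: has_real_derivative_iff_has_vector_derivative\<close>)
  then have "(\<phi> 1 - \<phi> 0)\<^sup>2 \<le> integral {0..1} (\<lambda>s. (\<phi>' s)\<^sup>2)"
    using square_integral_le[OF c] by (simp add: integral_unique)
  also have "ennreal (integral {0..1} (\<lambda>s. (\<phi>' s)\<^sup>2)) = (\<integral>\<^sup>+s\<in>{0..1}. ennreal ((\<phi>' s)\<^sup>2) \<partial>lborel)"
  proof -
    have "((\<lambda>s. (\<phi>' s)\<^sup>2) has_integral integral {0..1} (\<lambda>s. (\<phi>' s)\<^sup>2)) {0..1}"
      by (intro integrable_integral integrable_continuous_real continuous_intros c)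
    from nn_integral_has_integral_lebesgue'[OF _ this] show ?thesis by simp
  qed
  finally show ?thesis by (simp add: ennreal_leI)
qed

section \<open>Increments of differentiable fields\<close>

lemma norm_vector_matrix_mult_le:
  fixes h :: "real^'n::finite" and A :: "real^'m::finite^'n"
  shows "norm (h v* A) \<le> norm h * norm A"
proof -
  have "h v* A = (\<Sum>i\<in>UNIV. (h $ i) *\<^sub>R (A $ i))"
    by (simp add: vec_eq_iff vector_matrix_mult_def)
  then have "norm (h v* A) \<le> (\<Sum>i\<in>UNIV. \<bar>h $ i\<bar> * \<bar>norm (A $ i)\<bar>)"
    using norm_sum[of "\<lambda>i. (h $ i) *\<^sub>R (A $ i)" UNIV] by simp
  also have "\<dots> \<le> L2_set (\<lambda>i. h $ i) UNIV * L2_set (\<lambda>i. norm (A $ i)) UNIV"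
    by (rule L2_set_mult_ineq)
  also have "\<dots> = norm h * norm A" by (simp add: norm_vec_def L2_set_def)
  finally show ?thesis .
qed

text \<open>
  A quadratic form sees only the symmetric part; this is how the symmetric gradient enters.
\<close>

lemma inner_vector_matrix_sym_part:
  "h \<bullet> (h v* A) = h \<bullet> (h v* sym_part A)"
proof -
  have "h \<bullet> (h v* transpose A) = h \<bullet> (h v* A)"
    by (metis dot_lmul_matrix inner_commute vector_transpose_matrix)
  then show ?thesis
    by (simp add: sym_part_def vector_scaleR_matrix_ac vector_matrix_mult_add_rdistrib inner_add_right del: vector_transpose_matrix)
qed

lemma has_gradient_continuous: "has_gradient v G \<Longrightarrow> continuous_on UNIV v"
  unfolding has_gradient_def by (meson has_derivative_continuous continuous_at_imp_continuous_on)

lemma borel_measurable_has_gradient: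
  assumes "has_gradient v G"
  shows "v \<in> borel_measurable borel" "G \<in> borel_measurable borel"
  using assms has_gradient_continuous[OF assms]
  by (auto simp: has_gradient_def intro: borel_measurable_continuous_onI)

lemma has_gradient_increment:
  assumes v: "has_gradient v G"
  shows "ennreal ((u \<bullet> (v x - v y))\<^sup>2) \<le> (\<integral>\<^sup>+s\<in>{0..1}. ennreal ((u \<bullet> ((x - y) v* G (y + s *\<^sub>R (x - y))))\<^sup>2) \<partial>lborel)"
proof -
  have d: "(v has_derivative (\<lambda>h. h v* G x)) (at x)" and c: "continuous_on UNIV G" for x
    using v by (auto simp: has_gradient_def)
  define \<phi> where "\<phi> s = u \<bullet> v (y + s *\<^sub>R (x - y))" for s :: real
  define \<phi>' where "\<phi>' s = u \<bullet> ((x - y) v* G (y + s *\<^sub>R (x - y)))" for s :: real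
  have "(\<phi> has_real_derivative \<phi>' s) (at s within {0..1})" for s
  proof -
    have 1: "((\<lambda>s. y + s *\<^sub>R (x - y)) has_derivative (\<lambda>s. s *\<^sub>R (x - y))) (at s within {0..1})"
      by (auto intro!: derivative_eq_intros)
    have "(\<phi> has_derivative (\<lambda>t. u \<bullet> ((t *\<^sub>R (x - y)) v* G (y + s *\<^sub>R (x - y))))) (at s within {0..1})"
      unfolding \<phi>_def by (intro has_derivative_inner_right has_derivative_compose[OF 1 d])
    moreover have "u \<bullet> ((t *\<^sub>R (x - y)) v* G (y + s *\<^sub>R (x - y))) = \<phi>' s * t" for t
      by (simp add: \<phi>'_def scaleR_vector_matrix_assoc)
    ultimately show ?thesis by (simp add: has_field_derivative_def)
  qed
  moreover have "continuous_on {0..1} \<phi>'"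
  proof -
    have "continuous_on {0..1} (\<lambda>s. G (y + s *\<^sub>R (x - y)))"
      by (rule continuous_on_compose2[OF c]) (auto intro!: continuous_intros)
    then show ?thesis unfolding \<phi>'_def vector_matrix_mult_def by (auto intro!: continuous_intros)
  qed
  ultimately have "ennreal ((\<phi> 1 - \<phi> 0)\<^sup>2) \<le> (\<integral>\<^sup>+s\<in>{0..1}. ennreal ((\<phi>' s)\<^sup>2) \<partial>lborel)"
    by (rule increment_square_le)
  then show ?thesis by (simp add: \<phi>_def \<phi>'_def inner_diff_right)
qed

text \<open>
  The two cases of interest are \<open>u\<close> in the direction of the increment, with \<open>E = G\<close>, and
  \<open>u = x - y\<close>, with the symmetric part of \<open>G\<close> as \<open>E\<close>.
\<close>

lemma has_gradient_increment_le:
  assumes v: "has_gradient v G" and le: "\<And>z. \<bar>u \<bullet> ((x - y) v* G z)\<bar> \<le> K * norm (E z)" and K: "0 \<le> K"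
    and [measurable]: "E \<in> borel_measurable borel"
  shows "ennreal ((u \<bullet> (v x - v y))\<^sup>2) \<le> ennreal (K\<^sup>2) * (\<integral>\<^sup>+s\<in>{0..1}. ennreal ((norm (E (y + s *\<^sub>R (x - y))))\<^sup>2) \<partial>lborel)"
proof -
  have "ennreal ((u \<bullet> (v x - v y))\<^sup>2) \<le> (\<integral>\<^sup>+s\<in>{0..1}. ennreal ((u \<bullet> ((x - y) v* G (y + s *\<^sub>R (x - y))))\<^sup>2) \<partial>lborel)"
    by (rule has_gradient_increment[OF v])
  also have "\<dots> \<le> (\<integral>\<^sup>+s. ennreal (K\<^sup>2) * (ennreal ((norm (E (y + s *\<^sub>R (x - y))))\<^sup>2) * indicator {0..1} s) \<partial>lborel)"
  proof (rule nn_integral_mono)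
    fix s :: real
    have "(u \<bullet> ((x - y) v* G (y + s *\<^sub>R (x - y))))\<^sup>2 \<le> K\<^sup>2 * (norm (E (y + s *\<^sub>R (x - y))))\<^sup>2"
      using power_mono[OF le, of "y + s *\<^sub>R (x - y)" 2] by (simp add: power_mult_distrib)
    then show "ennreal ((u \<bullet> ((x - y) v* G (y + s *\<^sub>R (x - y))))\<^sup>2) * indicator {0..1} s
      \<le> ennreal (K\<^sup>2) * (ennreal ((norm (E (y + s *\<^sub>R (x - y))))\<^sup>2) * indicator {0..1} s)"
      using ennreal_leI by (fastforce simp: indicator_def ennreal_mult[symmetric])
  qed
  also have "\<dots> = ennreal (K\<^sup>2) * (\<integral>\<^sup>+s\<in>{0..1}. ennreal ((norm (E (y + s *\<^sub>R (x - y))))\<^sup>2) \<partial>lborel)"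
    by (rule nn_integral_cmult) measurable
  finally show ?thesis .
qed

lemma has_gradient_norm_increment:
  assumes v: "has_gradient v G"
  shows "ennreal ((norm (v x - v y))\<^sup>2) \<le> ennreal ((norm (x - y))\<^sup>2) * (\<integral>\<^sup>+s\<in>{0..1}. ennreal ((norm (G (y + s *\<^sub>R (x - y))))\<^sup>2) \<partial>lborel)"
proof -
  define u where "u = sgn (v x - v y)"
  have e: "u \<bullet> (v x - v y) = norm (v x - v y)"
    by (cases "v x = v y") (simp_all add: u_def sgn_div_norm power2_norm_eq_inner[symmetric] power2_eq_square)
  have "\<bar>u \<bullet> ((x - y) v* G z)\<bar> \<le> norm (x - y) * norm (G z)" for z
  proof -
    have "\<bar>u \<bullet> ((x - y) v* G z)\<bar> \<le> norm u * norm ((x - y) v* G z)" by (rule Cauchy_Schwarz_ineq2)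
    also have "\<dots> \<le> 1 * norm ((x - y) v* G z)" by (intro mult_right_mono) (auto simp: u_def norm_sgn)
    finally show ?thesis using norm_vector_matrix_mult_le[of "x - y" "G z"] by simp
  qed
  from has_gradient_increment_le[OF v this] borel_measurable_has_gradient[OF v] show ?thesis by (simp add: e)
qed

lemma has_gradient_radial_increment:
  assumes v: "has_gradient v G"
  shows "ennreal (((x - y) \<bullet> (v x - v y))\<^sup>2) \<le> ennreal (((norm (x - y))\<^sup>2)\<^sup>2) * (\<integral>\<^sup>+s\<in>{0..1}. ennreal ((norm (sym_part (G (y + s *\<^sub>R (x - y)))))\<^sup>2) \<partial>lborel)"
proof (rule has_gradient_increment_le[OF v])
  fix z
  have "\<bar>(x - y) \<bullet> ((x - y) v* G z)\<bar> \<le> norm (x - y) * norm ((x - y) v* sym_part (G z))"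
    unfolding inner_vector_matrix_sym_part[of _ "G z"] by (rule Cauchy_Schwarz_ineq2)
  also have "\<dots> \<le> norm (x - y) * (norm (x - y) * norm (sym_part (G z)))"
    by (intro mult_left_mono norm_vector_matrix_mult_le) auto
  finally show "\<bar>(x - y) \<bullet> ((x - y) v* G z)\<bar> \<le> (norm (x - y))\<^sup>2 * norm (sym_part (G z))"
    by (simp add: power2_eq_square mult_ac)
next
  have "continuous_on UNIV (\<lambda>x. sym_part (G x))"
    using v unfolding has_gradient_def sym_part_def transpose_def by (auto intro!: continuous_intros)
  then show "(\<lambda>x. sym_part (G x)) \<in> borel_measurable borel" by (rule borel_measurable_continuous_onI)
qed auto

text \<open>
  Used to subtract the value at a well-chosen point where one would usually subtract a mean value.
\<close>

lemma nn_integral_pigeonhole: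
  assumes [measurable]: "g \<in> borel_measurable M" "B \<in> sets M"
    and le: "(\<integral>\<^sup>+y\<in>B. g y \<partial>M) \<le> K * emeasure M B" and B: "0 < emeasure M B" "emeasure M B < \<infinity>"
  obtains y where "y \<in> B" "g y \<le> K"
proof (rule ccontr)
  assume "\<not> thesis"
  then have gt: "y \<in> B \<Longrightarrow> K < g y" for y using that not_le by blast
  have "B \<noteq> {}" using B by auto
  then obtain y0 where "K < g y0" using gt by blast
  then have K: "K < \<infinity>" using less_le_trans[OF _ top_greatest] by (simp add: infinity_ennreal_def)
  have "(\<integral>\<^sup>+y. K * indicator B y \<partial>M) < (\<integral>\<^sup>+y\<in>B. g y \<partial>M)"
  proof (rule nn_integral_less)
    show "(\<integral>\<^sup>+y. K * indicator B y \<partial>M) \<noteq> \<infinity>"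
      using K B by (simp add: nn_integral_cmult_indicator ennreal_mult_eq_top_iff less_top)
    show "AE y in M. K * indicator B y \<le> g y * indicator B y"
      using gt by (auto simp: indicator_def less_imp_le)
    show "\<not> (AE y in M. g y * indicator B y \<le> K * indicator B y)"
    proof
      assume "AE y in M. g y * indicator B y \<le> K * indicator B y"
      then have "AE y in M. y \<notin> B"
        by eventually_elim (use gt in \<open>auto simp: indicator_def not_le[symmetric] split: if_splits\<close>)
      then have "emeasure M B = 0"
        by (subst (asm) AE_iff_measurable[of B]) (use sets.sets_into_space[OF assms(2)] in auto)
      then show False using B by simp
    qed
  qed auto
  then show False using le by (simp add: nn_integral_cmult_indicator)
qed

lemma emeasure_ball_pos_finite:
  fixes a :: "'a::euclidean_space"
  assumes "r > 0"
  shows "0 < emeasure lborel (ball a r)" "emeasure lborel (ball a r) < \<infinity>"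
proof -
  show "emeasure lborel (ball a r) < \<infinity>" using emeasure_bounded_finite[of "ball a r"] by (simp add: less_top)
  have "emeasure lborel (ball a r) \<noteq> 0"
    using assms open_not_negligible[of "ball a r"]
    by (auto simp: negligible_iff_emeasure0)
  then show "0 < emeasure lborel (ball a r)" by (simp add: zero_less_iff_neq_zero)
qed

text \<open>
  Average \<open>\<bar>v x - v y\<bar>\<^sup>2\<close> over \<open>x\<close> and \<open>y\<close>, and choose \<open>y\<close> with
  at most average deviation.
\<close>

lemma poincare_ball:
  fixes v :: "real^'n::finite \<Rightarrow> real^'n"
  assumes v: "has_gradient v G" and r: "r > 0"
  shows "\<exists>c. energy (ball a r) (\<lambda>x. v x - c) \<le> ennreal (2 ^ CARD('n) * (2 * r)\<^sup>2) * energy (ball a r) G"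
proof -
  define B where "B = ball a r"
  note [measurable] = borel_measurable_has_gradient[OF v]
  have [measurable]: "B \<in> sets borel" by (simp add: B_def)
  note m = emeasure_ball_pos_finite[OF r, of a, folded B_def]
  have "(\<integral>\<^sup>+y\<in>B. (\<integral>\<^sup>+x\<in>B. ennreal ((norm (v x - v y))\<^sup>2) \<partial>lborel) \<partial>lborel)
    \<le> (\<integral>\<^sup>+y. ennreal ((2 * r)\<^sup>2) * ((\<integral>\<^sup>+x\<in>B. (\<integral>\<^sup>+s\<in>{0..1}. ennreal ((norm (G (y + s *\<^sub>R (x - y))))\<^sup>2) \<partial>lborel) \<partial>lborel) * indicator B y) \<partial>lborel)"
  proof (rule nn_integral_mono)
    fix y
    show "(\<integral>\<^sup>+x\<in>B. ennreal ((norm (v x - v y))\<^sup>2) \<partial>lborel) * indicator B y \<le> ennreal ((2 * r)\<^sup>2) * ((\<integral>\<^sup>+x\<in>B. (\<integral>\<^sup>+s\<in>{0..1}. ennreal ((norm (G (y + s *\<^sub>R (x - y))))\<^sup>2) \<partial>lborel) \<partial>lborel) * indicator B y)"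
    proof (cases "y \<in> B")
      case y: True
      have "(\<integral>\<^sup>+x\<in>B. ennreal ((norm (v x - v y))\<^sup>2) \<partial>lborel) \<le> (\<integral>\<^sup>+x. ennreal ((2 * r)\<^sup>2) * ((\<integral>\<^sup>+s\<in>{0..1}. ennreal ((norm (G (y + s *\<^sub>R (x - y))))\<^sup>2) \<partial>lborel) * indicator B x) \<partial>lborel)"
      proof (rule nn_integral_mono)
        fix x
        show "ennreal ((norm (v x - v y))\<^sup>2) * indicator B x \<le> ennreal ((2 * r)\<^sup>2) * ((\<integral>\<^sup>+s\<in>{0..1}. ennreal ((norm (G (y + s *\<^sub>R (x - y))))\<^sup>2) \<partial>lborel) * indicator B x)"
        proof (cases "x \<in> B")
          case x: True
          have "norm (x - y) \<le> 2 * r"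
            using x y dist_triangle2[of x y a] by (auto simp: B_def dist_norm norm_minus_commute)
          then have "ennreal ((norm (x - y))\<^sup>2) \<le> ennreal ((2 * r)\<^sup>2)"
            by (intro ennreal_leI power_mono) auto
          from order_trans[OF has_gradient_norm_increment[OF v] mult_right_mono[OF this]] x
          show ?thesis by simp
        qed simp
      qed
      also have "\<dots> = ennreal ((2 * r)\<^sup>2) * (\<integral>\<^sup>+x\<in>B. (\<integral>\<^sup>+s\<in>{0..1}. ennreal ((norm (G (y + s *\<^sub>R (x - y))))\<^sup>2) \<partial>lborel) \<partial>lborel)"
        by (rule nn_integral_cmult) measurable
      finally show ?thesis using y by simp
    qed simp
  qed
  also have "\<dots> = ennreal ((2 * r)\<^sup>2) * (\<integral>\<^sup>+y\<in>B. (\<integral>\<^sup>+x\<in>B. (\<integral>\<^sup>+s\<in>{0..1}. ennreal ((norm (G (y + s *\<^sub>R (x - y))))\<^sup>2) \<partial>lborel) \<partial>lborel) \<partial>lborel)"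
    by (rule nn_integral_cmult) measurable
  also have "\<dots> \<le> ennreal ((2 * r)\<^sup>2) * (ennreal (2 ^ DIM(real^'n)) * emeasure lborel B * (\<integral>\<^sup>+z\<in>B. ennreal ((norm (G z))\<^sup>2) \<partial>lborel))"
    by (intro mult_left_mono segment_average) (auto simp: B_def)
  also have "\<dots> = ennreal (2 ^ CARD('n) * (2 * r)\<^sup>2) * energy B G * emeasure lborel B"
    by (simp add: energy_def ennreal_mult mult_ac)
  finally obtain y where "(\<integral>\<^sup>+x\<in>B. ennreal ((norm (v x - v y))\<^sup>2) \<partial>lborel) \<le> ennreal (2 ^ CARD('n) * (2 * r)\<^sup>2) * energy B G"
    by (rule nn_integral_pigeonhole[rotated 2]) (use m in auto)
  then show ?thesis by (auto simp: energy_def B_def)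
qed

section \<open>Integration by parts and Korn's first inequality\<close>

lemma emeasure_lborel_cball_less_top: "emeasure lborel (cball (a::'a::euclidean_space) r) < top"
  using emeasure_bounded_finite[of "cball a r"] by (simp add: less_top)

definition scalar_gradient :: "('a::euclidean_space \<Rightarrow> real) \<Rightarrow> ('a \<Rightarrow> 'a) \<Rightarrow> bool" where
  "scalar_gradient a ga \<longleftrightarrow> continuous_on UNIV ga \<and> (\<forall>x. (a has_derivative (\<lambda>h. ga x \<bullet> h)) (at x))"

lemma scalar_gradient_continuous: "scalar_gradient a ga \<Longrightarrow> continuous_on UNIV a"
  unfolding scalar_gradient_def by (meson has_derivative_continuous continuous_at_imp_continuous_on)

lemma scalar_gradient_mult:
  assumes "scalar_gradient a ga" "scalar_gradient b gb"
  shows "scalar_gradient (\<lambda>x. a x * b x) (\<lambda>x. a x *\<^sub>R gb x + b x *\<^sub>R ga x)"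
  using assms scalar_gradient_continuous[OF assms(1)] scalar_gradient_continuous[OF assms(2)]
  unfolding scalar_gradient_def
  by (auto intro!: continuous_intros derivative_eq_intros simp: inner_add_left algebra_simps)

lemma scalar_gradient_outside:
  assumes a: "scalar_gradient a ga" and z: "\<And>x. R < norm x \<Longrightarrow> a x = 0" and x: "R < norm x"
  shows "ga x = 0"
proof -
  have "open {x. R < norm x}" by (intro open_Collect_less continuous_intros)
  then have "(a has_derivative (\<lambda>h. 0)) (at x)"
    by (rule has_derivative_transform_within_open[OF has_derivative_const[of 0]]) (use z x in auto)
  moreover have "(a has_derivative (\<lambda>h. ga x \<bullet> h)) (at x)" using a by (auto simp: scalar_gradient_def)
  ultimately have "(\<lambda>h. ga x \<bullet> h) = (\<lambda>h. 0)" by (rule has_derivative_unique[symmetric])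
  then have "ga x \<bullet> ga x = 0" by metis
  then show ?thesis by simp
qed

text \<open>
  A single multiple of the indicator of a ball dominates all difference quotients with step at most one, as dominated convergence requires.
\<close>

lemma scalar_gradient_quotient:
  fixes a :: "'a::euclidean_space \<Rightarrow> real"
  assumes a: "scalar_gradient a ga" and z: "\<And>x. R < norm x \<Longrightarrow> a x = 0"
  obtains M \<rho> :: real where "0 \<le> M" "0 < \<rho>" "\<And>x t. \<bar>t\<bar> \<le> 1 \<Longrightarrow> \<bar>(a (x + t *\<^sub>R e) - a x) / t\<bar> \<le> M * indicator (cball 0 \<rho>) x"
proof -
  have "bounded (ga ` cball 0 R)"
    using a by (intro compact_imp_bounded compact_continuous_image) (auto simp: scalar_gradient_def intro: continuous_on_subset)
  then obtain K where "0 < K" and K0: "\<And>x. norm x \<le> R \<Longrightarrow> norm (ga x) \<le> K" by (fastforce simp: bounded_pos)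
  have K: "norm (ga x) \<le> K" for x
    using scalar_gradient_outside[OF a z] K0[of x] \<open>0 < K\<close> by (cases "norm x \<le> R") auto
  have lip: "norm (a y - a x) \<le> K * norm (y - x)" for x y
  proof (rule differentiable_bound[of UNIV a "\<lambda>x h. ga x \<bullet> h"])
    fix x
    show "(a has_derivative (\<lambda>h. ga x \<bullet> h)) (at x within UNIV)" using a by (simp add: scalar_gradient_def)
    show "onorm (\<lambda>h. ga x \<bullet> h) \<le> K"
      by (rule onorm_le) (metis K Cauchy_Schwarz_ineq2 real_norm_def mult_right_mono norm_ge_zero order_trans)
  qed auto
  define \<rho> where "\<rho> = \<bar>R\<bar> + norm e + 1"
  show ?thesis
  proof (rule that[of "K * norm e" \<rho>])
    fix x :: 'a and t :: real assume t: "\<bar>t\<bar> \<le> 1"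
    show "\<bar>(a (x + t *\<^sub>R e) - a x) / t\<bar> \<le> K * norm e * indicator (cball 0 \<rho>) x"
    proof (cases "norm x \<le> \<rho>")
      case True
      have "\<bar>a (x + t *\<^sub>R e) - a x\<bar> \<le> K * (\<bar>t\<bar> * norm e)" using lip[of "x + t *\<^sub>R e" x] by simp
      then show ?thesis using True \<open>0 < K\<close> by (cases "t = 0") (auto simp: field_simps)
    next
      case False
      have "norm (t *\<^sub>R e) \<le> norm e" using t by (simp add: mult_left_le_one_le)
      then have "R < norm (x + t *\<^sub>R e)" "R < norm x"
        using False norm_triangle_ineq4[of "x + t *\<^sub>R e" "t *\<^sub>R e"] norm_ge_zero[of e] abs_ge_self[of R]
        unfolding \<rho>_def add_diff_cancel_right' by linarith+
      then have "a (x + t *\<^sub>R e) = 0" "a x = 0" using z by auto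
      then show ?thesis using \<open>0 < K\<close> by (simp add: indicator_def)
    qed
  qed (use \<open>0 < K\<close> in \<open>auto simp: \<rho>_def intro: add_nonneg_pos\<close>)
qed

lemma scalar_gradient_quotient_tendsto:
  assumes a: "scalar_gradient a ga"
  assumes t: "t \<longlonglongrightarrow> 0" "\<And>k. t k \<noteq> 0"
  shows "(\<lambda>k::nat. (a (x + t k *\<^sub>R e) - a x) / t k) \<longlonglongrightarrow> ga x \<bullet> e"
proof -
  have "((\<lambda>s. a (x + s *\<^sub>R e)) has_derivative (\<lambda>s. ga x \<bullet> (s *\<^sub>R e))) (at 0)"
    by (rule has_derivative_compose[of "\<lambda>s. x + s *\<^sub>R e" "\<lambda>s. s *\<^sub>R e" 0 UNIV a])
       (use a in \<open>auto simp: scalar_gradient_def intro!: derivative_eq_intros\<close>)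
  then have "DERIV (\<lambda>s. a (x + s *\<^sub>R e)) 0 :> ga x \<bullet> e"
    by (simp add: has_field_derivative_def mult_commute_abs)
  then have "((\<lambda>s. (a (x + s *\<^sub>R e) - a x) / s) \<longlongrightarrow> ga x \<bullet> e) (at 0)"
    by (simp add: has_field_derivative_iff)
  from filterlim_compose[OF this, of t sequentially] t show ?thesis
    by (simp add: filterlim_at)
qed

lemma integrable_lborel_bounded_support:
  fixes f :: "'a::euclidean_space \<Rightarrow> real"
  assumes "f \<in> borel_measurable borel" "\<And>x. \<bar>f x\<bar> \<le> M * indicator (cball 0 \<rho>) x"
  shows "integrable lborel f"
proof (rule Bochner_Integration.integrable_bound)
  show "integrable lborel (\<lambda>x::'a. M * indicator (cball 0 \<rho>) x)"
    by (intro integrable_mult_right integrable_real_indicator) (auto simp: emeasure_lborel_cball_less_top)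
qed (use assms in \<open>auto intro: order_trans[OF _ abs_ge_self]\<close>)

lemma integral_lborel_translate:
  fixes f :: "'a::euclidean_space \<Rightarrow> real"
  assumes [measurable]: "f \<in> borel_measurable borel"
  shows "(\<integral>x. f (x + t) \<partial>lborel) = (\<integral>x. f x \<partial>lborel)"
    "integrable lborel f \<Longrightarrow> integrable lborel (\<lambda>x. f (x + t))"
proof -
  have "(\<integral>x. f x \<partial>distr lborel borel ((+) t)) = (\<integral>x. f (t + x) \<partial>lborel)" by (rule integral_distr) auto
  then show "(\<integral>x. f (x + t) \<partial>lborel) = (\<integral>x. f x \<partial>lborel)" by (simp add: lborel_distr_plus add.commute)
  show "integrable lborel (\<lambda>x. f (x + t))" if "integrable lborel f"
    using integrable_distr[of "(+) t" lborel borel f] that by (simp add: lborel_distr_plus add.commute)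
qed

lemma integral_mult_directional_derivatives_tendsto:
  fixes a b :: "'a::euclidean_space \<Rightarrow> real"
  assumes a: "scalar_gradient a ga" "\<And>x. R < norm x \<Longrightarrow> a x = 0"
    and b: "scalar_gradient b gb" "\<And>x. R < norm x \<Longrightarrow> b x = 0"
    and t: "t \<longlonglongrightarrow> 0" "\<And>k. t k \<noteq> 0" "\<And>k. \<bar>t k\<bar> \<le> 1"
  shows "(\<lambda>k::nat. \<integral>x. ((a (x + t k *\<^sub>R e) - a x) / t k) * ((b (x + t k *\<^sub>R e') - b x) / t k) \<partial>lborel)
     \<longlonglongrightarrow> (\<integral>x. (ga x \<bullet> e) * (gb x \<bullet> e') \<partial>lborel)"
proof -
  from scalar_gradient_quotient[OF a, of R e] obtain M1 \<rho>1 where q1: "0 \<le> M1" "0 < \<rho>1"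
    "\<And>x t. \<bar>t\<bar> \<le> 1 \<Longrightarrow> \<bar>(a (x + t *\<^sub>R e) - a x) / t\<bar> \<le> M1 * indicator (cball 0 \<rho>1) x" by blast
  from scalar_gradient_quotient[OF b, of R e'] obtain M2 \<rho>2 where q2: "0 \<le> M2" "0 < \<rho>2"
    "\<And>x t. \<bar>t\<bar> \<le> 1 \<Longrightarrow> \<bar>(b (x + t *\<^sub>R e') - b x) / t\<bar> \<le> M2 * indicator (cball 0 \<rho>2) x" by blast
  note [continuous_intros] = continuous_on_compose2[OF scalar_gradient_continuous[OF a(1)]]
    continuous_on_compose2[OF scalar_gradient_continuous[OF b(1)]]
  have [measurable]: "a \<in> borel_measurable borel" "b \<in> borel_measurable borel"
    "ga \<in> borel_measurable borel" "gb \<in> borel_measurable borel"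
    using scalar_gradient_continuous[OF a(1)] scalar_gradient_continuous[OF b(1)] a(1) b(1)
    by (auto intro: borel_measurable_continuous_onI simp: scalar_gradient_def)
  show ?thesis
  proof (rule integral_dominated_convergence)
    show "integrable lborel (\<lambda>x::'a. M1 * M2 * indicator (cball 0 \<rho>1) x)"
      by (intro integrable_mult_right integrable_real_indicator) (auto simp: emeasure_lborel_cball_less_top)
    show "AE x in lborel. (\<lambda>k. ((a (x + t k *\<^sub>R e) - a x) / t k) * ((b (x + t k *\<^sub>R e') - b x) / t k)) \<longlonglongrightarrow> (ga x \<bullet> e) * (gb x \<bullet> e')"
      by (intro AE_I2 tendsto_mult scalar_gradient_quotient_tendsto a b t)
    fix k
    show "AE x in lborel. norm (((a (x + t k *\<^sub>R e) - a x) / t k) * ((b (x + t k *\<^sub>R e') - b x) / t k)) \<le> M1 * M2 * indicator (cball 0 \<rho>1) x"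
    proof (rule AE_I2)
      fix x :: 'a
      have "\<bar>(b (x + t k *\<^sub>R e') - b x) / t k\<bar> \<le> M2 * 1"
        using q2(3)[OF t(3), of x k] q2(1) by (cases "norm x \<le> \<rho>2") (auto simp del: abs_divide)
      from mult_mono[OF q1(3)[OF t(3), of x k] this] q1 q2
      show "norm (((a (x + t k *\<^sub>R e) - a x) / t k) * ((b (x + t k *\<^sub>R e') - b x) / t k)) \<le> M1 * M2 * indicator (cball 0 \<rho>1) x"
        by (simp add: abs_mult mult_ac)
    qed
  qed auto
qed

lemma reciprocal_sequence:
  defines "t \<equiv> \<lambda>k::nat. 1 / real (Suc k)"
  shows "t \<longlonglongrightarrow> 0" "t k \<noteq> 0" "\<bar>t k\<bar> \<le> 1"
  unfolding t_def by (rule LIMSEQ_Suc[OF lim_1_over_n]) auto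

text \<open>
  Integrating by parts twice would need second derivatives. Instead expand
  the integrals of products of difference quotients: by translation invariance, the steps \<open>t e\<close>, \<open>t e'\<close> on \<open>a\<close>, \<open>b\<close>
  give the same value as the steps \<open>- t e'\<close>, \<open>- t e\<close>. Let \<open>t\<close> tend to zero.
\<close>

lemma integral_directional_derivatives_commute:
  fixes a b :: "'a::euclidean_space \<Rightarrow> real"
  assumes a: "scalar_gradient a ga" "\<And>x. R < norm x \<Longrightarrow> a x = 0"
    and b: "scalar_gradient b gb" "\<And>x. R < norm x \<Longrightarrow> b x = 0"
  shows "(\<integral>x. (ga x \<bullet> e) * (gb x \<bullet> e') \<partial>lborel) = (\<integral>x. (ga x \<bullet> e') * (gb x \<bullet> e) \<partial>lborel)"
proof (rule LIMSEQ_unique)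
  define t where "t k = 1 / real (Suc k)" for k
  note t = reciprocal_sequence[folded t_def]
  have ca: "continuous_on UNIV a" and cb: "continuous_on UNIV b"
    using scalar_gradient_continuous a(1) b(1) by auto
  have [measurable]: "a \<in> borel_measurable borel" "b \<in> borel_measurable borel"
    using ca cb by (auto intro: borel_measurable_continuous_onI)
  show "(\<lambda>k::nat. \<integral>x. ((a (x + t k *\<^sub>R e) - a x) / t k) * ((b (x + t k *\<^sub>R e') - b x) / t k) \<partial>lborel)
     \<longlonglongrightarrow> (\<integral>x. (ga x \<bullet> e) * (gb x \<bullet> e') \<partial>lborel)"
    by (rule integral_mult_directional_derivatives_tendsto[OF a b t])
  have "bounded (b ` cball 0 R)"
    using cb by (intro compact_imp_bounded compact_continuous_image) (auto intro: continuous_on_subset)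
  then obtain Kb where Kb: "0 < Kb" "\<And>x. norm x \<le> R \<Longrightarrow> \<bar>b x\<bar> \<le> Kb" by (auto simp: bounded_pos)
  have Kb': "\<bar>b x\<bar> \<le> Kb" for x using Kb b(2)[of x] by (cases "norm x \<le> R") auto
  have "bounded (a ` cball 0 R)"
    using ca by (intro compact_imp_bounded compact_continuous_image) (auto intro: continuous_on_subset)
  then obtain Ka where Ka: "0 < Ka" "\<And>x. norm x \<le> R \<Longrightarrow> \<bar>a x\<bar> \<le> Ka" by (auto simp: bounded_pos)
  have int: "integrable lborel (\<lambda>x. a x * b (x + h))" for h
  proof (rule integrable_lborel_bounded_support)
    fix x
    show "\<bar>a x * b (x + h)\<bar> \<le> Ka * Kb * indicator (cball 0 R) x"
      using a(2)[of x] Ka Kb' by (auto simp: indicator_def abs_mult intro!: mult_mono)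
  qed measurable
  define J where "J h = (\<integral>x. a x * b (x + h) \<partial>lborel)" for h
  have sh: "(\<integral>x. a (x + p) * b (x + q) \<partial>lborel) = J (q - p)" "integrable lborel (\<lambda>x. a (x + p) * b (x + q))" for p q
    using integral_lborel_translate[of "\<lambda>x. a x * b (x + (q - p))" p] int[of "q - p"] by (simp_all add: J_def add.assoc)
  have ex: "(\<integral>x. (a (x + p) - a x) * (b (x + q) - b x) \<partial>lborel) = J (q - p) - J (- p) - J q + J 0" for p q
  proof -
    have "(\<integral>x. (a (x + p) - a x) * (b (x + q) - b x) \<partial>lborel)
      = (\<integral>x. a (x + p) * b (x + q) - a (x + p) * b (x + 0) - a (x + 0) * b (x + q) + a (x + 0) * b (x + 0) \<partial>lborel)"
      by (intro Bochner_Integration.integral_cong) (auto simp: algebra_simps)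
    also have "\<dots> = J (q - p) - J (0 - p) - J (q - 0) + J (0 - 0)"
      by (simp only: sh Bochner_Integration.integral_add Bochner_Integration.integral_diff Bochner_Integration.integrable_add Bochner_Integration.integrable_diff)
    finally show ?thesis by simp
  qed
  have ex': "(\<integral>x. ((a (x + p) - a x) / s) * ((b (x + q) - b x) / s) \<partial>lborel) = (J (q - p) - J (- p) - J q + J 0) / s\<^sup>2" for p q s
  proof -
    have "(\<integral>x. ((a (x + p) - a x) / s) * ((b (x + q) - b x) / s) \<partial>lborel) = (\<integral>x. ((a (x + p) - a x) * (b (x + q) - b x)) / s\<^sup>2 \<partial>lborel)"
      by (simp add: power2_eq_square)
    then show ?thesis by (simp add: ex)
  qed
  have eq: "(\<integral>x. ((a (x + t k *\<^sub>R e) - a x) / t k) * ((b (x + t k *\<^sub>R e') - b x) / t k) \<partial>lborel)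
    = (\<integral>x. ((a (x + (- t k) *\<^sub>R e') - a x) / - t k) * ((b (x + (- t k) *\<^sub>R e) - b x) / - t k) \<partial>lborel)" for k
    unfolding ex' by (simp add: algebra_simps)
  show "(\<lambda>k::nat. \<integral>x. ((a (x + t k *\<^sub>R e) - a x) / t k) * ((b (x + t k *\<^sub>R e') - b x) / t k) \<partial>lborel)
     \<longlonglongrightarrow> (\<integral>x. (ga x \<bullet> e') * (gb x \<bullet> e) \<partial>lborel)"
    unfolding eq
    by (rule integral_mult_directional_derivatives_tendsto[OF a b])
       (use t in \<open>auto intro: tendsto_minus_cancel_left[THEN iffD1]\<close>)
qed

text \<open>
  The integral of every difference quotient vanishes by translation invariance.
\<close>

lemma integral_directional_derivative_eq_0:
  fixes a :: "'a::euclidean_space \<Rightarrow> real"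
  assumes a: "scalar_gradient a ga" "\<And>x. R < norm x \<Longrightarrow> a x = 0"
  shows "(\<integral>x. ga x \<bullet> e \<partial>lborel) = 0"
proof (rule LIMSEQ_unique)
  define t where "t k = 1 / real (Suc k)" for k
  note t = reciprocal_sequence[folded t_def]
  from scalar_gradient_quotient[OF a, of R e] obtain M \<rho> where q: "0 \<le> M" "0 < \<rho>"
    "\<And>x t. \<bar>t\<bar> \<le> 1 \<Longrightarrow> \<bar>(a (x + t *\<^sub>R e) - a x) / t\<bar> \<le> M * indicator (cball 0 \<rho>) x" by blast
  have ca: "continuous_on UNIV a" using scalar_gradient_continuous a(1) by auto
  have [measurable]: "a \<in> borel_measurable borel" "ga \<in> borel_measurable borel"
    using ca a(1) by (auto intro: borel_measurable_continuous_onI simp: scalar_gradient_def)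
  show "(\<lambda>k::nat. \<integral>x. ((a (x + t k *\<^sub>R e) - a x) / t k) \<partial>lborel) \<longlonglongrightarrow> (\<integral>x. ga x \<bullet> e \<partial>lborel)"
  proof (rule integral_dominated_convergence)
    show "integrable lborel (\<lambda>x::'a. M * indicator (cball 0 \<rho>) x)"
      by (intro integrable_mult_right integrable_real_indicator) (auto simp: emeasure_lborel_cball_less_top)
    show "AE x in lborel. (\<lambda>k. (a (x + t k *\<^sub>R e) - a x) / t k) \<longlonglongrightarrow> ga x \<bullet> e"
      by (intro AE_I2 scalar_gradient_quotient_tendsto a t)
  qed (use q t in auto)
  have "bounded (a ` cball 0 R)"
    using ca by (intro compact_imp_bounded compact_continuous_image) (auto intro: continuous_on_subset)
  then obtain Ka where Ka: "0 < Ka" "\<And>x. norm x \<le> R \<Longrightarrow> \<bar>a x\<bar> \<le> Ka" by (auto simp: bounded_pos)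
  have "integrable lborel a"
    by (rule integrable_lborel_bounded_support[of _ Ka R]) (use Ka a(2) in \<open>auto simp: indicator_def\<close>)
  then have i0: "(\<integral>x. ((a (x + t k *\<^sub>R e) - a x) / t k) \<partial>lborel) = 0" for k
    using integral_lborel_translate[of a "t k *\<^sub>R e"] by (simp only: Bochner_Integration.integral_divide_zero) simp
  then show "(\<lambda>k::nat. \<integral>x. ((a (x + t k *\<^sub>R e) - a x) / t k) \<partial>lborel) \<longlonglongrightarrow> 0" unfolding i0 by simp
qed

lemma has_gradient_component:
  assumes "has_gradient v G"
  shows "scalar_gradient (\<lambda>x. v x $ j) (\<lambda>x. \<chi> i. G x $ i $ j)"
proof -
  have c: "continuous_on UNIV G" and d: "\<And>x. (v has_derivative (\<lambda>h. h v* G x)) (at x)"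
    using assms by (auto simp: has_gradient_def)
  have "((\<lambda>x. v x $ j) has_derivative (\<lambda>h. (h v* G x) $ j)) (at x)" for x
    by (rule bounded_linear.has_derivative[OF bounded_linear_vec_nth d])
  moreover have "(h v* G x) $ j = (\<chi> i. G x $ i $ j) \<bullet> h" for x h
    by (simp add: vector_matrix_mult_def inner_vec_def mult.commute)
  ultimately show ?thesis using c by (auto simp: scalar_gradient_def intro!: continuous_intros)
qed

lemma inner_matrix: "(A::real^'n::finite^'m::finite) \<bullet> B = (\<Sum>i\<in>UNIV. \<Sum>j\<in>UNIV. A $ i $ j * B $ i $ j)"
  by (simp add: inner_vec_def)

lemma norm_sym_part_le: "norm (sym_part A) \<le> norm A"
proof -
  have "norm (transpose A) = norm A"
  proof -
    have "transpose A \<bullet> transpose A = A \<bullet> A"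
      unfolding inner_matrix transpose_def by (subst sum.swap) simp
    then show ?thesis by (simp add: norm_eq_sqrt_inner)
  qed
  then show ?thesis using norm_triangle_ineq[of A "transpose A"] by (simp add: sym_part_def)
qed

text \<open>
  Since \<open>2 \<bar>sym G\<bar>\<^sup>2 = \<bar>G\<bar>\<^sup>2 + G \<bullet> transpose G\<close>, it suffices that \<open>G \<bullet> transpose G\<close> has nonnegative
  integral. Exchanging the directions of the two derivatives turns it into the square of the divergence.
\<close>

lemma korn_first:
  assumes u: "has_gradient u G" and z: "\<And>x. R < norm x \<Longrightarrow> u x = 0"
  shows "energy UNIV G \<le> 2 * energy UNIV (\<lambda>x. sym_part (G x))"
proof -
  note comp = has_gradient_component[OF u]
  have zc: "R < norm x \<Longrightarrow> u x $ j = 0" for x j using z by simp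
  have c: "continuous_on UNIV G" using u by (simp add: has_gradient_def)
  have G0: "G x = 0" if "R < norm x" for x
    using scalar_gradient_outside[OF comp zc that] by (simp add: vec_eq_iff)
  have "bounded (G ` cball 0 R)"
    using c by (intro compact_imp_bounded compact_continuous_image) (auto intro: continuous_on_subset)
  then obtain K where K: "0 < K" "\<And>x. norm x \<le> R \<Longrightarrow> norm (G x) \<le> K" by (auto simp: bounded_pos)
  have GK: "norm (G x) \<le> K * indicator (cball 0 R) x" for x using K G0[of x] by (auto simp: indicator_def)
  have [measurable]: "G \<in> borel_measurable borel" by (rule borel_measurable_continuous_onI[OF c])
  have e: "G x $ i $ j = (\<chi> i. G x $ i $ j) \<bullet> axis i 1" for x i j by (simp add: inner_axis)
  have int: "integrable lborel (\<lambda>x. G x $ i $ j * G x $ k $ l)" for i j k l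
  proof (rule integrable_lborel_bounded_support)
    show "(\<lambda>x. G x $ i $ j * G x $ k $ l) \<in> borel_measurable borel"
      by (rule borel_measurable_continuous_onI) (intro continuous_intros c)
    fix x
    have "\<bar>G x $ i $ j\<bar> \<le> norm (G x)" for i j
      using component_le_norm_cart[of "G x $ i" j] Finite_Cartesian_Product.norm_nth_le[of "G x" i] by linarith
    then have "\<bar>G x $ i $ j * G x $ k $ l\<bar> \<le> norm (G x) * norm (G x)"
      unfolding abs_mult by (intro mult_mono) auto
    also have "\<dots> \<le> (K * indicator (cball 0 R) x) * (K * indicator (cball 0 R) x)"
      using GK K by (intro mult_mono) auto
    finally show "\<bar>G x $ i $ j * G x $ k $ l\<bar> \<le> K * K * indicator (cball 0 R) x" by (cases "norm x \<le> R") simp_all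
  qed
  have swap: "(\<integral>x. G x $ i $ j * G x $ j $ i \<partial>lborel) = (\<integral>x. G x $ i $ i * G x $ j $ j \<partial>lborel)" for i j
  proof -
    have "(\<integral>x. ((\<chi> k. G x $ k $ j) \<bullet> axis i 1) * ((\<chi> k. G x $ k $ i) \<bullet> axis j 1) \<partial>lborel)
      = (\<integral>x. ((\<chi> k. G x $ k $ j) \<bullet> axis j 1) * ((\<chi> k. G x $ k $ i) \<bullet> axis i 1) \<partial>lborel)"
      by (rule integral_directional_derivatives_commute[OF comp zc comp zc])
    then show ?thesis by (simp add: e[symmetric] inner_axis mult.commute)
  qed
  have "(\<integral>x. (\<Sum>i\<in>UNIV. \<Sum>j\<in>UNIV. G x $ i $ j * G x $ j $ i) \<partial>lborel) = (\<integral>x. (\<Sum>i\<in>UNIV. \<Sum>j\<in>UNIV. G x $ i $ i * G x $ j $ j) \<partial>lborel)"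
    using int by (simp add: Bochner_Integration.integral_sum Bochner_Integration.integrable_sum swap)
  also have "\<dots> = (\<integral>x. (\<Sum>i\<in>UNIV. G x $ i $ i)\<^sup>2 \<partial>lborel)"
    by (simp add: power2_eq_square sum_product)
  also have "0 \<le> \<dots>" by simp
  finally have nonneg: "0 \<le> (\<integral>x. (\<Sum>i\<in>UNIV. \<Sum>j\<in>UNIV. G x $ i $ j * G x $ j $ i) \<partial>lborel)" .
  have tr: "(\<Sum>i\<in>UNIV. \<Sum>j\<in>UNIV. G x $ i $ j * G x $ j $ i) = G x \<bullet> transpose (G x)" for x
    by (simp add: inner_matrix transpose_def)
  have sq: "2 * (norm (sym_part A))\<^sup>2 = (norm A)\<^sup>2 + A \<bullet> transpose A" for A :: "real^'n^'n"
  proof -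
    have t: "transpose A \<bullet> transpose A = A \<bullet> A"
      unfolding inner_matrix transpose_def by (subst sum.swap) simp
    show ?thesis
      unfolding power2_norm_eq_inner sym_part_def by (simp add: inner_add_left inner_add_right t inner_commute algebra_simps)
  qed
  have i1: "integrable lborel (\<lambda>x. (norm (G x))\<^sup>2)"
    unfolding power2_norm_eq_inner inner_matrix by (intro Bochner_Integration.integrable_sum int)
  have i2: "integrable lborel (\<lambda>x. G x \<bullet> transpose (G x))"
    unfolding tr[symmetric] by (intro Bochner_Integration.integrable_sum int)
  have i3: "integrable lborel (\<lambda>x. 2 * (norm (sym_part (G x)))\<^sup>2)"
    unfolding sq by (intro Bochner_Integration.integrable_add i1 i2)
  have "(\<integral>x. (norm (G x))\<^sup>2 \<partial>lborel) \<le> (\<integral>x. 2 * (norm (sym_part (G x)))\<^sup>2 \<partial>lborel)"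
    unfolding sq using nonneg i1 i2 by (simp add: tr)
  then have "(\<integral>\<^sup>+x. ennreal ((norm (G x))\<^sup>2) \<partial>lborel) \<le> (\<integral>\<^sup>+x. ennreal (2 * (norm (sym_part (G x)))\<^sup>2) \<partial>lborel)"
    unfolding nn_integral_eq_integral[OF i1 AE_I2[OF zero_le_power2]]
    by (subst nn_integral_eq_integral[OF i3]) (auto intro: ennreal_leI)
  moreover have "(\<lambda>x. sym_part (G x)) \<in> borel_measurable borel"
    unfolding sym_part_def transpose_def
    by (rule borel_measurable_continuous_onI) (intro continuous_intros c)
  ultimately show ?thesis
    by (simp add: energy_def ennreal_mult nn_integral_cmult)
qed

section \<open>A cutoff function\<close>

lemma energy_mono_set: "S \<subseteq> T \<Longrightarrow> energy S f \<le> energy T f"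
  unfolding energy_def by (rule nn_integral_mono) (auto simp: indicator_def)

lemma energy_le_cmult:
  assumes "\<And>x. x \<in> S \<Longrightarrow> norm (f x) \<le> M * norm (g x)" and M: "0 \<le> M"
    and [measurable]: "g \<in> borel_measurable borel" "S \<in> sets borel"
  shows "energy S f \<le> ennreal (M\<^sup>2) * energy S g"
proof -
  have "energy S f \<le> (\<integral>\<^sup>+x. ennreal (M\<^sup>2) * (ennreal ((norm (g x))\<^sup>2) * indicator S x) \<partial>lborel)"
    unfolding energy_def
  proof (rule nn_integral_mono)
    fix x
    have "x \<in> S \<Longrightarrow> (norm (f x))\<^sup>2 \<le> M\<^sup>2 * (norm (g x))\<^sup>2"
      using power_mono[OF assms(1), of x 2] by (simp add: power_mult_distrib)
    then show "ennreal ((norm (f x))\<^sup>2) * indicator S x \<le> ennreal (M\<^sup>2) * (ennreal ((norm (g x))\<^sup>2) * indicator S x)"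
      using ennreal_leI by (fastforce simp: indicator_def ennreal_mult[symmetric])
  qed
  also have "\<dots> = ennreal (M\<^sup>2) * energy S g"
    unfolding energy_def by (rule nn_integral_cmult) measurable
  finally show ?thesis .
qed

lemma energy_add_le:
  fixes f g :: "'a::euclidean_space \<Rightarrow> 'b::euclidean_space"
  assumes [measurable]: "f \<in> borel_measurable borel" "g \<in> borel_measurable borel" "S \<in> sets borel"
  shows "energy S (\<lambda>x. f x + g x) \<le> 2 * energy S f + 2 * energy S g"
proof -
  have "energy S (\<lambda>x. f x + g x) \<le> (\<integral>\<^sup>+x. 2 * (ennreal ((norm (f x))\<^sup>2) * indicator S x) + 2 * (ennreal ((norm (g x))\<^sup>2) * indicator S x) \<partial>lborel)"
    unfolding energy_def
  proof (rule nn_integral_mono)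
    fix x
    have "(norm (f x + g x))\<^sup>2 \<le> (norm (f x) + norm (g x))\<^sup>2" by (intro power_mono norm_triangle_ineq) auto
    also have "\<dots> \<le> 2 * (norm (f x))\<^sup>2 + 2 * (norm (g x))\<^sup>2"
      using zero_le_power2[of "norm (f x) - norm (g x)"] by (simp add: power2_eq_square algebra_simps)
    finally have "ennreal ((norm (f x + g x))\<^sup>2) \<le> 2 * ennreal ((norm (f x))\<^sup>2) + 2 * ennreal ((norm (g x))\<^sup>2)"
      by (simp add: ennreal_plus[symmetric] ennreal_mult[symmetric] del: ennreal_plus flip: ennreal_numeral)
    then show "ennreal ((norm (f x + g x))\<^sup>2) * indicator S x \<le> 2 * (ennreal ((norm (f x))\<^sup>2) * indicator S x) + 2 * (ennreal ((norm (g x))\<^sup>2) * indicator S x)"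
      by (auto simp: indicator_def)
  qed
  also have "\<dots> = 2 * energy S f + 2 * energy S g"
    unfolding energy_def by (subst nn_integral_add) (auto simp: nn_integral_cmult)
  finally show ?thesis .
qed

lemma energy_const:
  assumes [measurable]: "S \<in> sets borel"
  shows "energy S (\<lambda>x. c) = ennreal ((norm c)\<^sup>2) * emeasure lborel S"
  unfolding energy_def by (simp add: nn_integral_cmult_indicator)

text \<open>
  Cauchy-Schwarz for the product of \<open>g\<close> with the indicator of \<open>B\<close>.
\<close>

lemma norm_integral_square_le:
  fixes f :: "'a::euclidean_space \<Rightarrow> 'b::euclidean_space"
  assumes [measurable]: "f \<in> borel_measurable borel" "B \<in> sets borel" "g \<in> borel_measurable borel"
    and le: "\<And>y. norm (f y) \<le> M * norm (g y) * indicator B y" and M: "0 \<le> M"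
  shows "ennreal ((norm (integral\<^sup>L lborel f))\<^sup>2) \<le> ennreal (M\<^sup>2) * emeasure lborel B * energy B g"
proof (cases "integrable lborel f")
  case True
  have "ennreal (norm (integral\<^sup>L lborel f)) \<le> (\<integral>\<^sup>+y. ennreal (norm (f y)) \<partial>lborel)"
    by (rule integral_norm_bound_ennreal[OF True])
  also have "\<dots> \<le> (\<integral>\<^sup>+y. ennreal M * ((ennreal (norm (g y)) * indicator B y) * indicator B y) \<partial>lborel)"
  proof (rule nn_integral_mono)
    fix y
    have "ennreal (norm (f y)) \<le> ennreal (M * norm (g y) * indicator B y)" by (intro ennreal_leI le)
    then show "ennreal (norm (f y)) \<le> ennreal M * ((ennreal (norm (g y)) * indicator B y) * indicator B y)"
      using M by (cases "y \<in> B") (auto simp: ennreal_mult)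
  qed
  also have "\<dots> = ennreal M * (\<integral>\<^sup>+y. (ennreal (norm (g y)) * indicator B y) * indicator B y \<partial>lborel)"
    by (rule nn_integral_cmult) measurable
  finally have "ennreal (norm (integral\<^sup>L lborel f)) \<le> ennreal M * (\<integral>\<^sup>+y. (ennreal (norm (g y)) * indicator B y) * indicator B y \<partial>lborel)" .
  then have "(ennreal (norm (integral\<^sup>L lborel f)))\<^sup>2 \<le> (ennreal M * (\<integral>\<^sup>+y. (ennreal (norm (g y)) * indicator B y) * indicator B y \<partial>lborel))\<^sup>2"
    by (rule power_mono) auto
  also have "\<dots> = ennreal (M\<^sup>2) * (\<integral>\<^sup>+y. (ennreal (norm (g y)) * indicator B y) * indicator B y \<partial>lborel)\<^sup>2"
    using M by (simp add: power_mult_distrib ennreal_power)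
  also have "\<dots> \<le> ennreal (M\<^sup>2) * ((\<integral>\<^sup>+y. (ennreal (norm (g y)) * indicator B y)\<^sup>2 \<partial>lborel) * (\<integral>\<^sup>+y. (indicator B y)\<^sup>2 \<partial>lborel))"
    by (intro mult_left_mono Cauchy_Schwarz_nn_integral) auto
  also have "(\<integral>\<^sup>+y. (ennreal (norm (g y)) * indicator B y)\<^sup>2 \<partial>lborel) = energy B g"
    unfolding energy_def by (intro nn_integral_cong) (simp add: power_mult_distrib ennreal_power indicator_def)
  also have "(\<integral>\<^sup>+y. (indicator B y)\<^sup>2 \<partial>lborel) = emeasure lborel B"
  proof -
    have "(\<integral>\<^sup>+y. (indicator B y)\<^sup>2 \<partial>lborel) = (\<integral>\<^sup>+y. indicator B y \<partial>lborel)"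
      by (intro nn_integral_cong) (simp add: indicator_def)
    then show ?thesis by simp
  qed
  finally show ?thesis by (simp add: ennreal_power mult_ac)
qed (simp add: not_integrable_integral_eq)

text \<open>
  Continuously differentiable, supported in \<open>cball 0 2\<close> and at least one on \<open>cball 0 1\<close>; one derivative is
  enough below, so a polynomial profile suffices.
\<close>

definition bump :: "'a::euclidean_space \<Rightarrow> real" where
  "bump y = (max 0 (4 - y \<bullet> y))\<^sup>2"

definition bump_gradient :: "'a::euclidean_space \<Rightarrow> 'a" where
  "bump_gradient y = (- 4 * max 0 (4 - y \<bullet> y)) *\<^sub>R y"

lemma DERIV_positive_part_square: "((\<lambda>t. (max 0 t)\<^sup>2) has_real_derivative 2 * max 0 t) (at t)"
proof (cases t "0 :: real" rule: linorder_cases)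
  case less
  have "((\<lambda>t. 0) has_real_derivative 2 * max 0 t) (at t)" using less by (auto intro!: derivative_eq_intros)
  then show ?thesis
    by (rule has_field_derivative_transform_within_open[where S = "{..<0}"]) (use less in auto)
next
  case greater
  have "((\<lambda>t. t\<^sup>2) has_real_derivative 2 * max 0 t) (at t)" using greater by (auto intro!: derivative_eq_intros)
  then show ?thesis
    by (rule has_field_derivative_transform_within_open[where S = "{0<..}"]) (use greater in auto)
next
  case equal
  have "((\<lambda>h. (max 0 (0 + h))\<^sup>2 / h) \<longlongrightarrow> 0) (at (0::real))"
  proof (rule Lim_null_comparison)
    show "\<forall>\<^sub>F h in at 0. norm ((max 0 (0 + h))\<^sup>2 / h) \<le> \<bar>h\<bar>"
      by (intro always_eventually) (auto simp: max_def power2_eq_square)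
    show "((\<lambda>h. \<bar>h\<bar>) \<longlongrightarrow> 0) (at (0::real))" by (rule tendsto_rabs_zero) (rule tendsto_ident_at)
  qed
  then show ?thesis using equal by (simp add: DERIV_def)
qed

lemma scalar_gradient_bump: "scalar_gradient bump bump_gradient"
  unfolding scalar_gradient_def
proof (intro conjI allI)
  show "continuous_on UNIV bump_gradient"
    unfolding bump_gradient_def[abs_def] by (intro continuous_intros)
  fix x :: 'a
  have 1: "((\<lambda>y. 4 - y \<bullet> y) has_derivative (\<lambda>h. - 2 * (x \<bullet> h))) (at x)"
    by (auto intro!: derivative_eq_intros simp: inner_commute)
  show "(bump has_derivative (\<lambda>h. bump_gradient x \<bullet> h)) (at x)"
    using has_derivative_compose[OF 1 DERIV_positive_part_square[THEN has_field_derivative_imp_has_derivative]]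
    by (simp add: bump_def[abs_def] bump_gradient_def mult_ac)
qed

lemma bump_bounds:
  shows "0 \<le> bump y" "bump y \<le> 16 * indicator (ball 0 2) y" "norm (bump_gradient y) \<le> 32 * indicator (ball 0 2) y"
    "norm y \<le> 1 \<Longrightarrow> 1 \<le> bump y"
proof -
  show "0 \<le> bump y" by (simp add: bump_def)
  have out: "4 - y \<bullet> y \<le> 0" if "2 \<le> norm y"
    using power_mono[OF that, of 2] by (simp add: power2_norm_eq_inner)
  have m: "max 0 (4 - y \<bullet> y) \<le> 4" by simp
  show "bump y \<le> 16 * indicator (ball 0 2) y"
  proof (cases "norm y < 2")
    case True
    have "bump y \<le> 4\<^sup>2" unfolding bump_def by (rule power_mono[OF m]) auto
    with True show ?thesis by simp
  qed (use out in \<open>simp add: bump_def max_def\<close>)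
  show "norm (bump_gradient y) \<le> 32 * indicator (ball 0 2) y"
  proof (cases "norm y < 2")
    case True
    have "norm (bump_gradient y) = 4 * max 0 (4 - y \<bullet> y) * norm y" by (simp add: bump_gradient_def)
    also have "\<dots> \<le> 4 * 4 * 2" using True m by (intro mult_mono) auto
    finally show ?thesis using True by simp
  qed (use out in \<open>simp add: bump_gradient_def max_def\<close>)
  assume "norm y \<le> 1"
  then have "y \<bullet> y \<le> 1" using power_mono[of "norm y" 1 2] by (simp add: power2_norm_eq_inner)
  then have "1\<^sup>2 \<le> bump y" unfolding bump_def by (intro power_mono) auto
  then show "1 \<le> bump y" by simp
qed

lemma bump_outside: "2 < norm y \<Longrightarrow> bump y = 0"
  using bump_bounds(1,2)[of y] by simp

lemma continuous_on_bump: "continuous_on S bump"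
  using scalar_gradient_continuous[OF scalar_gradient_bump] by (rule continuous_on_subset) simp

lemma integrable_continuous_cball_support:
  fixes f :: "'a::euclidean_space \<Rightarrow> 'b::euclidean_space"
  assumes "continuous_on UNIV f" "\<And>x. R < norm x \<Longrightarrow> f x = 0"
  shows "integrable lborel f"
proof -
  have "integrable lborel (\<lambda>x. indicator (cball 0 R) x *\<^sub>R f x)"
    by (rule borel_integrable_compact) (use assms(1) in \<open>auto intro: continuous_on_subset\<close>)
  also have "(\<lambda>x. indicator (cball 0 R) x *\<^sub>R f x) = f"
    using assms(2) by (auto simp: indicator_def fun_eq_iff not_le)
  finally show ?thesis .
qed

lemma integral_bump_pos: "0 < (\<integral>y. bump (y::'a::euclidean_space) \<partial>lborel)"
proof -
  have i: "integrable lborel (bump :: 'a \<Rightarrow> real)"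
    by (rule integrable_continuous_cball_support[of _ 2]) (auto simp: continuous_on_bump bump_outside)
  have "0 < measure lborel (ball (0::'a) 1)"
    using emeasure_ball_pos_finite[of 1 "0::'a"] by (simp add: measure_def enn2real_positive_iff)
  also have "\<dots> = (\<integral>y. indicator (ball (0::'a) 1) y \<partial>lborel)" by simp
  also have "\<dots> \<le> (\<integral>y. bump (y::'a) \<partial>lborel)"
  proof (rule integral_mono[OF _ i])
    show "integrable lborel (indicator (ball (0::'a) 1) :: 'a \<Rightarrow> real)"
      using emeasure_ball_pos_finite[of 1 "0::'a"] by (intro integrable_real_indicator) auto
  qed (auto simp: indicator_def bump_bounds(1) intro!: bump_bounds(4))
  finally show ?thesis .
qed

section \<open>Korn's inequality on balls\<close>

lemma bounded_linear_matrix_apply_left: "bounded_linear (\<lambda>A::real^'n::finite^'m::finite. A *v x)"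
  by (rule linear_conv_bounded_linear[THEN iffD1], rule linearI)
     (simp_all add: matrix_vector_mult_add_rdistrib scaleR_matrix_vector_assoc)

lemma linear_sym_part: "linear sym_part"
  by (rule linearI) (simp_all add: sym_part_def transpose_def vec_eq_iff algebra_simps)

lemma bounded_linear_sym_part: "bounded_linear sym_part"
  using linear_sym_part by (rule linear_conv_bounded_linear[THEN iffD1])

lemma sym_part_add: "sym_part (A + B) = sym_part A + sym_part B"
  by (rule linear_add[OF linear_sym_part])

lemma sym_part_diff: "sym_part (A - B) = sym_part A - sym_part B"
  by (rule linear_diff[OF linear_sym_part])

lemma sym_part_scaleR: "sym_part (c *\<^sub>R A) = c *\<^sub>R sym_part A"
  by (rule linear_scale[OF linear_sym_part])

lemma sym_part_transpose: "sym_part (transpose A) = sym_part A"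
  by (simp add: sym_part_def add.commute)

text \<open>
  For fixed \<open>x\<close> let \<open>E y = (v x - v y) \<bullet> (x - y)\<close>. Its gradient is
  \<open>v y - v x - G y *v (x - y)\<close>, which is affine in \<open>x\<close> except for the term \<open>v x\<close>. Integrate
  the gradient of \<open>bump * E\<close>.
\<close>

lemma korn_poincare_identity:
  fixes v :: "real^'n::finite \<Rightarrow> real^'n"
  assumes v: "has_gradient v G"
  defines "m \<equiv> (\<integral>y. bump (y::real^'n) \<partial>lborel)"
  defines "N \<equiv> (\<integral>y. bump y *\<^sub>R G y \<partial>lborel)"
    and "b \<equiv> (\<integral>y. bump y *\<^sub>R (v y + G y *v y) \<partial>lborel)"
  shows "(m *\<^sub>R v x - b + N *v x) \<bullet> e = (\<integral>y. ((v x - v y) \<bullet> (x - y)) * (bump_gradient y \<bullet> e) \<partial>lborel)"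
proof -
  have cv: "continuous_on UNIV v" and cG: "continuous_on UNIV G" and d: "\<And>y. (v has_derivative (\<lambda>h. h v* G y)) (at y)"
    using v has_gradient_continuous[OF v] by (auto simp: has_gradient_def)
  have cGy: "continuous_on UNIV (\<lambda>y. G y *v f y)" if "continuous_on UNIV f" for f
    unfolding matrix_vector_mult_def using cG that by (auto intro!: continuous_intros)
  have cbg: "continuous_on UNIV (bump_gradient :: real^'n \<Rightarrow> real^'n)" using scalar_gradient_bump[where 'a = "real^'n"] by (simp add: scalar_gradient_def)
  define E where "E y = (v x - v y) \<bullet> (x - y)" for y
  define gE where "gE y = - (v x - v y) - G y *v (x - y)" for y
  have "scalar_gradient E gE"
    unfolding scalar_gradient_def
  proof (intro conjI allI)
    show "continuous_on UNIV gE" unfolding gE_def by (intro continuous_intros cv cGy)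
    fix y
    have "(E has_derivative (\<lambda>h. (v x - v y) \<bullet> (0 - h) + (0 - h v* G y) \<bullet> (x - y))) (at y)"
      unfolding E_def by (intro derivative_intros d)
    moreover have "(v x - v y) \<bullet> (0 - h) + (0 - h v* G y) \<bullet> (x - y) = gE y \<bullet> h" for h
    proof -
      have "(0 - h v* G y) \<bullet> (x - y) = - (h \<bullet> (G y *v (x - y)))"
        by (simp only: dot_lmul_matrix[symmetric] diff_0 inner_minus_left)
      then show ?thesis
        by (simp only: gE_def inner_diff_left[of "- (v x - v y)"] diff_0 inner_minus_left inner_minus_right inner_commute[of _ h] inner_diff_right)
    qed
    ultimately show "(E has_derivative (\<lambda>h. gE y \<bullet> h)) (at y)" by simp
  qed
  from integral_directional_derivative_eq_0[OF scalar_gradient_mult[OF scalar_gradient_bump this], of 2 e]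
  have 0: "(\<integral>y. (bump y *\<^sub>R gE y + E y *\<^sub>R bump_gradient y) \<bullet> e \<partial>lborel) = 0"
    by (simp add: bump_outside)
  have bg0: "2 < norm y \<Longrightarrow> bump_gradient y = 0" for y :: "real^'n" using bump_bounds(3)[of y] by simp
  have cE: "continuous_on UNIV E" unfolding E_def by (intro continuous_intros cv)
  have cgE: "continuous_on UNIV gE" unfolding gE_def by (intro continuous_intros cv cGy)
  have i1: "integrable lborel (\<lambda>y. (bump y *\<^sub>R gE y) \<bullet> e)"
    by (rule integrable_continuous_cball_support[of _ 2]) (intro continuous_intros continuous_on_bump cgE, simp add: bump_outside)
  have i2: "integrable lborel (\<lambda>y. E y * (bump_gradient y \<bullet> e))"
    by (rule integrable_continuous_cball_support[of _ 2]) (intro continuous_intros cbg cE, simp add: bg0)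
  have im: "integrable lborel (bump :: real^'n \<Rightarrow> real)"
    by (rule integrable_continuous_cball_support[of _ 2]) (auto simp: continuous_on_bump bump_outside)
  have iN: "integrable lborel (\<lambda>y. bump y *\<^sub>R G y)"
    by (rule integrable_continuous_cball_support[of _ 2]) (intro continuous_intros continuous_on_bump cG, simp add: bump_outside)
  have ib: "integrable lborel (\<lambda>y. bump y *\<^sub>R (v y + G y *v y))"
    by (rule integrable_continuous_cball_support[of _ 2]) (intro continuous_intros continuous_on_bump cv cGy, simp add: bump_outside)
  have Nx: "N *v x = (\<integral>y. (bump y *\<^sub>R G y) *v x \<partial>lborel)"
    unfolding N_def by (rule integral_bounded_linear[OF bounded_linear_matrix_apply_left iN, symmetric])
  have iNx: "integrable lborel (\<lambda>y. (bump y *\<^sub>R G y) *v x)"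
    by (rule integrable_bounded_linear[OF bounded_linear_matrix_apply_left iN])
  have imv: "integrable lborel (\<lambda>y::real^'n. bump y *\<^sub>R v x)" by (intro integrable_scaleR_left im)
  have "m *\<^sub>R v x - b + N *v x = (\<integral>y. bump y *\<^sub>R v x - bump y *\<^sub>R (v y + G y *v y) + (bump y *\<^sub>R G y) *v x \<partial>lborel)"
    unfolding Nx b_def m_def using imv ib iNx im by (simp add: Bochner_Integration.integral_add Bochner_Integration.integral_diff)
  also have "\<dots> = (\<integral>y. - (bump y *\<^sub>R gE y) \<partial>lborel)"
    by (intro Bochner_Integration.integral_cong refl)
       (simp add: gE_def matrix_vector_mult_diff_distrib scaleR_matrix_vector_assoc[symmetric] algebra_simps)
  finally have "(m *\<^sub>R v x - b + N *v x) \<bullet> e = (\<integral>y. - (bump y *\<^sub>R gE y) \<partial>lborel) \<bullet> e" by simp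
  also have "\<dots> = (\<integral>y. - (bump y *\<^sub>R gE y) \<bullet> e \<partial>lborel)"
  proof (rule Bochner_Integration.integral_inner_left[symmetric])
    show "integrable lborel (\<lambda>y. - (bump y *\<^sub>R gE y))" if "e \<noteq> 0"
      by (rule integrable_continuous_cball_support[of _ 2]) (intro continuous_intros continuous_on_bump cgE, simp add: bump_outside)
  qed
  also have "\<dots> = (\<integral>y. E y * (bump_gradient y \<bullet> e) \<partial>lborel)"
    using 0 Bochner_Integration.integral_add[OF i1 i2] by (simp add: inner_add_left)
  finally show ?thesis by (simp add: E_def)
qed

text \<open>
  The factor 256 is \<open>\<bar>x - y\<bar> ^ 4\<close> for points of \<open>ball 0 2\<close>.
\<close>

lemma radial_increment_average:
  fixes v :: "real^'n::finite \<Rightarrow> real^'n"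
  assumes v: "has_gradient v G"
  shows "(\<integral>\<^sup>+x\<in>ball 0 2. energy (ball 0 2) (\<lambda>y. (v x - v y) \<bullet> (x - y)) \<partial>lborel)
    \<le> ennreal (256 * 2 ^ CARD('n)) * emeasure lborel (ball (0::real^'n) 2) * energy (ball 0 2) (\<lambda>z. sym_part (G z))"
proof -
  define B where "B = ball (0::real^'n) 2"
  note [measurable] = borel_measurable_has_gradient[OF v]
  have [measurable]: "B \<in> sets borel" by (simp add: B_def)
  have [measurable]: "(\<lambda>z. sym_part (G z)) \<in> borel_measurable borel"
  proof (rule borel_measurable_continuous_onI)
    show "continuous_on UNIV (\<lambda>x. sym_part (G x))"
      using v unfolding has_gradient_def sym_part_def transpose_def by (auto intro!: continuous_intros)
  qed
  define S where "S x y = (\<integral>\<^sup>+s\<in>{0..1}. ennreal ((norm (sym_part (G (x + s *\<^sub>R (y - x)))))\<^sup>2) \<partial>lborel)" for x y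
  have pt: "ennreal ((norm ((v x - v y) \<bullet> (x - y)))\<^sup>2) \<le> ennreal 256 * S x y" if "x \<in> B" "y \<in> B" for x y
  proof -
    have "norm (y - x) \<le> 4"
      using that norm_triangle_ineq4[of y x] by (auto simp: B_def)
    then have "((norm (y - x))\<^sup>2)\<^sup>2 \<le> (4\<^sup>2)\<^sup>2" by (intro power_mono) auto
    then have *: "ennreal (((norm (y - x))\<^sup>2)\<^sup>2) \<le> ennreal 256" by (intro ennreal_leI) simp
    have "(v x - v y) \<bullet> (x - y) = (y - x) \<bullet> (v y - v x)"
      by (metis inner_commute inner_minus_left inner_minus_right minus_diff_eq)
    then have "ennreal ((norm ((v x - v y) \<bullet> (x - y)))\<^sup>2) \<le> ennreal (((norm (y - x))\<^sup>2)\<^sup>2) * S x y"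
      using has_gradient_radial_increment[OF v, of y x] by (simp add: S_def)
    also have "\<dots> \<le> ennreal 256 * S x y" by (rule mult_right_mono[OF *]) simp
    finally show ?thesis .
  qed
  have "(\<integral>\<^sup>+x\<in>B. energy B (\<lambda>y. (v x - v y) \<bullet> (x - y)) \<partial>lborel) \<le> (\<integral>\<^sup>+x. ennreal 256 * ((\<integral>\<^sup>+y\<in>B. S x y \<partial>lborel) * indicator B x) \<partial>lborel)"
  proof (rule nn_integral_mono)
    fix x
    show "energy B (\<lambda>y. (v x - v y) \<bullet> (x - y)) * indicator B x \<le> ennreal 256 * ((\<integral>\<^sup>+y\<in>B. S x y \<partial>lborel) * indicator B x)"
    proof (cases "x \<in> B")
      case True
      have "energy B (\<lambda>y. (v x - v y) \<bullet> (x - y)) \<le> (\<integral>\<^sup>+y. ennreal 256 * (S x y * indicator B y) \<partial>lborel)"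
        unfolding energy_def by (rule nn_integral_mono) (use pt True in \<open>auto simp: indicator_def\<close>)
      also have "\<dots> = ennreal 256 * (\<integral>\<^sup>+y\<in>B. S x y \<partial>lborel)"
        unfolding S_def by (rule nn_integral_cmult) measurable
      finally show ?thesis using True by simp
    qed simp
  qed
  also have "\<dots> = ennreal 256 * (\<integral>\<^sup>+x\<in>B. (\<integral>\<^sup>+y\<in>B. S x y \<partial>lborel) \<partial>lborel)"
    unfolding S_def by (rule nn_integral_cmult) measurable
  also have "\<dots> \<le> ennreal 256 * (ennreal (2 ^ DIM(real^'n)) * emeasure lborel B * (\<integral>\<^sup>+z\<in>B. ennreal ((norm (sym_part (G z)))\<^sup>2) \<partial>lborel))"
    unfolding S_def by (intro mult_left_mono segment_average) (auto simp: B_def)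
  also have "\<dots> = ennreal (256 * 2 ^ CARD('n)) * emeasure lborel B * energy B (\<lambda>z. sym_part (G z))"
    by (simp add: energy_def ennreal_mult mult_ac)
  finally show ?thesis by (simp add: B_def)
qed

lemma continuous_on_sym_part_gradient:
  "has_gradient v G \<Longrightarrow> continuous_on UNIV (\<lambda>x. sym_part (G x))"
  unfolding has_gradient_def sym_part_def transpose_def by (auto intro!: continuous_intros)

text \<open>
  The identity above bounds \<open>v - b/m + (N/m) x\<close> pointwise by an integral of radial
  increments. The affine field subtracted is not rigid, but the symmetric part of its gradient is
  an average of \<open>sym_part \<circ> G\<close> and therefore small as well.
\<close>

lemma korn_poincare:
  fixes v :: "real^'n::finite \<Rightarrow> real^'n"
  defines "m \<equiv> (\<integral>y. bump (y::real^'n) \<partial>lborel)"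
  obtains C where "C < top" "\<And>v G. has_gradient v G \<Longrightarrow>
    \<exists>b (N :: real^'n^'n). energy (ball 0 2) (\<lambda>x. v x - b + N *v x) \<le> C * energy (ball 0 2) (\<lambda>z. sym_part (G z)) \<and>
      energy (ball 0 2) (\<lambda>x::real^'n. sym_part N) \<le> C * energy (ball 0 2) (\<lambda>z. sym_part (G z))"
proof -
  define B where "B = ball (0::real^'n) 2"
  have m: "0 < m" unfolding m_def by (rule integral_bump_pos)
  have Bfin: "emeasure lborel B < top" using emeasure_ball_pos_finite[of 2 "0::real^'n"] by (simp add: B_def)
  have [measurable]: "B \<in> sets borel" by (simp add: B_def)
  define C1 where "C1 = ennreal ((32 / m)\<^sup>2) * emeasure lborel B * (ennreal (256 * 2 ^ CARD('n)) * emeasure lborel B)"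
  define C2 where "C2 = ennreal ((16 / m)\<^sup>2) * emeasure lborel B * emeasure lborel B"
  have fin: "C1 + C2 < top" using Bfin by (simp add: C1_def C2_def ennreal_mult_less_top less_top[symmetric] ennreal_mult_eq_top_iff)
  show thesis
  proof (rule that[OF fin])
    fix v G assume v: "has_gradient (v :: real^'n \<Rightarrow> real^'n) G"
    note [measurable] = borel_measurable_has_gradient[OF v]
    have cv: "continuous_on UNIV v" and cG: "continuous_on UNIV G"
      using v has_gradient_continuous[OF v] by (auto simp: has_gradient_def)
    have [measurable]: "(\<lambda>z. sym_part (G z)) \<in> borel_measurable borel"
      by (rule borel_measurable_continuous_onI[OF continuous_on_sym_part_gradient[OF v]])
    have [measurable]: "bump_gradient \<in> borel_measurable (borel :: (real^'n) measure)"
      using scalar_gradient_bump[where 'a = "real^'n"] by (auto intro: borel_measurable_continuous_onI simp: scalar_gradient_def)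
    have [measurable]: "bump \<in> borel_measurable (borel :: (real^'n) measure)"
      by (intro borel_measurable_continuous_onI continuous_on_bump)
    define N where "N = (1 / m) *\<^sub>R (\<integral>y. bump y *\<^sub>R G y \<partial>lborel)"
    define b where "b = (1 / m) *\<^sub>R (\<integral>y. bump y *\<^sub>R (v y + G y *v y) \<partial>lborel)"
    define w where "w x = v x - b + N *v x" for x
    have id: "(m *\<^sub>R w x) \<bullet> e = (\<integral>y. ((v x - v y) \<bullet> (x - y)) * (bump_gradient y \<bullet> e) \<partial>lborel)" for x e
      using korn_poincare_identity[OF v, of x e] m
      by (simp add: w_def N_def b_def m_def[symmetric] scaleR_add_right scaleR_diff_right scaleR_matrix_vector_assoc[symmetric])
    have pt: "ennreal ((norm (w x))\<^sup>2) \<le> ennreal ((32 / m)\<^sup>2) * emeasure lborel B * energy B (\<lambda>y. (v x - v y) \<bullet> (x - y))" for x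
    proof -
      define e where "e = (1 / m) *\<^sub>R sgn (w x)"
      have "(m *\<^sub>R w x) \<bullet> e = norm (w x)"
        using m by (cases "w x = 0") (simp_all add: e_def sgn_div_norm power2_norm_eq_inner[symmetric] power2_eq_square)
      then have "ennreal ((norm (w x))\<^sup>2) = ennreal ((norm (\<integral>y. ((v x - v y) \<bullet> (x - y)) * (bump_gradient y \<bullet> e) \<partial>lborel))\<^sup>2)"
        using id[of x e] by simp
      also have "\<dots> \<le> ennreal ((32 / m)\<^sup>2) * emeasure lborel B * energy B (\<lambda>y. (v x - v y) \<bullet> (x - y))"
      proof (rule norm_integral_square_le)
        fix y
        have ne: "norm e \<le> 1 / m" using m by (simp add: e_def norm_sgn)
        have "\<bar>bump_gradient y \<bullet> e\<bar> \<le> norm (bump_gradient y) * norm e" by (rule Cauchy_Schwarz_ineq2)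
        also have "\<dots> \<le> (32 * indicator B y) * (1 / m)"
          unfolding B_def by (intro mult_mono bump_bounds ne) auto
        finally have "\<bar>bump_gradient y \<bullet> e\<bar> \<le> 32 / m * indicator B y" by simp
        from mult_left_mono[OF this, of "\<bar>(v x - v y) \<bullet> (x - y)\<bar>"]
        show "norm (((v x - v y) \<bullet> (x - y)) * (bump_gradient y \<bullet> e)) \<le> 32 / m * norm ((v x - v y) \<bullet> (x - y)) * indicator B y"
          by (simp add: abs_mult mult_ac)
      qed (use m in auto)
      finally show ?thesis .
    qed
    have "energy B w \<le> (\<integral>\<^sup>+x. ennreal ((32 / m)\<^sup>2) * emeasure lborel B * (energy B (\<lambda>y. (v x - v y) \<bullet> (x - y)) * indicator B x) \<partial>lborel)"
      unfolding energy_def[of B w]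
    proof (rule nn_integral_mono)
      fix x
      show "ennreal ((norm (w x))\<^sup>2) * indicator B x \<le> ennreal ((32 / m)\<^sup>2) * emeasure lborel B * (energy B (\<lambda>y. (v x - v y) \<bullet> (x - y)) * indicator B x)"
        using pt[of x] by (cases "x \<in> B") auto
    qed
    also have "\<dots> = ennreal ((32 / m)\<^sup>2) * emeasure lborel B * (\<integral>\<^sup>+x\<in>B. energy B (\<lambda>y. (v x - v y) \<bullet> (x - y)) \<partial>lborel)"
      unfolding energy_def by (rule nn_integral_cmult) measurable
    also have "\<dots> \<le> ennreal ((32 / m)\<^sup>2) * emeasure lborel B * (ennreal (256 * 2 ^ CARD('n)) * emeasure lborel B * energy B (\<lambda>z. sym_part (G z)))"
      unfolding B_def by (intro mult_left_mono radial_increment_average v) auto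
    also have "\<dots> = C1 * energy B (\<lambda>z. sym_part (G z))" by (simp add: C1_def mult_ac)
    also have "\<dots> \<le> (C1 + C2) * energy B (\<lambda>z. sym_part (G z))" by (intro mult_right_mono) auto
    finally have 1: "energy B w \<le> (C1 + C2) * energy B (\<lambda>z. sym_part (G z))" .
    have iN: "integrable lborel (\<lambda>y. bump y *\<^sub>R G y)"
      by (rule integrable_continuous_cball_support[of _ 2]) (intro continuous_intros continuous_on_bump cG, simp add: bump_outside)
    have "sym_part N = (1 / m) *\<^sub>R (\<integral>y. bump y *\<^sub>R sym_part (G y) \<partial>lborel)"
      unfolding N_def using integral_bounded_linear[OF bounded_linear_sym_part iN] by (simp add: sym_part_scaleR)
    also have "\<dots> = (\<integral>y. (bump y / m) *\<^sub>R sym_part (G y) \<partial>lborel)"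
      by (simp flip: Bochner_Integration.integral_scaleR_right)
    finally have "ennreal ((norm (sym_part N))\<^sup>2) = ennreal ((norm (\<integral>y. (bump y / m) *\<^sub>R sym_part (G y) \<partial>lborel))\<^sup>2)" by simp
    also have "\<dots> \<le> ennreal ((16 / m)\<^sup>2) * emeasure lborel B * energy B (\<lambda>z. sym_part (G z))"
    proof (rule norm_integral_square_le)
      fix y :: "real^'n"
      have "bump y / m \<le> 16 / m * indicator B y"
        using divide_right_mono[OF bump_bounds(2)[of y], of m] m by (simp add: B_def)
      from mult_right_mono[OF this, of "norm (sym_part (G y))"]
      show "norm ((bump y / m) *\<^sub>R sym_part (G y)) \<le> 16 / m * norm (sym_part (G y)) * indicator B y"
        using m by (simp add: bump_bounds(1) mult_ac)
    qed (use m in auto)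
    finally have "energy B (\<lambda>x::real^'n. sym_part N) \<le> ennreal ((16 / m)\<^sup>2) * emeasure lborel B * energy B (\<lambda>z. sym_part (G z)) * emeasure lborel B"
      by (simp add: energy_const mult_right_mono)
    also have "\<dots> = C2 * energy B (\<lambda>z. sym_part (G z))" by (simp add: C2_def mult_ac)
    also have "\<dots> \<le> (C1 + C2) * energy B (\<lambda>z. sym_part (G z))" by (intro mult_right_mono) auto
    finally show "\<exists>b (N :: real^'n^'n). energy (ball 0 2) (\<lambda>x. v x - b + N *v x) \<le> (C1 + C2) * energy (ball 0 2) (\<lambda>z. sym_part (G z)) \<and>
      energy (ball 0 2) (\<lambda>x::real^'n. sym_part N) \<le> (C1 + C2) * energy (ball 0 2) (\<lambda>z. sym_part (G z))"
      using 1 unfolding B_def w_def by blast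
  qed
qed

text \<open>
  The gradient of a product with a scalar function contributes a matrix of this form.
\<close>

definition outer :: "real^'m::finite \<Rightarrow> real^'n::finite \<Rightarrow> real^'n^'m" where
  "outer a b = (\<chi> i j. a $ i * b $ j)"

lemma vector_matrix_mult_outer: "h v* outer a b = (h \<bullet> a) *\<^sub>R b"
  by (simp add: vec_eq_iff vector_matrix_mult_def outer_def inner_vec_def sum_distrib_left mult_ac)

lemma norm_outer: "norm (outer a b) = norm a * norm b"
proof -
  have "outer a b \<bullet> outer a b = (a \<bullet> a) * (b \<bullet> b)"
  proof -
    have "outer a b \<bullet> outer a b = (\<Sum>i\<in>UNIV. \<Sum>j\<in>UNIV. (a $ i * a $ i) * (b $ j * b $ j))"
      by (simp add: inner_vec_def outer_def mult_ac)
    then show ?thesis by (simp add: inner_vec_def sum_product)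
  qed
  then show ?thesis by (simp add: norm_eq_sqrt_inner real_sqrt_mult)
qed

text \<open>
  Apply \<open>korn_first\<close> to \<open>bump * w\<close>, whose gradient is
  \<open>bump * G + outer bump_gradient w\<close>.
\<close>

lemma energy_gradient_cutoff:
  fixes w :: "real^'n::finite \<Rightarrow> real^'n"
  assumes w: "has_gradient w G"
  shows "energy (ball 0 1) G \<le> 2048 * energy (ball 0 2) (\<lambda>x. sym_part (G x)) + 10240 * energy (ball 0 2) w"
proof -
  define B where "B = ball (0::real^'n) 2"
  have cw: "continuous_on UNIV w" and cG: "continuous_on UNIV G"
    using w has_gradient_continuous[OF w] by (auto simp: has_gradient_def)
  have cbg: "continuous_on UNIV (bump_gradient :: real^'n \<Rightarrow> real^'n)"
    using scalar_gradient_bump[where 'a = "real^'n"] by (simp add: scalar_gradient_def)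
  define P where "P x = outer (bump_gradient x) (w x)" for x
  define H where "H x = bump x *\<^sub>R G x + P x" for x
  have cP: "continuous_on UNIV P"
    unfolding P_def outer_def by (intro continuous_intros cbg cw)
  have cH: "continuous_on UNIV H" unfolding H_def by (intro continuous_intros continuous_on_bump cG cP)
  have [measurable]: "w \<in> borel_measurable borel" "G \<in> borel_measurable borel" "P \<in> borel_measurable borel" "H \<in> borel_measurable borel"
    "bump \<in> borel_measurable (borel :: (real^'n) measure)"
    by (auto intro: borel_measurable_continuous_onI cw cG cP cH continuous_on_bump)
  have [measurable]: "sym_part \<in> borel_measurable (borel :: (real^'n^'n) measure)"
    by (intro borel_measurable_continuous_onI linear_continuous_on bounded_linear_sym_part)
  have [measurable]: "B \<in> sets borel" by (simp add: B_def)
  have u: "has_gradient (\<lambda>x. bump x *\<^sub>R w x) H"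
    unfolding has_gradient_def
  proof (intro conjI allI cH)
    fix x
    have "((\<lambda>x. bump x *\<^sub>R w x) has_derivative (\<lambda>h. bump x *\<^sub>R (h v* G x) + (bump_gradient x \<bullet> h) *\<^sub>R w x)) (at x)"
      using w scalar_gradient_bump[where 'a = "real^'n"]
      by (intro has_derivative_scaleR) (auto simp: has_gradient_def scalar_gradient_def)
    then show "((\<lambda>x. bump x *\<^sub>R w x) has_derivative (\<lambda>h. h v* H x)) (at x)"
      by (simp add: H_def P_def vector_matrix_mult_add_rdistrib vector_scaleR_matrix_ac vector_matrix_mult_outer inner_commute)
  qed
  have K: "energy UNIV H \<le> 2 * energy UNIV (\<lambda>x. sym_part (H x))"
    by (rule korn_first[OF u, of 2]) (simp add: bump_outside)
  have normP: "norm (P x) \<le> 32 * norm (w x) * indicator B x" for x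
    using mult_right_mono[OF bump_bounds(3)[of x], of "norm (w x)"] by (simp add: P_def norm_outer B_def mult_ac)
  have P0: "x \<notin> B \<Longrightarrow> P x = 0" for x using normP[of x] by simp
  have b0: "x \<notin> B \<Longrightarrow> bump x = 0" for x using bump_bounds(1,2)[of x] by (simp add: B_def)
  have restrict: "energy UNIV f = energy B f" if "\<And>x. x \<notin> B \<Longrightarrow> f x = 0" for f :: "real^'n \<Rightarrow> real^'n^'n"
    unfolding energy_def by (intro nn_integral_cong) (use that in \<open>auto simp: indicator_def\<close>)
  have eP: "energy UNIV P \<le> 1024 * energy B w"
  proof -
    have "energy B P \<le> ennreal (32\<^sup>2) * energy B w"
      by (rule energy_le_cmult) (use normP in \<open>auto intro: order_trans[OF normP]\<close>)
    then show ?thesis using restrict[OF P0] by simp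
  qed
  have esP: "energy UNIV (\<lambda>x. sym_part (P x)) \<le> energy UNIV P"
    using energy_le_cmult[of UNIV "\<lambda>x. sym_part (P x)" 1 P] by (simp add: norm_sym_part_le)
  have ebS: "energy UNIV (\<lambda>x. bump x *\<^sub>R sym_part (G x)) \<le> 256 * energy B (\<lambda>x. sym_part (G x))"
  proof -
    have "energy B (\<lambda>x. bump x *\<^sub>R sym_part (G x)) \<le> ennreal (16\<^sup>2) * energy B (\<lambda>x. sym_part (G x))"
    proof (rule energy_le_cmult)
      fix x assume "x \<in> B"
      then have "bump x \<le> 16" using bump_bounds(2)[of x] by (simp add: B_def)
      then show "norm (bump x *\<^sub>R sym_part (G x)) \<le> 16 * norm (sym_part (G x))"
        by (simp add: bump_bounds(1) mult_right_mono)
    qed auto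
    then show ?thesis using restrict[of "\<lambda>x. bump x *\<^sub>R sym_part (G x)"] b0 by simp
  qed
  have sH: "sym_part (H x) = bump x *\<^sub>R sym_part (G x) + sym_part (P x)" for x
    by (simp add: H_def sym_part_add sym_part_scaleR)
  have esH: "energy UNIV (\<lambda>x. sym_part (H x)) \<le> 2 * (256 * energy B (\<lambda>x. sym_part (G x))) + 2 * (1024 * energy B w)"
  proof -
    have "energy UNIV (\<lambda>x. sym_part (H x)) \<le> 2 * energy UNIV (\<lambda>x. bump x *\<^sub>R sym_part (G x)) + 2 * energy UNIV (\<lambda>x. sym_part (P x))"
      unfolding sH by (rule energy_add_le) measurable
    also have "\<dots> \<le> 2 * (256 * energy B (\<lambda>x. sym_part (G x))) + 2 * (1024 * energy B w)"
      by (intro add_mono mult_left_mono ebS order_trans[OF esP eP]) auto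
    finally show ?thesis .
  qed
  have "energy (ball 0 1) G \<le> ennreal (1\<^sup>2) * energy (ball 0 1) (\<lambda>x. bump x *\<^sub>R G x)"
  proof (rule energy_le_cmult)
    fix x :: "real^'n" assume "x \<in> ball 0 1"
    then have "1 \<le> bump x" using bump_bounds(4)[of x] by simp
    then show "norm (G x) \<le> 1 * norm (bump x *\<^sub>R G x)" by (simp add: mult_le_cancel_right1)
  qed auto
  also have "\<dots> \<le> energy UNIV (\<lambda>x. bump x *\<^sub>R G x)" by (simp add: energy_mono_set)
  also have "\<dots> = energy UNIV (\<lambda>x. H x + - P x)" by (simp add: H_def)
  also have "\<dots> \<le> 2 * energy UNIV H + 2 * energy UNIV (\<lambda>x. - P x)" by (rule energy_add_le) measurable
  also have "energy UNIV (\<lambda>x. - P x) = energy UNIV P" by (simp add: energy_def)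
  also have "2 * energy UNIV H + 2 * energy UNIV P
      \<le> 2 * (2 * (2 * (256 * energy B (\<lambda>x. sym_part (G x))) + 2 * (1024 * energy B w))) + 2 * (1024 * energy B w)"
    by (intro add_mono mult_left_mono order_trans[OF K] eP esH) auto
  also have "\<dots> = 2048 * energy B (\<lambda>x. sym_part (G x)) + 10240 * energy B w"
    by (simp add: distrib_left mult.assoc[symmetric] add.assoc flip: distrib_right)
  finally show ?thesis by (simp add: B_def)
qed

lemma korn_unit_ball:
  obtains C where "C < top" "\<And>(v :: real^'n::finite \<Rightarrow> real^'n) G. has_gradient v G \<Longrightarrow>
    \<exists>c. energy (ball 0 1) (\<lambda>x. G x - c) \<le> C * energy (ball 0 2) (\<lambda>x. sym_part (G x))"
proof -
  obtain C where C: "C < top" "\<And>(v :: real^'n \<Rightarrow> real^'n) G. has_gradient v G \<Longrightarrow>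
    \<exists>b (N :: real^'n^'n). energy (ball 0 2) (\<lambda>x. v x - b + N *v x) \<le> C * energy (ball 0 2) (\<lambda>z. sym_part (G z)) \<and>
      energy (ball 0 2) (\<lambda>x::real^'n. sym_part N) \<le> C * energy (ball 0 2) (\<lambda>z. sym_part (G z))"
    by (rule korn_poincare) blast
  define C' where "C' = 2048 * (2 + 2 * C) + 10240 * C"
  show thesis
  proof (rule that[of C'])
    show "C' < top" using C(1) by (simp add: C'_def ennreal_mult_less_top)
    fix v G assume v: "has_gradient (v :: real^'n \<Rightarrow> real^'n) G"
    from C(2)[OF this] obtain b and N :: "real^'n^'n" where
      1: "energy (ball 0 2) (\<lambda>x. v x - b + N *v x) \<le> C * energy (ball 0 2) (\<lambda>z. sym_part (G z))" and
      2: "energy (ball 0 2) (\<lambda>x::real^'n. sym_part N) \<le> C * energy (ball 0 2) (\<lambda>z. sym_part (G z))" by blast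
    have w: "has_gradient (\<lambda>x. v x - b + N *v x) (\<lambda>x. G x - (- transpose N))"
      unfolding has_gradient_def
    proof (intro conjI allI)
      show "continuous_on UNIV (\<lambda>x. G x - - transpose N)" using v by (auto simp: has_gradient_def intro!: continuous_intros)
      fix x
      have N: "((\<lambda>x. N *v x) has_derivative (\<lambda>h. N *v h)) (at x)"
        by (rule bounded_linear_imp_has_derivative) (simp add: matrix_vector_mul_bounded_linear)
      have "((\<lambda>x. v x - b + N *v x) has_derivative (\<lambda>h. h v* G x - 0 + N *v h)) (at x)"
        using v by (intro derivative_intros N) (auto simp: has_gradient_def)
      then show "((\<lambda>x. v x - b + N *v x) has_derivative (\<lambda>h. h v* (G x - - transpose N))) (at x)"
        by (simp add: vector_matrix_mult_add_rdistrib)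
    qed
    have [measurable]: "(\<lambda>x. sym_part (G x)) \<in> borel_measurable borel"
      by (rule borel_measurable_continuous_onI[OF continuous_on_sym_part_gradient[OF v]])
    have "energy (ball 0 2) (\<lambda>x. sym_part (G x - - transpose N)) = energy (ball 0 2) (\<lambda>x. sym_part (G x) + sym_part N)"
      by (simp add: sym_part_add sym_part_transpose)
    also have "\<dots> \<le> 2 * energy (ball 0 2) (\<lambda>x. sym_part (G x)) + 2 * energy (ball 0 2) (\<lambda>x::real^'n. sym_part N)"
      by (rule energy_add_le) auto
    also have "\<dots> \<le> 2 * energy (ball 0 2) (\<lambda>x. sym_part (G x)) + 2 * (C * energy (ball 0 2) (\<lambda>z. sym_part (G z)))"
      by (intro add_left_mono mult_left_mono 2) auto
    finally have 3: "energy (ball 0 2) (\<lambda>x. sym_part (G x - - transpose N)) \<le> (2 + 2 * C) * energy (ball 0 2) (\<lambda>x. sym_part (G x))"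
      by (simp add: distrib_right mult.assoc)
    have "energy (ball 0 1) (\<lambda>x. G x - - transpose N) \<le> 2048 * ((2 + 2 * C) * energy (ball 0 2) (\<lambda>x. sym_part (G x))) + 10240 * (C * energy (ball 0 2) (\<lambda>z. sym_part (G z)))"
      by (rule order_trans[OF energy_gradient_cutoff[OF w]]) (intro add_mono mult_left_mono 3 1, auto)
    also have "\<dots> = C' * energy (ball 0 2) (\<lambda>x. sym_part (G x))"
      by (simp add: C'_def distrib_right mult.assoc)
    finally show "\<exists>c. energy (ball 0 1) (\<lambda>x. G x - c) \<le> C' * energy (ball 0 2) (\<lambda>x. sym_part (G x))" by blast
  qed
qed

lemma energy_affine:
  fixes f :: "'a::euclidean_space \<Rightarrow> 'b::euclidean_space"
  assumes [measurable]: "f \<in> borel_measurable borel" and r: "r > 0"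
  shows "energy (ball a (r * \<rho>)) f = ennreal (r ^ DIM('a)) * energy (ball 0 \<rho>) (\<lambda>y. f (a + r *\<^sub>R y))"
proof -
  have [measurable]: "ball a (r * \<rho>) \<in> sets borel" by simp
  have "energy (ball a (r * \<rho>)) f = ennreal (r ^ DIM('a)) * (\<integral>\<^sup>+x. ennreal ((norm (f (a + r *\<^sub>R x)))\<^sup>2) * indicator (ball a (r * \<rho>)) (a + r *\<^sub>R x) \<partial>lborel)"
    unfolding energy_def by (rule nn_integral_affine[OF _ r]) measurable
  also have "(\<integral>\<^sup>+x. ennreal ((norm (f (a + r *\<^sub>R x)))\<^sup>2) * indicator (ball a (r * \<rho>)) (a + r *\<^sub>R x) \<partial>lborel) = energy (ball 0 \<rho>) (\<lambda>y. f (a + r *\<^sub>R y))"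
    unfolding energy_def by (intro nn_integral_cong) (use r in \<open>auto simp: indicator_def dist_norm\<close>)
  finally show ?thesis .
qed

text \<open>
  Rescaling \<open>v\<close> to the unit ball leaves its gradient unchanged, so the constant is the same
  for all balls; the passage to \<open>\<Omega>\<close> depends on this.
\<close>

lemma korn_ball:
  obtains K where "0 \<le> K" "\<And>(v :: real^'n::finite \<Rightarrow> real^'n) G a r. has_gradient v G \<Longrightarrow> 0 < r \<Longrightarrow>
    \<exists>c. energy (ball a r) (\<lambda>x. G x - c) \<le> ennreal K * energy (ball a (2 * r)) (\<lambda>x. sym_part (G x))"
proof -
  obtain C where C: "C < top" "\<And>(v :: real^'n \<Rightarrow> real^'n) G. has_gradient v G \<Longrightarrow>
    \<exists>c. energy (ball 0 1) (\<lambda>x. G x - c) \<le> C * energy (ball 0 2) (\<lambda>x. sym_part (G x))"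
    by (rule korn_unit_ball) blast
  have C': "C = ennreal (enn2real C)" using C(1) by simp
  show thesis
  proof (rule that[of "enn2real C"])
    fix v G a and r :: real assume v: "has_gradient (v :: real^'n \<Rightarrow> real^'n) G" and r: "0 < r"
    have cG: "continuous_on UNIV G" using v by (simp add: has_gradient_def)
    have [measurable]: "G \<in> borel_measurable borel" by (rule borel_measurable_continuous_onI[OF cG])
    have [measurable]: "(\<lambda>x. sym_part (G x)) \<in> borel_measurable borel"
      by (rule borel_measurable_continuous_onI[OF continuous_on_sym_part_gradient[OF v]])
    have "has_gradient (\<lambda>y. (1 / r) *\<^sub>R v (a + r *\<^sub>R y)) (\<lambda>y. G (a + r *\<^sub>R y))"
      unfolding has_gradient_def
    proof (intro conjI allI)
      show "continuous_on UNIV (\<lambda>y. G (a + r *\<^sub>R y))"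
        by (rule continuous_on_compose2[OF cG]) (auto intro!: continuous_intros)
      fix y
      have 1: "((\<lambda>y. a + r *\<^sub>R y) has_derivative (\<lambda>h. r *\<^sub>R h)) (at y)" by (auto intro!: derivative_eq_intros)
      have "((\<lambda>y. v (a + r *\<^sub>R y)) has_derivative (\<lambda>h. (r *\<^sub>R h) v* G (a + r *\<^sub>R y))) (at y)"
        by (rule has_derivative_compose[OF 1]) (use v in \<open>auto simp: has_gradient_def\<close>)
      from has_derivative_scaleR_right[OF this, of "1 / r"]
      show "((\<lambda>y. (1 / r) *\<^sub>R v (a + r *\<^sub>R y)) has_derivative (\<lambda>h. h v* G (a + r *\<^sub>R y))) (at y)"
        using r by (simp add: scaleR_vector_matrix_assoc)
    qed
    from C(2)[OF this] obtain c where c: "energy (ball 0 1) (\<lambda>y. G (a + r *\<^sub>R y) - c) \<le> C * energy (ball 0 2) (\<lambda>y. sym_part (G (a + r *\<^sub>R y)))" by blast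
    have "energy (ball a r) (\<lambda>x. G x - c) = ennreal (r ^ CARD('n)) * energy (ball 0 1) (\<lambda>y. G (a + r *\<^sub>R y) - c)"
      using energy_affine[of "\<lambda>x. G x - c" r a 1] r by simp
    also have "\<dots> \<le> ennreal (r ^ CARD('n)) * (C * energy (ball 0 2) (\<lambda>y. sym_part (G (a + r *\<^sub>R y))))"
      by (rule mult_left_mono[OF c]) simp
    also have "\<dots> = C * energy (ball a (2 * r)) (\<lambda>x. sym_part (G x))"
      using energy_affine[of "\<lambda>x. sym_part (G x)" r a 2] r by (simp add: mult_ac)
    finally show "\<exists>c. energy (ball a r) (\<lambda>x. G x - c) \<le> ennreal (enn2real C) * energy (ball a (2 * r)) (\<lambda>x. sym_part (G x))"
      using C' by auto
  qed simp
qed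

section \<open>From balls to domains: the interior and vertical dilations\<close>

text \<open>
  The local hypothesis: on balls, \<open>f\<close> is within \<open>\<epsilon>\<close> of a constant in \<open>L2\<close>, at the cost of doubling the radius. It
  is used for \<open>f = \<nabla>v\<close> with \<open>\<epsilon>\<close> a multiple of \<open>sym \<nabla>v\<close>, and for \<open>f = v\<close> with \<open>\<epsilon>\<close> a multiple of \<open>\<nabla>v\<close>.
\<close>

definition oscillation_bound ::
  "(real^'n::finite) set \<Rightarrow> (real^'n \<Rightarrow> 'b::euclidean_space) \<Rightarrow> (real^'n \<Rightarrow> 'c::euclidean_space) \<Rightarrow> bool" where
  "oscillation_bound \<Omega> f e \<longleftrightarrow> continuous_on UNIV f \<and> continuous_on UNIV e \<and>
     (\<forall>x r. 0 < r \<longrightarrow> ball x (2 * r) \<subseteq> \<Omega> \<longrightarrow>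
        (\<exists>c. energy (ball x r) (\<lambda>y. f y - c) \<le> energy (ball x (2 * r)) e))"

lemma oscillation_bound_diff_const:
  assumes "oscillation_bound \<Omega> f e"
  shows "oscillation_bound \<Omega> (\<lambda>x. f x - a) e"
  unfolding oscillation_bound_def
proof (intro conjI allI impI)
  show "continuous_on UNIV (\<lambda>x. f x - a)" "continuous_on UNIV e"
    using assms by (auto simp: oscillation_bound_def intro!: continuous_intros)
  fix x and r :: real assume "0 < r" "ball x (2 * r) \<subseteq> \<Omega>"
  with assms obtain c where "energy (ball x r) (\<lambda>y. f y - c) \<le> energy (ball x (2 * r)) e"
    unfolding oscillation_bound_def by blast
  then show "\<exists>c. energy (ball x r) (\<lambda>y. f y - a - c) \<le> energy (ball x (2 * r)) e"
    by (intro exI[of _ "c - a"]) simp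
qed

lemma energy_Union_le:
  assumes "finite D" and [measurable]: "f \<in> borel_measurable borel" "\<And>x. x \<in> D \<Longrightarrow> S x \<in> sets borel"
    and sub: "K \<subseteq> (\<Union>x\<in>D. S x)"
  shows "energy K f \<le> (\<Sum>x\<in>D. energy (S x) f)"
proof -
  have "energy K f \<le> (\<integral>\<^sup>+y. (\<Sum>x\<in>D. ennreal ((norm (f y))\<^sup>2) * indicator (S x) y) \<partial>lborel)"
    unfolding energy_def
  proof (rule nn_integral_mono)
    fix y
    show "ennreal ((norm (f y))\<^sup>2) * indicator K y \<le> (\<Sum>x\<in>D. ennreal ((norm (f y))\<^sup>2) * indicator (S x) y)"
    proof (cases "y \<in> K")
      case True
      with sub obtain x where x: "x \<in> D" "y \<in> S x" by blast
      then have "ennreal ((norm (f y))\<^sup>2) * indicator K y = ennreal ((norm (f y))\<^sup>2) * indicator (S x) y" using True by simp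
      also have "\<dots> \<le> (\<Sum>x\<in>D. ennreal ((norm (f y))\<^sup>2) * indicator (S x) y)"
        by (rule member_le_sum) (use x \<open>finite D\<close> in auto)
      finally show ?thesis .
    qed simp
  qed
  also have "\<dots> = (\<Sum>x\<in>D. energy (S x) f)"
    unfolding energy_def by (rule nn_integral_sum) (use assms in measurable)
  finally show ?thesis .
qed

text \<open>
  On \<open>A\<close> the function is close to a constant \<open>c\<close>, and \<open>c\<close> itself is controlled on the smaller
  set \<open>B\<close>.
\<close>

lemma energy_transfer:
  fixes f :: "'a::euclidean_space \<Rightarrow> 'b::euclidean_space"
  assumes [measurable]: "f \<in> borel_measurable borel" "A \<in> sets borel" "B \<in> sets borel"
    and sub: "B \<subseteq> A" and fin: "emeasure lborel A < top" "0 < emeasure lborel B"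
    and le: "energy A (\<lambda>x. f x - c) \<le> E"
  shows "energy A f \<le> (2 + 4 * (emeasure lborel A / emeasure lborel B)) * (E + energy B f)"
proof -
  define k where "k = emeasure lborel A / emeasure lborel B"
  have Bfin: "emeasure lborel B < top"
    using emeasure_mono[OF sub, of lborel] fin(1) by (simp add: order_le_less_trans)
  have k: "emeasure lborel A = k * emeasure lborel B"
    using fin(2) Bfin unfolding k_def
    by (simp add: ennreal_divide_times[symmetric] ennreal_times_divide mult.commute ennreal_mult_divide_eq less_top[symmetric])
  have "energy B (\<lambda>x. c) = energy B (\<lambda>x. f x + - (f x - c))" by simp
  also have "\<dots> \<le> 2 * energy B f + 2 * energy B (\<lambda>x. - (f x - c))" by (rule energy_add_le) measurable
  also have "energy B (\<lambda>x. - (f x - c)) = energy B (\<lambda>x. f x - c)" by (simp add: energy_def norm_minus_commute)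
  also have "\<dots> \<le> E" by (rule order_trans[OF energy_mono_set[OF sub] le])
  finally have c: "energy B (\<lambda>x. c) \<le> 2 * energy B f + 2 * E" by (simp add: mult_left_mono)
  have "energy A f = energy A (\<lambda>x. (f x - c) + c)" by simp
  also have "\<dots> \<le> 2 * energy A (\<lambda>x. f x - c) + 2 * energy A (\<lambda>x. c)" by (rule energy_add_le) measurable
  also have "energy A (\<lambda>x. c) = k * energy B (\<lambda>x. c)" by (simp add: energy_const k mult_ac)
  also have "2 * energy A (\<lambda>x. f x - c) + 2 * (k * energy B (\<lambda>x. c)) \<le> 2 * E + 2 * (k * (2 * energy B f + 2 * E))"
    by (intro add_mono mult_left_mono le c) auto
  also have "2 * (k * (2 * energy B f + 2 * E)) = 4 * k * (E + energy B f)"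
    by (simp add: distrib_left mult_ac add.commute)
  also have "2 * E + 4 * k * (E + energy B f) \<le> 2 * (E + energy B f) + 4 * k * (E + energy B f)"
    by (intro add_right_mono mult_left_mono) auto
  finally show ?thesis by (simp only: k_def distrib_right)
qed

lemma oscillation_bound_measurable:
  assumes "oscillation_bound \<Omega> f e"
  shows "f \<in> borel_measurable borel" "e \<in> borel_measurable borel"
  using assms by (auto simp: oscillation_bound_def intro: borel_measurable_continuous_onI)

text \<open>
  The points with the asserted property form a set that is open and closed in \<open>\<Omega>\<close>: by
  \<open>energy_transfer\<close> the estimate passes between any two points of a ball whose double lies in \<open>\<Omega>\<close>.
\<close>

lemma interior_propagation:
  fixes \<Omega> :: "(real^'n::finite) set"
  assumes "open \<Omega>" "connected \<Omega>" "0 < r0" "ball x0 r0 \<subseteq> \<Omega>" "x \<in> \<Omega>"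
  shows "\<exists>\<rho> C. 0 < \<rho> \<and> C < top \<and> (\<forall>(f :: real^'n \<Rightarrow> 'b::euclidean_space) (e :: real^'n \<Rightarrow> 'c::euclidean_space).
     oscillation_bound \<Omega> f e \<longrightarrow> energy (ball x \<rho>) f \<le> C * (energy \<Omega> e + energy (ball x0 r0) f))"
proof -
  define P where "P x \<longleftrightarrow> (\<exists>\<rho> C. 0 < \<rho> \<and> C < top \<and> (\<forall>(f :: real^'n \<Rightarrow> 'b) (e :: real^'n \<Rightarrow> 'c).
     oscillation_bound \<Omega> f e \<longrightarrow> energy (ball x \<rho>) f \<le> C * (energy \<Omega> e + energy (ball x0 r0) f)))" for x
  have "P x"
  proof (rule connected_induction_simple[OF \<open>connected \<Omega>\<close>])
    show "x0 \<in> \<Omega>" "x \<in> \<Omega>" using assms by auto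
    show "P x0"
      unfolding P_def by (rule exI[of _ r0], rule exI[of _ 1]) (use \<open>0 < r0\<close> in \<open>auto simp: distrib_left\<close>)
    fix a assume "a \<in> \<Omega>"
    then obtain s where s: "0 < s" "ball a s \<subseteq> \<Omega>" using \<open>open \<Omega>\<close> openE by blast
    define r where "r = s / 2"
    have r: "0 < r" "ball a (2 * r) \<subseteq> \<Omega>" using s by (auto simp: r_def)
    define T where "T = ball a r"
    show "\<exists>T. openin (top_of_set \<Omega>) T \<and> a \<in> T \<and> (\<forall>x\<in>T. \<forall>y\<in>T. P x \<longrightarrow> P y)"
    proof (intro exI[of _ T] conjI ballI impI)
      have "T \<subseteq> ball a (2 * r)" unfolding T_def using r by (intro subset_ball) simp
      then have "T \<subseteq> \<Omega>" using r by blast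
      then show "openin (top_of_set \<Omega>) T" unfolding T_def using openin_open_eq[OF \<open>open \<Omega>\<close>] by simp
      show "a \<in> T" using r by (simp add: T_def)
      fix x y assume "x \<in> T" "y \<in> T" "P x"
      from \<open>P x\<close> obtain \<rho> C where \<rho>: "0 < \<rho>" "C < top" and le:
        "\<And>(f :: real^'n \<Rightarrow> 'b) (e :: real^'n \<Rightarrow> 'c). oscillation_bound \<Omega> f e \<Longrightarrow> energy (ball x \<rho>) f \<le> C * (energy \<Omega> e + energy (ball x0 r0) f)"
        unfolding P_def by blast
      have "open T" by (simp add: T_def)
      then obtain s' where s': "0 < s'" "ball x s' \<subseteq> T" using \<open>x \<in> T\<close> openE by blast
      define B where "B = ball x (min \<rho> s')"
      have B: "B \<subseteq> T" "B \<subseteq> ball x \<rho>" using s' by (auto simp: B_def)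
      obtain q where q: "0 < q" "ball y q \<subseteq> T" using \<open>y \<in> T\<close> \<open>open T\<close> openE by blast
      define k where "k = emeasure lborel T / emeasure lborel B"
      have mB: "0 < emeasure lborel B" unfolding B_def by (rule emeasure_ball_pos_finite) (use \<rho> s' in auto)
      have mT: "emeasure lborel T < top" using emeasure_ball_pos_finite[OF r(1), of a] by (simp add: T_def)
      have "k < top" unfolding k_def using mB mT by (simp add: ennreal_divide_eq_top_iff less_top[symmetric] zero_less_iff_neq_zero)
      show "P y"
        unfolding P_def
      proof (intro exI conjI allI impI)
        show "0 < q" by (rule q)
        show "(2 + 4 * k) * (1 + C) < top" using \<open>k < top\<close> \<rho> by (simp add: ennreal_mult_less_top)
        fix f :: "real^'n \<Rightarrow> 'b" and e :: "real^'n \<Rightarrow> 'c" assume o: "oscillation_bound \<Omega> f e"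
        note [measurable] = oscillation_bound_measurable[OF o]
        from o r obtain c where "energy T (\<lambda>y. f y - c) \<le> energy (ball a (2 * r)) e"
          unfolding oscillation_bound_def T_def by blast
        also have "\<dots> \<le> energy \<Omega> e" by (rule energy_mono_set[OF r(2)])
        finally have c: "energy T (\<lambda>y. f y - c) \<le> energy \<Omega> e" .
        have "energy (ball y q) f \<le> energy T f" by (rule energy_mono_set[OF q(2)])
        also have "\<dots> \<le> (2 + 4 * k) * (energy \<Omega> e + energy B f)"
          unfolding k_def by (rule energy_transfer[OF _ _ _ B(1) mT mB c]) (auto simp: T_def B_def)
        also have "\<dots> \<le> (2 + 4 * k) * (1 * (energy \<Omega> e + energy (ball x0 r0) f) + C * (energy \<Omega> e + energy (ball x0 r0) f))"
          by (intro mult_left_mono add_mono order_trans[OF energy_mono_set[OF B(2)] le[OF o]]) auto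
        also have "\<dots> = (2 + 4 * k) * (1 + C) * (energy \<Omega> e + energy (ball x0 r0) f)"
          by (simp only: distrib_right[symmetric] mult.assoc)
        finally show "energy (ball y q) f \<le> (2 + 4 * k) * (1 + C) * (energy \<Omega> e + energy (ball x0 r0) f)" .
      qed
    qed
  qed
  then show ?thesis unfolding P_def .
qed

lemma compact_propagation:
  fixes \<Omega> :: "(real^'n::finite) set"
  assumes \<Omega>: "open \<Omega>" "connected \<Omega>" "0 < r0" "ball x0 r0 \<subseteq> \<Omega>" and K: "compact K" "K \<subseteq> \<Omega>"
  shows "\<exists>C<top. \<forall>(f :: real^'n \<Rightarrow> 'b::euclidean_space) (e :: real^'n \<Rightarrow> 'c::euclidean_space).
     oscillation_bound \<Omega> f e \<longrightarrow> energy K f \<le> C * (energy \<Omega> e + energy (ball x0 r0) f)"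
proof -
  have "\<forall>x\<in>K. \<exists>\<rho> C. 0 < \<rho> \<and> C < top \<and> (\<forall>(f :: real^'n \<Rightarrow> 'b) (e :: real^'n \<Rightarrow> 'c).
     oscillation_bound \<Omega> f e \<longrightarrow> energy (ball x \<rho>) f \<le> C * (energy \<Omega> e + energy (ball x0 r0) f))"
    using interior_propagation[OF \<Omega>] K(2) by blast
  then obtain \<rho> C where \<rho>: "\<And>x. x \<in> K \<Longrightarrow> 0 < \<rho> x" "\<And>x. x \<in> K \<Longrightarrow> C x < top" and
    le: "\<And>x (f :: real^'n \<Rightarrow> 'b) (e :: real^'n \<Rightarrow> 'c). x \<in> K \<Longrightarrow> oscillation_bound \<Omega> f e \<Longrightarrow>
      energy (ball x (\<rho> x)) f \<le> C x * (energy \<Omega> e + energy (ball x0 r0) f)"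
    by metis
  obtain D where D: "D \<subseteq> K" "finite D" "K \<subseteq> (\<Union>x\<in>D. ball x (\<rho> x))"
  proof (rule compactE_image[OF K(1)])
    show "open (ball x (\<rho> x))" for x by simp
    show "K \<subseteq> (\<Union>x\<in>K. ball x (\<rho> x))" using \<rho>(1) by force
  qed
  show ?thesis
  proof (intro exI[of _ "\<Sum>x\<in>D. C x"] conjI allI impI)
    show "(\<Sum>x\<in>D. C x) < top" using D \<rho>(2) by (auto simp: less_top[symmetric])
    fix f :: "real^'n \<Rightarrow> 'b" and e :: "real^'n \<Rightarrow> 'c" assume o: "oscillation_bound \<Omega> f e"
    have "energy K f \<le> (\<Sum>x\<in>D. energy (ball x (\<rho> x)) f)"
      by (rule energy_Union_le) (use D oscillation_bound_measurable[OF o] in auto)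
    also have "\<dots> \<le> (\<Sum>x\<in>D. C x * (energy \<Omega> e + energy (ball x0 r0) f))"
      by (intro sum_mono le o) (use D in auto)
    finally show "energy K f \<le> (\<Sum>x\<in>D. C x) * (energy \<Omega> e + energy (ball x0 r0) f)"
      by (simp add: sum_distrib_right)
  qed
qed

lemma ennreal_absorb:
  assumes "X < top" "0 \<le> \<theta>" "\<theta> < 1" and le: "X \<le> \<alpha> + ennreal \<theta> * X"
  shows "X \<le> ennreal (1 / (1 - \<theta>)) * \<alpha>"
proof (cases "\<alpha> = top")
  case True
  then show ?thesis using assms by (simp add: ennreal_mult_top)
next
  case False
  then obtain a where a: "\<alpha> = ennreal a" "0 \<le> a" by (cases \<alpha>) auto
  obtain x where x: "X = ennreal x" "0 \<le> x" using \<open>X < top\<close> by (cases X) auto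
  have "ennreal x \<le> ennreal (a + \<theta> * x)"
    using le a x assms by (simp add: ennreal_mult)
  then have "x \<le> a + \<theta> * x" using a x assms by (subst (asm) ennreal_le_iff) auto
  then have "x * (1 - \<theta>) \<le> a" by (simp add: algebra_simps)
  then have "x \<le> 1 / (1 - \<theta>) * a" using assms by (simp add: field_simps)
  then show ?thesis using a x assms by (simp add: ennreal_mult[symmetric] ennreal_leI)
qed

text \<open>
  The map \<open>y \<mapsto> y - \<kappa> \<tau>(y) e\<close> multiplies the depth \<open>\<tau>\<close> below the graph of \<open>g\<close> by \<open>1 + \<kappa>\<close>, hence
  it should multiply volumes by \<open>1 + \<kappa>\<close>. No differentiability of \<open>g\<close> is at hand, so instead of
  changing variables one averages over translations by \<open>t e\<close>, \<open>0 \<le> t \<le> 2 h\<close>: along each vertical line the map is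
  affine. The images of the translations fill an interval longer by \<open>\<kappa> h\<close>, which turns the factor
  \<open>1 / (1 + \<kappa>)\<close> into \<open>(1 + \<kappa>/2) / (1 + \<kappa>)\<close>; it is still less than one.
\<close>

lemma nn_integral_vertical_dilation:
  fixes F :: "'a::euclidean_space \<Rightarrow> ennreal"
  assumes [measurable]: "F \<in> borel_measurable borel" "g \<in> borel_measurable borel"
    and e: "norm e = 1" and inv: "\<And>y t. g (y + t *\<^sub>R e) = g y" and \<kappa>: "0 < \<kappa>" and h: "0 < h"
  defines "\<tau> \<equiv> \<lambda>y. g y - y \<bullet> e"
  shows "(\<integral>\<^sup>+y. (if 0 < \<tau> y \<and> \<tau> y < h then F (y - (\<kappa> * \<tau> y) *\<^sub>R e) else 0) \<partial>lborel)
    \<le> ennreal ((1 + \<kappa> / 2) / (1 + \<kappa>)) * (\<integral>\<^sup>+y. (if 0 < \<tau> y \<and> \<tau> y < (1 + \<kappa>) * h then F y else 0) \<partial>lborel)"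
proof -
  define lam where "lam = 1 + \<kappa>"
  have l: "0 < lam" using \<kappa> by (simp add: lam_def)
  define H where "H y = (if 0 < \<tau> y \<and> \<tau> y < h then F (y - (\<kappa> * \<tau> y) *\<^sub>R e) else 0)" for y
  define K where "K y = (if 0 < \<tau> y \<and> \<tau> y < (1 + \<kappa>) * h then F y else 0)" for y
  have [measurable]: "\<tau> \<in> borel_measurable borel" unfolding \<tau>_def by measurable
  have [measurable]: "H \<in> borel_measurable borel" "K \<in> borel_measurable borel"
    unfolding H_def K_def by measurable
  have ee: "e \<bullet> e = 1" using e by (simp add: power2_norm_eq_inner[symmetric])
  have \<tau>: "\<tau> (y + t *\<^sub>R e) = \<tau> y - t" for y t by (simp add: \<tau>_def inv inner_add_left ee)
  \<comment> \<open>Along a vertical line the dilation is the affine map \<open>t \<mapsto> - \<kappa> \<tau> y + lam t\<close>.\<close>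
  have line: "ennreal lam * (\<integral>\<^sup>+t. H (y + t *\<^sub>R e) * indicator {0..2*h} t \<partial>lborel) \<le> (\<integral>\<^sup>+s. K (y + s *\<^sub>R e) * indicator {-\<kappa>*h..2*h} s \<partial>lborel)" for y
  proof -
    have "(\<integral>\<^sup>+s. K (y + s *\<^sub>R e) * indicator {-\<kappa>*h..2*h} s \<partial>lborel)
      = ennreal \<bar>lam\<bar> * (\<integral>\<^sup>+t. K (y + (- \<kappa> * \<tau> y + lam * t) *\<^sub>R e) * indicator {-\<kappa>*h..2*h} (- \<kappa> * \<tau> y + lam * t) \<partial>lborel)"
      by (rule nn_integral_real_affine) (use l in auto)
    moreover have "(\<integral>\<^sup>+t. H (y + t *\<^sub>R e) * indicator {0..2*h} t \<partial>lborel)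
       \<le> (\<integral>\<^sup>+t. K (y + (- \<kappa> * \<tau> y + lam * t) *\<^sub>R e) * indicator {-\<kappa>*h..2*h} (- \<kappa> * \<tau> y + lam * t) \<partial>lborel)"
    proof (rule nn_integral_mono)
      fix t
      show "H (y + t *\<^sub>R e) * indicator {0..2*h} t \<le> K (y + (- \<kappa> * \<tau> y + lam * t) *\<^sub>R e) * indicator {-\<kappa>*h..2*h} (- \<kappa> * \<tau> y + lam * t)"
      proof (cases "t \<in> {0..2*h} \<and> 0 < \<tau> y - t \<and> \<tau> y - t < h")
        case True
        define s where "s = - \<kappa> * \<tau> y + lam * t"
        have s: "s = t - \<kappa> * (\<tau> y - t)" "\<tau> y - s = (1 + \<kappa>) * (\<tau> y - t)" by (auto simp: s_def lam_def algebra_simps)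
        have m: "0 < \<kappa> * (\<tau> y - t)" "\<kappa> * (\<tau> y - t) \<le> \<kappa> * h" "0 < (1 + \<kappa>) * (\<tau> y - t)" "(1 + \<kappa>) * (\<tau> y - t) < (1 + \<kappa>) * h"
          using True \<kappa> by auto
        have sr: "s \<in> {-\<kappa>*h..2*h}" using True m s(1) by auto
        have pe: "y + t *\<^sub>R e - (\<kappa> * (\<tau> y - t)) *\<^sub>R e = y + s *\<^sub>R e" by (simp add: s(1) algebra_simps)
        have "H (y + t *\<^sub>R e) = F (y + s *\<^sub>R e)" using True by (simp only: H_def \<tau> pe) simp
        moreover have "K (y + s *\<^sub>R e) = F (y + s *\<^sub>R e)" using m(3,4) by (simp only: K_def \<tau> s(2)) simp
        ultimately show ?thesis unfolding s_def[symmetric] using sr by (simp add: indicator_def)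
      qed (auto simp: H_def \<tau> indicator_def)
    qed
    ultimately show ?thesis using l by (simp add: mult_left_mono)
  qed
  have avg: "(\<integral>\<^sup>+y. (\<integral>\<^sup>+t. G (y + t *\<^sub>R e) * indicator {a..b} t \<partial>lborel) \<partial>lborel) = ennreal (b - a) * (\<integral>\<^sup>+y. G y \<partial>lborel)"
    if [measurable]: "G \<in> borel_measurable borel" and "a \<le> b" for G :: "'a \<Rightarrow> ennreal" and a b :: real
  proof -
    have "(\<integral>\<^sup>+y. (\<integral>\<^sup>+t. G (y + t *\<^sub>R e) * indicator {a..b} t \<partial>lborel) \<partial>lborel) = (\<integral>\<^sup>+t. (\<integral>\<^sup>+y. G (y + t *\<^sub>R e) * indicator {a..b} t \<partial>lborel) \<partial>lborel)"
      by (rule lborel_pair.Fubini') measurable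
    also have "\<dots> = (\<integral>\<^sup>+t. (\<integral>\<^sup>+y. G y \<partial>lborel) * indicator {a..b} t \<partial>lborel)"
      by (intro nn_integral_cong) (simp add: nn_integral_multc nn_integral_translate)
    also have "\<dots> = ennreal (b - a) * (\<integral>\<^sup>+y. G y \<partial>lborel)"
      using \<open>a \<le> b\<close> by (simp add: nn_integral_cmult_indicator mult.commute)
    finally show ?thesis .
  qed
  have "ennreal lam * (ennreal (2 * h) * (\<integral>\<^sup>+y. H y \<partial>lborel)) = (\<integral>\<^sup>+y. ennreal lam * (\<integral>\<^sup>+t. H (y + t *\<^sub>R e) * indicator {0..2*h} t \<partial>lborel) \<partial>lborel)"
    using avg[of H 0 "2 * h"] h by (simp add: nn_integral_cmult)
  also have "\<dots> \<le> (\<integral>\<^sup>+y. (\<integral>\<^sup>+s. K (y + s *\<^sub>R e) * indicator {-\<kappa>*h..2*h} s \<partial>lborel) \<partial>lborel)"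
    by (rule nn_integral_mono) (rule line)
  also have "\<dots> = ennreal ((2 + \<kappa>) * h) * (\<integral>\<^sup>+y. K y \<partial>lborel)"
  proof -
    have le: "-\<kappa>*h \<le> 2*h" using h \<kappa> by (simp add: order_trans[of _ 0])
    show ?thesis using avg[OF _ le, of K] by (simp add: algebra_simps)
  qed
  finally have fin: "ennreal lam * (ennreal (2 * h) * (\<integral>\<^sup>+y. H y \<partial>lborel)) \<le> ennreal ((2 + \<kappa>) * h) * (\<integral>\<^sup>+y. K y \<partial>lborel)" .
  define p where "p = 1 / (lam * (2 * h))"
  have p: "0 \<le> p" using l h by (simp add: p_def)
  have "(\<integral>\<^sup>+y. H y \<partial>lborel) = ennreal p * (ennreal lam * (ennreal (2 * h) * (\<integral>\<^sup>+y. H y \<partial>lborel)))"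
  proof -
    have "ennreal p * (ennreal lam * ennreal (2 * h)) = 1"
      using l h p by (simp add: ennreal_mult[symmetric] p_def del: ennreal_mult_less_top)
    then show ?thesis by (simp add: mult.assoc[symmetric])
  qed
  also have "\<dots> \<le> ennreal p * (ennreal ((2 + \<kappa>) * h) * (\<integral>\<^sup>+y. K y \<partial>lborel))"
    by (rule mult_left_mono[OF fin]) simp
  also have "\<dots> = ennreal (p * ((2 + \<kappa>) * h)) * (\<integral>\<^sup>+y. K y \<partial>lborel)"
    using p by (simp add: ennreal_mult' mult.assoc)
  also have "p * ((2 + \<kappa>) * h) = (1 + \<kappa> / 2) / (1 + \<kappa>)"
  proof -
    have "p * ((2 + \<kappa>) * h) = ((2 + \<kappa>) * h) / ((2 * lam) * h)" by (simp add: p_def mult_ac)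
    also have "\<dots> = (2 + \<kappa>) / (2 * lam)" using h by (rule_tac mult_divide_mult_cancel_right) simp
    also have "\<dots> = (1 + \<kappa> / 2) / lam" using l by (simp add: divide_simps)
    finally show ?thesis by (simp add: lam_def)
  qed
  finally show ?thesis by (simp add: H_def K_def)
qed

section \<open>From balls to domains: the boundary layer\<close>

lemma emeasure_lborel_ball_scale:
  fixes a :: "'a::euclidean_space"
  assumes "0 < r"
  shows "emeasure lborel (ball a r) = ennreal (r ^ DIM('a)) * emeasure lborel (ball (0::'a) 1)"
  using energy_affine[of "\<lambda>_::'a. 1::real" r a 1] assms by (simp add: energy_const)

text \<open>
  For \<open>z\<close> in the layer, let \<open>B\<close> be the ball of radius \<open>b \<tau>(z)\<close> about \<open>z\<close>. A point \<open>y\<close> of the concentric ball of a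
  quarter of the radius and its image under the dilation both lie in \<open>B\<close>, where \<open>f\<close> is close to
  a constant. Integrating these estimates over \<open>z\<close> with weight \<open>\<tau>(z) ^ - n\<close> counts every point of \<open>D\<close> at least
  \<open>c1\<close> times and every point of \<open>\<Omega>\<close> at most \<open>96 ^ n c1\<close> times, because \<open>\<tau>\<close> is almost constant on these balls. The
  choice of \<open>b\<close> makes \<open>\<tau>\<close> vary by at most a quarter on the doubled balls.
\<close>

lemma vertical_increment_energy:
  fixes \<Omega> D Z :: "(real^'n::finite) set" and f :: "real^'n \<Rightarrow> 'b::euclidean_space" and \<epsilon> :: "real^'n \<Rightarrow> 'c::euclidean_space"
  assumes e: "norm e = 1" and inv: "\<And>y t. g (y + t *\<^sub>R e) = g y" and L: "1 \<le> L"
    and lip: "\<And>y z. \<bar>(g y - y \<bullet> e) - (g z - z \<bullet> e)\<bar> \<le> L * dist y z"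
    and osc: "oscillation_bound \<Omega> f \<epsilon>"
    and [measurable]: "g \<in> borel_measurable borel" "D \<in> sets borel" "Z \<in> sets borel" "\<Omega> \<in> sets borel"
  defines "\<tau> \<equiv> \<lambda>y. g y - y \<bullet> e" and "b \<equiv> 1 / (8 * L)"
  assumes Z: "\<And>z. z \<in> Z \<Longrightarrow> 0 < \<tau> z" "\<And>z. z \<in> Z \<Longrightarrow> ball z (2 * (b * \<tau> z)) \<subseteq> \<Omega>"
    and D: "\<And>y. y \<in> D \<Longrightarrow> 0 < \<tau> y" "\<And>y. y \<in> D \<Longrightarrow> ball y (b * \<tau> y / 8) \<subseteq> Z"
  shows "energy D (\<lambda>y. f y - f (y - (b / 4 * \<tau> y) *\<^sub>R e)) \<le> ennreal (4 * 96 ^ CARD('n)) * energy \<Omega> \<epsilon>"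
proof -
  define N where "N = CARD('n)"
  define \<omega> where "\<omega> = emeasure lborel (ball (0::real^'n) 1)"
  have \<omega>: "0 < \<omega>" "\<omega> < top" using emeasure_ball_pos_finite[of 1 "0::real^'n"] by (auto simp: \<omega>_def)
  have b: "0 < b" "b \<le> 1/8" "L * b = 1/8" using L by (auto simp: b_def field_simps)
  have cf: "continuous_on UNIV f" and c\<epsilon>: "continuous_on UNIV \<epsilon>" using osc by (auto simp: oscillation_bound_def)
  have [measurable]: "f \<in> borel_measurable borel" "\<epsilon> \<in> borel_measurable borel"
    using oscillation_bound_measurable[OF osc] by auto
  have [measurable]: "\<tau> \<in> borel_measurable borel" unfolding \<tau>_def by measurable
  have lip: "\<bar>\<tau> y - \<tau> z\<bar> \<le> L * dist y z" for y z unfolding \<tau>_def by (rule lip)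
  \<comment> \<open>\<open>\<tau>\<close> is \<open>L\<close>-Lipschitz and \<open>L * b = 1/8\<close>.\<close>
  have near: "\<bar>\<tau> y - \<tau> z\<bar> < k * t / 8" if "dist y z < k * (b * t)" for y z k t
  proof -
    have "L * dist y z < L * (k * (b * t))" using that L by (intro mult_strict_left_mono) auto
    also have "\<dots> = (L * b) * k * t" by simp
    also have "\<dots> = k * t / 8" using b(3) by simp
    finally show ?thesis using lip[of y z] by linarith
  qed
  define T where "T y = y - (b / 4 * \<tau> y) *\<^sub>R e" for y
  have [measurable]: "T \<in> borel_measurable borel" unfolding T_def by measurable
  define \<Delta> where "\<Delta> y = ennreal ((norm (f y - f (T y)))\<^sup>2)" for y
  have [measurable]: "\<Delta> \<in> borel_measurable borel" unfolding \<Delta>_def by measurable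
  let ?d = "\<lambda>y z. if dist y z < b * \<tau> z / 4 then \<Delta> y else 0"
  have J: "(\<integral>\<^sup>+y. ?d y z \<partial>lborel) \<le> 4 * energy (ball z (2 * (b * \<tau> z))) \<epsilon>" if z: "z \<in> Z" for z
  proof -
    have \<tau>z: "0 < \<tau> z" by (rule Z(1)[OF z])
    define r where "r = b * \<tau> z"
    have r: "0 < r" using b \<tau>z by (simp add: r_def)
    obtain c where c: "energy (ball z r) (\<lambda>y. f y - c) \<le> energy (ball z (2 * r)) \<epsilon>"
      using osc r Z(2)[OF z] unfolding oscillation_bound_def r_def by blast
    define F where "F y = (if dist y z < r then ennreal ((norm (f y - c))\<^sup>2) else 0)" for y
    have [measurable]: "F \<in> borel_measurable borel" unfolding F_def by measurable
    let ?T = "\<lambda>y. if 0 < \<tau> y \<and> \<tau> y < 2 * \<tau> z then F (y - (b / 4 * \<tau> y) *\<^sub>R e) else 0"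
    have IF: "(\<integral>\<^sup>+y. F y \<partial>lborel) = energy (ball z r) (\<lambda>y. f y - c)"
      unfolding energy_def F_def by (intro nn_integral_cong) (auto simp: indicator_def dist_commute)
    have "(\<integral>\<^sup>+y. ?d y z \<partial>lborel)
      \<le> (\<integral>\<^sup>+y. 2 * F y + 2 * ?T y \<partial>lborel)"
    proof (rule nn_integral_mono)
      fix y
      show "?d y z \<le> 2 * F y + 2 * ?T y"
      proof (cases "dist y z < b * \<tau> z / 4")
        case True
        have \<tau>y: "\<bar>\<tau> y - \<tau> z\<bar> < \<tau> z / 32" using near[of y z "1/4" "\<tau> z"] True by simp
        have \<tau>yp: "0 < \<tau> y" using \<tau>y \<tau>z by linarith
        have 1: "dist y z < r" using True r by (simp add: r_def)
        have "dist (T y) z \<le> dist (T y) y + dist y z" by (rule dist_triangle)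
        also have "dist (T y) y = b / 4 * \<tau> y" using e b \<tau>yp by (simp add: T_def dist_norm abs_of_pos)
        also have "b / 4 * \<tau> y + dist y z < b / 4 * (2 * \<tau> z) + b * \<tau> z / 4"
        proof -
          have "\<tau> y \<le> 2 * \<tau> z" using \<tau>y \<tau>z by linarith
          then have "b / 4 * \<tau> y \<le> b / 4 * (2 * \<tau> z)" by (rule mult_left_mono) (use b in simp)
          then show ?thesis using True by linarith
        qed
        also have "\<dots> \<le> r" using r by (simp add: r_def)
        finally have 2: "dist (T y) z < r" .
        have "(norm (f y - f (T y)))\<^sup>2 \<le> 2 * (norm (f y - c))\<^sup>2 + 2 * (norm (f (T y) - c))\<^sup>2"
        proof -
          have "norm (f y - f (T y)) \<le> norm (f y - c) + norm (f (T y) - c)"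
            using norm_triangle_ineq4[of "f y - c" "f (T y) - c"] by simp
          then have "(norm (f y - f (T y)))\<^sup>2 \<le> (norm (f y - c) + norm (f (T y) - c))\<^sup>2" by (rule power_mono) simp
          also have "\<dots> \<le> 2 * (norm (f y - c))\<^sup>2 + 2 * (norm (f (T y) - c))\<^sup>2"
            using zero_le_power2[of "norm (f y - c) - norm (f (T y) - c)"] by (simp add: power2_eq_square algebra_simps)
          finally show ?thesis .
        qed
        then have "\<Delta> y \<le> 2 * ennreal ((norm (f y - c))\<^sup>2) + 2 * ennreal ((norm (f (T y) - c))\<^sup>2)"
          unfolding \<Delta>_def by (simp add: ennreal_plus[symmetric] ennreal_mult[symmetric] del: ennreal_plus flip: ennreal_numeral)
        moreover have "0 < \<tau> y" "\<tau> y < 2 * \<tau> z" using \<tau>y \<tau>z by linarith+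
        moreover have "F (y - (b / 4 * \<tau> y) *\<^sub>R e) = ennreal ((norm (f (T y) - c))\<^sup>2)" using 2 by (simp add: F_def T_def)
        moreover have "F y = ennreal ((norm (f y - c))\<^sup>2)" using 1 by (simp add: F_def)
        ultimately show ?thesis using True by simp
      qed simp
    qed
    also have "\<dots> = 2 * (\<integral>\<^sup>+y. F y \<partial>lborel) + 2 * (\<integral>\<^sup>+y. ?T y \<partial>lborel)"
      by (simp add: nn_integral_add nn_integral_cmult)
    also have "\<dots> \<le> 2 * (\<integral>\<^sup>+y. F y \<partial>lborel) + 2 * (1 * (\<integral>\<^sup>+y. F y \<partial>lborel))"
    proof (intro add_left_mono mult_left_mono)
      have "(\<integral>\<^sup>+y. ?T y \<partial>lborel)
        \<le> ennreal ((1 + b / 4 / 2) / (1 + b / 4)) * (\<integral>\<^sup>+y. (if 0 < \<tau> y \<and> \<tau> y < (1 + b / 4) * (2 * \<tau> z) then F y else 0) \<partial>lborel)"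
        unfolding \<tau>_def
        by (rule nn_integral_vertical_dilation[OF _ _ e inv]) (measurable, use b \<tau>z in \<open>simp_all add: \<tau>_def\<close>)
      also have "\<dots> \<le> 1 * (\<integral>\<^sup>+y. F y \<partial>lborel)"
      proof (rule mult_mono)
        show "ennreal ((1 + b / 4 / 2) / (1 + b / 4)) \<le> 1" using b by (simp add: divide_le_eq)
      qed (auto intro: nn_integral_mono)
      finally show "(\<integral>\<^sup>+y. ?T y \<partial>lborel) \<le> 1 * (\<integral>\<^sup>+y. F y \<partial>lborel)" .
    qed auto
    also have "\<dots> = 4 * energy (ball z r) (\<lambda>y. f y - c)" by (simp add: IF distrib_right[symmetric])
    also have "\<dots> \<le> 4 * energy (ball z (2 * r)) \<epsilon>" by (rule mult_left_mono[OF c]) simp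
    finally show ?thesis by (simp add: r_def)
  qed
  let ?a = "\<lambda>y z. if z \<in> Z \<and> dist y z < b * \<tau> z / 4 then ennreal (1 / \<tau> z ^ N) else 0" and ?b = "\<lambda>w z. if z \<in> Z \<and> dist w z < 2 * (b * \<tau> z) then ennreal (1 / \<tau> z ^ N) else 0"
  have lower: "ennreal ((b/16) ^ N) * \<omega> \<le> (\<integral>\<^sup>+z. ?a y z \<partial>lborel)" if y: "y \<in> D" for y
  proof -
    have \<tau>y: "0 < \<tau> y" by (rule D(1)[OF y])
    have "ennreal ((b/16) ^ N) * \<omega> = ennreal (1 / (2 * \<tau> y) ^ N) * emeasure lborel (ball y (b * \<tau> y / 8))"
    proof -
      have "b / 16 = (1 / (2 * \<tau> y)) * (b * \<tau> y / 8)" using \<tau>y by simp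
      then have "(b/16) ^ N = 1 / (2 * \<tau> y) ^ N * (b * \<tau> y / 8) ^ N"
        by (simp only: power_mult_distrib[of "1 / (2 * \<tau> y)"] power_one_over[of "2 * \<tau> y"])
      then have "ennreal ((b/16) ^ N) = ennreal (1 / (2 * \<tau> y) ^ N) * ennreal ((b * \<tau> y / 8) ^ N)"
        using \<tau>y by (simp only: ennreal_mult'[of "1 / (2 * \<tau> y) ^ N"] zero_le_divide_1_iff zero_le_power less_imp_le mult_nonneg_nonneg zero_le_numeral)
      moreover have "emeasure lborel (ball y (b * \<tau> y / 8)) = ennreal ((b * \<tau> y / 8) ^ N) * \<omega>"
        using \<tau>y b by (subst emeasure_lborel_ball_scale) (simp_all add: \<omega>_def N_def)
      ultimately show ?thesis by (simp only: mult.assoc)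
    qed
    also have "\<dots> = (\<integral>\<^sup>+z. ennreal (1 / (2 * \<tau> y) ^ N) * indicator (ball y (b * \<tau> y / 8)) z \<partial>lborel)"
      by (simp add: nn_integral_cmult_indicator)
    also have "\<dots> \<le> (\<integral>\<^sup>+z. ?a y z \<partial>lborel)"
    proof (rule nn_integral_mono)
      fix z
      show "ennreal (1 / (2 * \<tau> y) ^ N) * indicator (ball y (b * \<tau> y / 8)) z \<le> ?a y z"
      proof (cases "z \<in> ball y (b * \<tau> y / 8)")
        case True
        then have d: "dist y z < b * \<tau> y / 8" by simp
        have "\<bar>\<tau> y - \<tau> z\<bar> < \<tau> y / 64" using near[of y z "1/8" "\<tau> y"] d by simp
        then have \<tau>z: "\<tau> y < 2 * \<tau> z" "0 < \<tau> z" "\<tau> z \<le> 2 * \<tau> y" using \<tau>y by linarith+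
        have "b * \<tau> y / 8 \<le> b * \<tau> z / 4" using mult_left_mono[OF less_imp_le[OF \<tau>z(1)], of b] b by simp
        then have "dist y z < b * \<tau> z / 4" using d by linarith
        moreover have "z \<in> Z" using D(2)[OF y] True by blast
        moreover have "1 / (2 * \<tau> y) ^ N \<le> 1 / \<tau> z ^ N"
          using \<tau>z by (intro divide_left_mono power_mono mult_pos_pos zero_less_power) auto
        ultimately show ?thesis using True by (simp add: ennreal_leI)
      qed simp
    qed
    finally show ?thesis .
  qed
  have upper: "(\<integral>\<^sup>+z. ?b w z \<partial>lborel) \<le> ennreal ((6 * b) ^ N) * \<omega> * indicator \<Omega> w" for w
  proof (cases "w \<in> \<Omega> \<and> 0 < \<tau> w")
    case True
    then have \<tau>w: "0 < \<tau> w" by simp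
    have "(\<integral>\<^sup>+z. ?b w z \<partial>lborel)
       \<le> (\<integral>\<^sup>+z. ennreal (1 / (\<tau> w / 2) ^ N) * indicator (ball w (3 * b * \<tau> w)) z \<partial>lborel)"
    proof (rule nn_integral_mono)
      fix z
      show "?b w z \<le> ennreal (1 / (\<tau> w / 2) ^ N) * indicator (ball w (3 * b * \<tau> w)) z"
      proof (cases "z \<in> Z \<and> dist w z < 2 * (b * \<tau> z)")
        case True
        then have "0 < \<tau> z" using Z(1) by blast
        moreover have "\<bar>\<tau> w - \<tau> z\<bar> < \<tau> z / 4" using near[of w z 2 "\<tau> z"] True by simp
        ultimately have \<tau>z: "\<tau> w / 2 \<le> \<tau> z" "2 * \<tau> z \<le> 3 * \<tau> w" by linarith+
        have "2 * (b * \<tau> z) \<le> 3 * b * \<tau> w" using mult_left_mono[OF \<tau>z(2), of b] b by simp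
        then have "z \<in> ball w (3 * b * \<tau> w)" using True by simp
        moreover have "1 / \<tau> z ^ N \<le> 1 / (\<tau> w / 2) ^ N"
          using \<tau>z \<tau>w by (intro divide_left_mono power_mono mult_pos_pos zero_less_power) auto
        ultimately show ?thesis using True by (simp add: ennreal_leI)
      qed auto
    qed
    also have "\<dots> = ennreal (1 / (\<tau> w / 2) ^ N) * emeasure lborel (ball w (3 * b * \<tau> w))"
      by (simp add: nn_integral_cmult_indicator)
    also have "\<dots> = ennreal ((6 * b) ^ N) * \<omega>"
    proof -
      have "(1 / (\<tau> w / 2)) * (3 * b * \<tau> w) = 6 * b" using \<tau>w by simp
      then have "1 / (\<tau> w / 2) ^ N * (3 * b * \<tau> w) ^ N = (6 * b) ^ N"
        by (simp only: power_mult_distrib[of "1 / (\<tau> w / 2)", symmetric] power_one_over[of "\<tau> w / 2", symmetric])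
      moreover have "emeasure lborel (ball w (3 * b * \<tau> w)) = ennreal ((3 * b * \<tau> w) ^ N) * \<omega>"
        using \<tau>w b by (subst emeasure_lborel_ball_scale) (simp_all add: \<omega>_def N_def)
      ultimately show ?thesis
        using \<tau>w b by (simp add: mult.assoc[symmetric] ennreal_mult'[symmetric])
    qed
    finally show ?thesis using True by simp
  next
    case False
    have "\<not> (z \<in> Z \<and> dist w z < 2 * (b * \<tau> z))" for z
    proof
      assume z: "z \<in> Z \<and> dist w z < 2 * (b * \<tau> z)"
      then have "w \<in> \<Omega>" using Z(2)[of z] by (auto simp: dist_commute)
      moreover have "\<bar>\<tau> w - \<tau> z\<bar> < 2 * \<tau> z / 8" using near[of w z 2 "\<tau> z"] z by blast
      then have "0 < \<tau> w" using z Z(1)[of z] by arith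
      ultimately show False using False by simp
    qed
    then show ?thesis by (simp only: if_False nn_integral_const mult_zero_left zero_le)
  qed
  let ?A = "\<lambda>y z. if z \<in> Z \<and> dist y z < b * \<tau> z / 4 then ennreal (1 / \<tau> z ^ N) * \<Delta> y else 0"
    and ?B = "\<lambda>w z. if z \<in> Z \<and> dist w z < 2 * (b * \<tau> z) then ennreal (1 / \<tau> z ^ N) * ennreal ((norm (\<epsilon> w))\<^sup>2) else 0"
  define c1 where "c1 = ennreal ((b/16) ^ N) * \<omega>"
  have c1: "0 < c1" "c1 < top" using \<omega> b by (auto simp: c1_def ennreal_zero_less_mult_iff ennreal_mult_less_top)
  have mD: "energy D (\<lambda>y. f y - f (y - (b / 4 * \<tau> y) *\<^sub>R e)) = (\<integral>\<^sup>+y\<in>D. \<Delta> y \<partial>lborel)"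
    by (simp add: energy_def \<Delta>_def T_def)
  have "c1 * (\<integral>\<^sup>+y\<in>D. \<Delta> y \<partial>lborel) = (\<integral>\<^sup>+y. c1 * (\<Delta> y * indicator D y) \<partial>lborel)"
    by (rule nn_integral_cmult[symmetric]) measurable
  also have "\<dots> \<le> (\<integral>\<^sup>+y. (\<integral>\<^sup>+z. ?A y z \<partial>lborel) \<partial>lborel)"
  proof (rule nn_integral_mono)
    fix y
    have "(\<integral>\<^sup>+z. ?A y z \<partial>lborel)
      = (\<integral>\<^sup>+z. ?a y z * \<Delta> y \<partial>lborel)"
      by (intro nn_integral_cong) auto
    also have "\<dots> = (\<integral>\<^sup>+z. ?a y z \<partial>lborel) * \<Delta> y"
      by (rule nn_integral_multc) measurable
    finally have *: "(\<integral>\<^sup>+z. ?A y z \<partial>lborel) = \<dots>" .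
    show "c1 * (\<Delta> y * indicator D y) \<le> (\<integral>\<^sup>+z. ?A y z \<partial>lborel)"
    proof (cases "y \<in> D")
      case True
      from mult_right_mono[OF lower[OF this], of "\<Delta> y"] True show ?thesis unfolding * c1_def by simp
    qed simp
  qed
  also have "\<dots> = (\<integral>\<^sup>+z. (\<integral>\<^sup>+y. ?A y z \<partial>lborel) \<partial>lborel)"
    by (rule lborel_pair.Fubini') measurable
  also have "\<dots> \<le> (\<integral>\<^sup>+z. (\<integral>\<^sup>+w. 4 * ?B w z \<partial>lborel) \<partial>lborel)"
  proof (rule nn_integral_mono)
    fix z
    show "(\<integral>\<^sup>+y. ?A y z \<partial>lborel)
      \<le> (\<integral>\<^sup>+w. 4 * ?B w z \<partial>lborel)"
    proof (cases "z \<in> Z")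
      case True
      have "(\<integral>\<^sup>+y. ?A y z \<partial>lborel)
        = (\<integral>\<^sup>+y. ennreal (1 / \<tau> z ^ N) * ?d y z \<partial>lborel)"
        using True by (intro nn_integral_cong) auto
      also have "\<dots> = ennreal (1 / \<tau> z ^ N) * (\<integral>\<^sup>+y. ?d y z \<partial>lborel)"
        by (rule nn_integral_cmult) measurable
      also have "\<dots> \<le> ennreal (1 / \<tau> z ^ N) * (4 * energy (ball z (2 * (b * \<tau> z))) \<epsilon>)"
        by (rule mult_left_mono[OF J[OF True]]) simp
      also have "\<dots> = (4 * ennreal (1 / \<tau> z ^ N)) * energy (ball z (2 * (b * \<tau> z))) \<epsilon>" by (simp add: mult_ac)
      also have "\<dots> = (\<integral>\<^sup>+w. (4 * ennreal (1 / \<tau> z ^ N)) * (ennreal ((norm (\<epsilon> w))\<^sup>2) * indicator (ball z (2 * (b * \<tau> z))) w) \<partial>lborel)"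
        unfolding energy_def by (rule nn_integral_cmult[symmetric]) (intro borel_measurable_times_ennreal borel_measurable_indicator, measurable)
      also have "\<dots> = (\<integral>\<^sup>+w. 4 * ?B w z \<partial>lborel)"
        using True by (intro nn_integral_cong) (auto simp: indicator_def dist_commute mult.assoc)
      finally show ?thesis .
    qed simp
  qed
  also have "\<dots> = (\<integral>\<^sup>+w. (\<integral>\<^sup>+z. 4 * ?B w z \<partial>lborel) \<partial>lborel)"
    by (rule lborel_pair.Fubini') measurable
  also have "\<dots> \<le> (\<integral>\<^sup>+w. (4 * (ennreal ((6 * b) ^ N) * \<omega>)) * (ennreal ((norm (\<epsilon> w))\<^sup>2) * indicator \<Omega> w) \<partial>lborel)"
  proof (rule nn_integral_mono)
    fix w
    have "(\<integral>\<^sup>+z. 4 * ?B w z \<partial>lborel)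
      = (\<integral>\<^sup>+z. (4 * ennreal ((norm (\<epsilon> w))\<^sup>2)) * ?b w z \<partial>lborel)"
      by (intro nn_integral_cong) (auto simp: mult_ac)
    also have "\<dots> = (4 * ennreal ((norm (\<epsilon> w))\<^sup>2)) * (\<integral>\<^sup>+z. ?b w z \<partial>lborel)"
      by (rule nn_integral_cmult) measurable
    also have "\<dots> \<le> (4 * ennreal ((norm (\<epsilon> w))\<^sup>2)) * (ennreal ((6 * b) ^ N) * \<omega> * indicator \<Omega> w)"
      by (rule mult_left_mono[OF upper]) simp
    finally show "(\<integral>\<^sup>+z. 4 * ?B w z \<partial>lborel)
      \<le> (4 * (ennreal ((6 * b) ^ N) * \<omega>)) * (ennreal ((norm (\<epsilon> w))\<^sup>2) * indicator \<Omega> w)" by (simp add: mult_ac)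
  qed
  also have "\<dots> = (4 * (ennreal ((6 * b) ^ N) * \<omega>)) * energy \<Omega> \<epsilon>"
    unfolding energy_def by (rule nn_integral_cmult) measurable
  also have "\<dots> = c1 * (ennreal (4 * 96 ^ N) * energy \<Omega> \<epsilon>)"
  proof -
    have "6 * b = 96 * (b / 16)" by simp
    then have "(6 * b) ^ N = 96 ^ N * (b / 16) ^ N" by (simp only: power_mult_distrib[of 96])
    then have "ennreal ((6 * b) ^ N) = ennreal (96 ^ N) * ennreal ((b / 16) ^ N)" by (simp only: ennreal_mult' zero_le_power zero_le_numeral)
    moreover have "ennreal (4 * 96 ^ N) = 4 * ennreal (96 ^ N)" by (simp only: ennreal_mult' zero_le_numeral ennreal_numeral)
    ultimately show ?thesis by (simp only: c1_def mult_ac)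
  qed
  finally have "c1 * (\<integral>\<^sup>+y\<in>D. \<Delta> y \<partial>lborel) \<le> c1 * (ennreal (4 * 96 ^ N) * energy \<Omega> \<epsilon>)" .
  then have "(\<integral>\<^sup>+y\<in>D. \<Delta> y \<partial>lborel) \<le> ennreal (4 * 96 ^ N) * energy \<Omega> \<epsilon>"
    using c1 by (subst (asm) ennreal_mult_le_mult_iff) (auto simp: less_top)
  then show ?thesis by (simp only: mD N_def)
qed

lemma energy_weighted_add_le:
  fixes f g :: "'a::euclidean_space \<Rightarrow> 'b::euclidean_space"
  assumes [measurable]: "f \<in> borel_measurable borel" "g \<in> borel_measurable borel" "S \<in> sets borel" and \<eta>: "0 < \<eta>"
  shows "energy S (\<lambda>x. f x + g x) \<le> ennreal (1 + 1 / \<eta>) * energy S f + ennreal (1 + \<eta>) * energy S g"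
proof -
  have "energy S (\<lambda>x. f x + g x) \<le> (\<integral>\<^sup>+x. ennreal (1 + 1 / \<eta>) * (ennreal ((norm (f x))\<^sup>2) * indicator S x) + ennreal (1 + \<eta>) * (ennreal ((norm (g x))\<^sup>2) * indicator S x) \<partial>lborel)"
    unfolding energy_def
  proof (rule nn_integral_mono)
    fix x
    have "(norm (f x + g x))\<^sup>2 \<le> (norm (f x) + norm (g x))\<^sup>2" by (intro power_mono norm_triangle_ineq) auto
    also have "\<dots> \<le> (1 + 1 / \<eta>) * (norm (f x))\<^sup>2 + (1 + \<eta>) * (norm (g x))\<^sup>2"
    proof -
      have "0 \<le> (norm (f x) - \<eta> * norm (g x))\<^sup>2 / \<eta>" using \<eta> by simp
      also have "\<dots> = (norm (f x))\<^sup>2 / \<eta> + \<eta> * (norm (g x))\<^sup>2 - 2 * norm (f x) * norm (g x)"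
        using \<eta> by (simp add: power2_eq_square field_simps)
      finally show ?thesis by (simp add: power2_eq_square algebra_simps)
    qed
    finally have "ennreal ((norm (f x + g x))\<^sup>2) \<le> ennreal (1 + 1 / \<eta>) * ennreal ((norm (f x))\<^sup>2) + ennreal (1 + \<eta>) * ennreal ((norm (g x))\<^sup>2)"
      using \<eta> by (simp add: ennreal_plus[symmetric] ennreal_mult[symmetric] ennreal_leI del: ennreal_plus)
    then show "ennreal ((norm (f x + g x))\<^sup>2) * indicator S x \<le> ennreal (1 + 1 / \<eta>) * (ennreal ((norm (f x))\<^sup>2) * indicator S x) + ennreal (1 + \<eta>) * (ennreal ((norm (g x))\<^sup>2) * indicator S x)"
      by (auto simp: indicator_def)
  qed
  also have "\<dots> = ennreal (1 + 1 / \<eta>) * energy S f + ennreal (1 + \<eta>) * energy S g"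
    unfolding energy_def by (subst nn_integral_add) (auto simp: nn_integral_cmult)
  finally show ?thesis .
qed

lemma energy_bounded_finite:
  fixes f :: "'a::euclidean_space \<Rightarrow> 'b::euclidean_space"
  assumes f: "continuous_on UNIV f" and S: "bounded S"
  shows "energy S f < top"
proof -
  obtain R where R: "S \<subseteq> cball 0 R" using S by (auto simp: bounded_iff subset_iff)
  have "bounded (f ` cball 0 R)"
    using f by (intro compact_imp_bounded compact_continuous_image) (auto intro: continuous_on_subset)
  then obtain K where K: "0 < K" "\<And>x. x \<in> cball 0 R \<Longrightarrow> norm (f x) \<le> K" by (fastforce simp: bounded_pos)
  have "energy S f \<le> energy (cball 0 R) f" by (rule energy_mono_set[OF R])
  also have "\<dots> \<le> ennreal (1\<^sup>2) * energy (cball 0 R) (\<lambda>x::'a. K)"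
    by (rule energy_le_cmult) (use K in auto)
  also have "\<dots> < top"
    by (simp add: energy_const ennreal_mult_less_top emeasure_lborel_cball_less_top)
  finally show ?thesis .
qed

text \<open>
  With \<open>D\<close> the layer of thickness \<open>h\<close> under the graph, \<open>T\<close> the dilation and \<open>K\<close> the
  compact remainder of the thickened layer, the two preceding lemmas give
  \<open>\<parallel>f\<parallel>\<^sup>2\<^sub>D \<le> C \<parallel>\<epsilon>\<parallel>\<^sup>2 + \<theta>' (\<parallel>f\<parallel>\<^sup>2\<^sub>D + \<parallel>f\<parallel>\<^sup>2\<^sub>K)\<close> with \<open>\<theta>' < 1\<close>, and the energy on \<open>D\<close> can be absorbed since it is
  finite.
\<close>

lemma boundary_estimate:
  fixes \<Omega> :: "(real^'n::finite) set"
  assumes \<Omega>: "open \<Omega>" and x0: "x0 \<in> frontier \<Omega>" and lip: "strong_lipschitz_boundary \<Omega>"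
  shows "\<exists>V K C. open V \<and> x0 \<in> V \<and> compact K \<and> K \<subseteq> \<Omega> \<and> C < top \<and>
    (\<forall>(f :: real^'n \<Rightarrow> 'b::euclidean_space) (\<epsilon> :: real^'n \<Rightarrow> 'c::euclidean_space).
      oscillation_bound \<Omega> f \<epsilon> \<longrightarrow> energy (\<Omega> \<inter> V) f \<le> C * (energy \<Omega> \<epsilon> + energy K f))"
proof -
  obtain U e g where U: "x0 \<in> U" "lipschitz_chart \<Omega> U e g"
    using lip x0 unfolding strong_lipschitz_boundary_def by blast
  then obtain L0 where "open U" and e: "norm e = 1" and inv: "\<And>y t. g (y + t *\<^sub>R e) = g y"
    and g: "L0-lipschitz_on UNIV g" and fr: "frontier \<Omega> \<inter> U = {y \<in> U. y \<bullet> e = g y}"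
    and in_\<Omega>: "\<Omega> \<inter> U = {y \<in> U. y \<bullet> e < g y}"
    unfolding lipschitz_chart_def by blast
  have L0: "0 \<le> L0" using g by (rule lipschitz_on_nonneg)
  define L where "L = L0 + 1"
  have L: "1 \<le> L" using L0 by (simp add: L_def)
  define \<tau> where "\<tau> y = g y - y \<bullet> e" for y
  have cg: "continuous_on UNIV g" by (rule lipschitz_on_continuous_on[OF g])
  have [measurable]: "g \<in> borel_measurable borel" by (rule borel_measurable_continuous_onI[OF cg])
  have c\<tau>: "continuous_on UNIV \<tau>" unfolding \<tau>_def by (intro continuous_intros cg)
  have glip: "\<bar>g y - g z\<bar> \<le> L0 * dist y z" for y z using lipschitz_onD[OF g, of y z] by (simp add: dist_real_def)
  have \<tau>lip: "\<bar>\<tau> y - \<tau> z\<bar> \<le> L * dist y z" for y z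
  proof -
    have "\<bar>(y - z) \<bullet> e\<bar> \<le> dist y z" using Cauchy_Schwarz_ineq2[of "y - z" e] e by (simp add: dist_norm)
    then show ?thesis using glip[of y z] by (simp add: \<tau>_def L_def inner_diff_left distrib_right)
  qed
  have "x0 \<in> frontier \<Omega> \<inter> U" using x0 U(1) by blast
  then have \<tau>0: "\<tau> x0 = 0" unfolding fr by (simp add: \<tau>_def)
  have \<Omega>_iff: "y \<in> U \<Longrightarrow> y \<in> \<Omega> \<longleftrightarrow> 0 < \<tau> y" for y using in_\<Omega> by (auto simp: \<tau>_def)
  obtain R where R: "0 < R" "ball x0 R \<subseteq> U" using \<open>open U\<close> U(1) openE by blast
  \<comment> \<open>The distance from the vertical line through \<open>x0\<close>: the dilation leaves cylinders \<open>q < \<delta>\<close> invariant.\<close>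
  define q where "q y = norm ((y - x0) - ((y - x0) \<bullet> e) *\<^sub>R e)" for y
  have ee: "e \<bullet> e = 1" using e by (simp add: power2_norm_eq_inner[symmetric])
  have q_inv: "q (y + t *\<^sub>R e) = q y" for y t
    by (simp add: q_def inner_add_left inner_diff_left ee algebra_simps)
  have cq: "continuous_on UNIV q" unfolding q_def by (intro continuous_intros)
  have q0: "q x0 = 0" by (simp add: q_def)
  have dist_le: "dist y x0 \<le> (1 + L) * q y + \<bar>\<tau> y\<bar>" for y
  proof -
    define t where "t = (y - x0) \<bullet> e"
    have "g y = g (y + (- t) *\<^sub>R e)" by (simp only: inv)
    then have "\<bar>g y - g x0\<bar> \<le> L0 * dist (y + (- t) *\<^sub>R e) x0" using glip by simp
    also have "dist (y + (- t) *\<^sub>R e) x0 = q y" by (simp add: q_def dist_norm t_def algebra_simps)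
    finally have 1: "\<bar>g y - g x0\<bar> \<le> L0 * q y" .
    have "t = (g y - g x0) - \<tau> y" using \<tau>0 by (simp add: t_def \<tau>_def inner_diff_left)
    then have t: "\<bar>t\<bar> \<le> L0 * q y + \<bar>\<tau> y\<bar>" using 1 by linarith
    have "y - x0 = ((y - x0) - t *\<^sub>R e) + t *\<^sub>R e" by simp
    then have "dist y x0 \<le> q y + \<bar>t\<bar>"
      using norm_triangle_ineq[of "(y - x0) - t *\<^sub>R e" "t *\<^sub>R e"] e by (simp add: dist_norm q_def t_def)
    moreover have "0 \<le> q y" by (simp add: q_def)
    ultimately show ?thesis using t by (simp add: L_def distrib_right)
  qed
  define b where "b = 1 / (8 * L)"
  have b: "0 < b" "b \<le> 1/8" "L * b = 1/8" using L by (auto simp: b_def field_simps)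
  define h where "h = R / 16"
  define \<delta> where "\<delta> = R / (16 * (1 + L))"
  have h: "0 < h" using R by (simp add: h_def)
  have \<delta>: "0 < \<delta>" "(1 + L) * \<delta> = R / 16" using R L by (auto simp: \<delta>_def field_simps)
  have close: "dist y x0 \<le> R / 16 + \<bar>\<tau> y\<bar>" if "q y \<le> \<delta>" for y
    using dist_le[of y] mult_left_mono[OF that, of "1 + L"] L \<delta> by simp
  define Z where "Z = {z \<in> ball x0 (R / 2). 0 < \<tau> z \<and> \<tau> z < 2 * h}"
  define D where "D = {y. q y < \<delta> \<and> 0 < \<tau> y \<and> \<tau> y < h}"
  define V where "V = {y. q y < \<delta> \<and> \<bar>\<tau> y\<bar> < h}"
  define \<kappa> where "\<kappa> = b / 4"
  have \<kappa>: "0 < \<kappa>" "\<kappa> \<le> 1" using b by (auto simp: \<kappa>_def)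
  define K where "K = {y. q y \<le> \<delta> \<and> h \<le> \<tau> y \<and> \<tau> y \<le> (1 + \<kappa>) * h}"
  have "open Z"
  proof -
    have "Z = ball x0 (R / 2) \<inter> {z. 0 < \<tau> z} \<inter> {z. \<tau> z < 2 * h}" by (auto simp: Z_def)
    then show ?thesis by (auto intro!: open_Int open_Collect_less c\<tau> continuous_intros)
  qed
  have "open D"
  proof -
    have "D = {z. q z < \<delta>} \<inter> {z. 0 < \<tau> z} \<inter> {z. \<tau> z < h}" by (auto simp: D_def)
    then show ?thesis by (auto intro!: open_Int open_Collect_less c\<tau> cq continuous_intros)
  qed
  have "open V"
  proof -
    have "V = {z. q z < \<delta>} \<inter> {z. \<bar>\<tau> z\<bar> < h}" by (auto simp: V_def)
    then show ?thesis by (auto intro!: open_Int open_Collect_less c\<tau> cq continuous_intros)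
  qed
  have "x0 \<in> V" using h \<delta> by (simp add: V_def q0 \<tau>0)
  have "\<Omega> \<inter> V \<subseteq> D"
  proof
    fix y assume y: "y \<in> \<Omega> \<inter> V"
    then have "dist y x0 < R" using close[of y] R by (auto simp: V_def h_def)
    then have "y \<in> U" using R by (auto simp: dist_commute)
    then show "y \<in> D" using y \<Omega>_iff[of y] by (auto simp: V_def D_def)
  qed
  have "K \<subseteq> \<Omega>" and "compact K"
  proof -
    have lh: "(1 + \<kappa>) * h \<le> 2 * h" using \<kappa> h by (intro mult_right_mono) auto
    have dK: "dist y x0 < R" if "y \<in> K" for y
    proof -
      have y: "q y \<le> \<delta>" "h \<le> \<tau> y" "\<tau> y \<le> (1 + \<kappa>) * h" using that by (auto simp: K_def)
      then have "\<bar>\<tau> y\<bar> \<le> 2 * h" using lh h by linarith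
      then show ?thesis using close[OF y(1)] R unfolding h_def by linarith
    qed
    show "K \<subseteq> \<Omega>"
    proof
      fix y assume y: "y \<in> K"
      then have "y \<in> U" using dK[OF y] R by (auto simp: dist_commute)
      then show "y \<in> \<Omega>" using y \<Omega>_iff[of y] h by (auto simp: K_def)
    qed
    have "K = {z. q z \<le> \<delta>} \<inter> {z. h \<le> \<tau> z} \<inter> {z. \<tau> z \<le> (1 + \<kappa>) * h}" by (auto simp: K_def)
    then have "closed K" by (auto intro!: closed_Int closed_Collect_le c\<tau> cq continuous_intros)
    moreover have "bounded K" using dK unfolding bounded_def by (metis dist_commute less_imp_le)
    ultimately show "compact K" by (simp add: compact_eq_bounded_closed)
  qed
  have D_bounded: "bounded D"
  proof -
    have "dist x0 y \<le> R" if "y \<in> D" for y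
      using that close[of y] R by (auto simp: D_def h_def dist_commute)
    then show ?thesis unfolding bounded_def by blast
  qed
  have Z1: "0 < \<tau> z" "ball z (2 * (b * \<tau> z)) \<subseteq> \<Omega>" if z: "z \<in> Z" for z
  proof -
    show \<tau>z: "0 < \<tau> z" using z by (simp add: Z_def)
    show "ball z (2 * (b * \<tau> z)) \<subseteq> \<Omega>"
    proof
      fix y assume "y \<in> ball z (2 * (b * \<tau> z))"
      then have y: "dist y z < 2 * (b * \<tau> z)" by (simp add: dist_commute)
      have "b * \<tau> z \<le> 1/8 * \<tau> z" using b \<tau>z by (intro mult_right_mono) auto
      moreover have "\<tau> z < 2 * h" using z by (simp add: Z_def)
      ultimately have "dist y z < R / 2" using y R unfolding h_def by linarith
      moreover have "dist z x0 < R / 2" using z by (simp add: Z_def dist_commute)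
      ultimately have "dist y x0 < R" using dist_triangle[of y x0 z] by linarith
      then have "y \<in> U" using R by (auto simp: dist_commute)
      have "L * dist y z < L * (2 * (b * \<tau> z))" using y L by (intro mult_strict_left_mono) auto
      also have "\<dots> = 2 * (L * b) * \<tau> z" by simp
      also have "\<dots> = \<tau> z / 4" using b(3) by simp
      finally have "0 < \<tau> y" using \<tau>lip[of y z] \<tau>z by linarith
      then show "y \<in> \<Omega>" using \<Omega>_iff[OF \<open>y \<in> U\<close>] by simp
    qed
  qed
  have D1: "0 < \<tau> y" "ball y (b * \<tau> y / 8) \<subseteq> Z" if y: "y \<in> D" for y
  proof -
    show \<tau>y: "0 < \<tau> y" using y by (simp add: D_def)
    show "ball y (b * \<tau> y / 8) \<subseteq> Z"
    proof
      fix z assume "z \<in> ball y (b * \<tau> y / 8)"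
      then have z: "dist z y < b * \<tau> y / 8" by (simp add: dist_commute)
      have "b * \<tau> y \<le> 1/8 * \<tau> y" using b \<tau>y by (intro mult_right_mono) auto
      moreover have "\<tau> y < h" using y by (simp add: D_def)
      ultimately have "dist z y < R / 4" using z R unfolding h_def by linarith
      moreover have "dist y x0 \<le> R / 16 + R / 16" using close[of y] y by (auto simp: D_def h_def)
      ultimately have "dist z x0 < R / 2" using dist_triangle[of z x0 y] R by linarith
      moreover have "L * dist z y \<le> L * (b * \<tau> y / 8)" using z L by (intro mult_left_mono) auto
      then have "L * dist z y \<le> (L * b) * \<tau> y / 8" by simp
      then have "L * dist z y \<le> \<tau> y / 64" using b(3) by simp
      then have "0 < \<tau> z" "\<tau> z < 2 * h" using \<tau>lip[of z y] \<tau>y y h by (auto simp: D_def abs_le_iff)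
      ultimately show "z \<in> Z" by (simp add: Z_def dist_commute)
    qed
  qed
  have [measurable]: "D \<in> sets borel" "Z \<in> sets borel" "\<Omega> \<in> sets borel" "K \<in> sets borel"
    using \<open>open D\<close> \<open>open Z\<close> \<Omega> \<open>compact K\<close> by (auto intro: borel_compact)
  have [measurable]: "\<tau> \<in> borel_measurable borel" "q \<in> borel_measurable borel"
    by (intro borel_measurable_continuous_onI c\<tau> cq)+
  define \<theta> where "\<theta> = (1 + \<kappa> / 2) / (1 + \<kappa>)"
  have \<theta>: "0 < \<theta>" "\<theta> < 1" using \<kappa> by (auto simp: \<theta>_def)
  \<comment> \<open>The weight \<open>\<eta>\<close> in \<open>energy_weighted_add_le\<close> is chosen such that \<open>(1 + \<eta>) \<theta>\<close> is halfway between \<open>\<theta>\<close> and one.\<close>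
  define \<eta> where "\<eta> = (1 - \<theta>) / (2 * \<theta>)"
  have \<eta>: "0 < \<eta>" using \<theta> by (simp add: \<eta>_def)
  define \<theta>' where "\<theta>' = (1 + \<theta>) / 2"
  have \<theta>': "0 \<le> \<theta>'" "\<theta>' < 1" "(1 + \<eta>) * \<theta> = \<theta>'" using \<theta> by (auto simp: \<theta>'_def \<eta>_def field_simps)
  define M where "M = ennreal (1 / (1 - \<theta>')) * (ennreal (1 + 1 / \<eta>) * ennreal (4 * 96 ^ CARD('n)) + ennreal \<theta>')"
  show ?thesis
  proof (intro exI conjI allI impI)
    show "open V" "x0 \<in> V" "compact K" "K \<subseteq> \<Omega>" by fact+
    show "M < top" by (simp add: M_def ennreal_mult_less_top)
    fix f :: "real^'n \<Rightarrow> 'b" and \<epsilon> :: "real^'n \<Rightarrow> 'c" assume o: "oscillation_bound \<Omega> f \<epsilon>"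
    have cf: "continuous_on UNIV f" using o by (simp add: oscillation_bound_def)
    have [measurable]: "f \<in> borel_measurable borel" using oscillation_bound_measurable[OF o] by simp
    define T where "T y = y - (\<kappa> * \<tau> y) *\<^sub>R e" for y
    have [measurable]: "T \<in> borel_measurable borel" unfolding T_def by measurable
    have 1: "energy D (\<lambda>y. f y - f (T y)) \<le> ennreal (4 * 96 ^ CARD('n)) * energy \<Omega> \<epsilon>"
      unfolding T_def \<kappa>_def \<tau>_def b_def
      by (rule vertical_increment_energy[OF e inv L _ o, where Z = Z and D = D])
         (use \<tau>lip Z1 D1 in \<open>auto simp: \<tau>_def b_def\<close>)
    define F where "F y = (if q y < \<delta> then ennreal ((norm (f y))\<^sup>2) else 0)" for y
    have [measurable]: "F \<in> borel_measurable borel" unfolding F_def by measurable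
    have qT: "q (T y) = q y" for y using q_inv[of y "- (\<kappa> * \<tau> y)"] by (simp add: T_def)
    have "energy D (\<lambda>y. f (T y)) = (\<integral>\<^sup>+y. (if 0 < \<tau> y \<and> \<tau> y < h then F (y - (\<kappa> * \<tau> y) *\<^sub>R e) else 0) \<partial>lborel)"
      unfolding energy_def by (intro nn_integral_cong) (auto simp: F_def D_def indicator_def qT T_def[symmetric])
    also have "\<dots> \<le> ennreal \<theta> * (\<integral>\<^sup>+y. (if 0 < \<tau> y \<and> \<tau> y < (1 + \<kappa>) * h then F y else 0) \<partial>lborel)"
      unfolding \<tau>_def \<theta>_def by (rule nn_integral_vertical_dilation[OF _ _ e inv]) (use \<kappa> h in auto)
    also have "\<dots> \<le> ennreal \<theta> * (energy D f + energy K f)"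
    proof (rule mult_left_mono)
      have "(\<integral>\<^sup>+y. (if 0 < \<tau> y \<and> \<tau> y < (1 + \<kappa>) * h then F y else 0) \<partial>lborel)
        \<le> (\<integral>\<^sup>+y. ennreal ((norm (f y))\<^sup>2) * indicator D y + ennreal ((norm (f y))\<^sup>2) * indicator K y \<partial>lborel)"
        by (rule nn_integral_mono) (auto simp: F_def D_def K_def indicator_def)
      also have "\<dots> = energy D f + energy K f" unfolding energy_def by (rule nn_integral_add) measurable
      finally show "(\<integral>\<^sup>+y. (if 0 < \<tau> y \<and> \<tau> y < (1 + \<kappa>) * h then F y else 0) \<partial>lborel) \<le> energy D f + energy K f" .
    qed simp
    finally have 2: "energy D (\<lambda>y. f (T y)) \<le> ennreal \<theta> * (energy D f + energy K f)" .
    have "energy D f = energy D (\<lambda>y. (f y - f (T y)) + f (T y))" by simp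
    also have "\<dots> \<le> ennreal (1 + 1 / \<eta>) * energy D (\<lambda>y. f y - f (T y)) + ennreal (1 + \<eta>) * energy D (\<lambda>y. f (T y))"
      by (rule energy_weighted_add_le[OF _ _ _ \<eta>]) measurable
    also have "\<dots> \<le> ennreal (1 + 1 / \<eta>) * (ennreal (4 * 96 ^ CARD('n)) * energy \<Omega> \<epsilon>) + ennreal (1 + \<eta>) * (ennreal \<theta> * (energy D f + energy K f))"
      by (intro add_mono mult_left_mono 1 2) auto
    also have "ennreal (1 + \<eta>) * (ennreal \<theta> * (energy D f + energy K f)) = ennreal \<theta>' * (energy D f + energy K f)"
    proof -
      have "ennreal \<theta>' = ennreal (1 + \<eta>) * ennreal \<theta>"
        unfolding \<theta>'(3)[symmetric] using \<eta> \<theta> by (intro ennreal_mult) auto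
      then show ?thesis by (simp only: mult.assoc)
    qed
    finally have "energy D f \<le> (ennreal (1 + 1 / \<eta>) * (ennreal (4 * 96 ^ CARD('n)) * energy \<Omega> \<epsilon>) + ennreal \<theta>' * energy K f) + ennreal \<theta>' * energy D f"
      by (simp add: distrib_left add_ac)
    then have "energy D f \<le> ennreal (1 / (1 - \<theta>')) * (ennreal (1 + 1 / \<eta>) * (ennreal (4 * 96 ^ CARD('n)) * energy \<Omega> \<epsilon>) + ennreal \<theta>' * energy K f)"
      by (rule ennreal_absorb[OF energy_bounded_finite[OF cf D_bounded] \<theta>'(1,2)])
    also have "\<dots> \<le> ennreal (1 / (1 - \<theta>')) * (ennreal (1 + 1 / \<eta>) * (ennreal (4 * 96 ^ CARD('n)) * (energy \<Omega> \<epsilon> + energy K f)) + ennreal \<theta>' * (energy \<Omega> \<epsilon> + energy K f))"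
      by (intro add_mono mult_left_mono) auto
    also have "\<dots> = M * (energy \<Omega> \<epsilon> + energy K f)"
      unfolding M_def by (simp only: mult.assoc distrib_right)
    finally show "energy (\<Omega> \<inter> V) f \<le> M * (energy \<Omega> \<epsilon> + energy K f)"
      using energy_mono_set[OF \<open>\<Omega> \<inter> V \<subseteq> D\<close>, of f] by (rule order_trans[rotated])
  qed
qed

text \<open>
  The boundary is covered by finitely many of the neighbourhoods of \<open>boundary_estimate\<close>; what remains
  of \<open>\<Omega>\<close> is compact, and one fixed ball controls the energy there by chaining.
\<close>

theorem local_to_global:
  fixes \<Omega> :: "(real^'n::finite) set"
  assumes \<Omega>: "open \<Omega>" "connected \<Omega>" "\<Omega> \<noteq> {}" "bounded \<Omega>" and lip: "strong_lipschitz_boundary \<Omega>"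
  shows "\<exists>C<top. \<forall>(f :: real^'n \<Rightarrow> 'b::euclidean_space) (\<epsilon> :: real^'n \<Rightarrow> 'c::euclidean_space).
    oscillation_bound \<Omega> f \<epsilon> \<longrightarrow> (\<exists>c. energy \<Omega> (\<lambda>x. f x - c) \<le> C * energy \<Omega> \<epsilon>)"
proof -
  define good where "good S \<longleftrightarrow> (\<exists>K C. compact K \<and> K \<subseteq> \<Omega> \<and> C < top \<and>
    (\<forall>(f :: real^'n \<Rightarrow> 'b) (\<epsilon> :: real^'n \<Rightarrow> 'c).
      oscillation_bound \<Omega> f \<epsilon> \<longrightarrow> energy S f \<le> C * (energy \<Omega> \<epsilon> + energy K f)))" for S
  have "\<forall>x\<in>frontier \<Omega>. \<exists>V. open V \<and> x \<in> V \<and> good (\<Omega> \<inter> V)"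
  proof
    fix x assume "x \<in> frontier \<Omega>"
    from boundary_estimate[OF \<Omega>(1) this lip, where 'b = 'b and 'c = 'c]
    show "\<exists>V. open V \<and> x \<in> V \<and> good (\<Omega> \<inter> V)" unfolding good_def by blast
  qed
  then obtain V where V: "\<And>x. x \<in> frontier \<Omega> \<Longrightarrow> open (V x)" "\<And>x. x \<in> frontier \<Omega> \<Longrightarrow> x \<in> V x"
    "\<And>x. x \<in> frontier \<Omega> \<Longrightarrow> good (\<Omega> \<inter> V x)" by metis
  have "compact (frontier \<Omega>)" using \<Omega>(4) by (rule compact_frontier_bounded)
  then obtain D where D: "D \<subseteq> frontier \<Omega>" "finite D" "frontier \<Omega> \<subseteq> (\<Union>x\<in>D. V x)"
  proof (rule compactE_image)
    show "open (V x)" if "x \<in> frontier \<Omega>" for x by (rule V(1)[OF that])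
    show "frontier \<Omega> \<subseteq> (\<Union>x\<in>frontier \<Omega>. V x)" using V(2) by blast
  qed
  define K0 where "K0 = closure \<Omega> - (\<Union>x\<in>D. V x)"
  have "closed K0" unfolding K0_def using D V by (intro closed_Diff) auto
  moreover have "bounded K0" using \<Omega>(4) by (auto simp: K0_def intro: bounded_subset)
  ultimately have K0: "compact K0" by (simp add: compact_eq_bounded_closed)
  have K0\<Omega>: "K0 \<subseteq> \<Omega>"
    using D(3) \<Omega>(1) by (auto simp: K0_def frontier_def interior_open)
  from V(3) D(1) have "\<forall>x\<in>D. \<exists>K C. compact K \<and> K \<subseteq> \<Omega> \<and> C < top \<and>
    (\<forall>(f :: real^'n \<Rightarrow> 'b) (\<epsilon> :: real^'n \<Rightarrow> 'c).
      oscillation_bound \<Omega> f \<epsilon> \<longrightarrow> energy (\<Omega> \<inter> V x) f \<le> C * (energy \<Omega> \<epsilon> + energy K f))"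
    unfolding good_def by blast
  then obtain K C where K: "\<And>x. x \<in> D \<Longrightarrow> compact (K x)" "\<And>x. x \<in> D \<Longrightarrow> K x \<subseteq> \<Omega>" "\<And>x. x \<in> D \<Longrightarrow> C x < top"
    and KC: "\<And>x (f :: real^'n \<Rightarrow> 'b) (\<epsilon> :: real^'n \<Rightarrow> 'c). x \<in> D \<Longrightarrow> oscillation_bound \<Omega> f \<epsilon> \<Longrightarrow> energy (\<Omega> \<inter> V x) f \<le> C x * (energy \<Omega> \<epsilon> + energy (K x) f)"
    by metis
  define KK where "KK = K0 \<union> (\<Union>x\<in>D. K x)"
  have KK: "compact KK" "KK \<subseteq> \<Omega>"
    unfolding KK_def using K0 K0\<Omega> K(1,2) D(2) by (auto intro!: compact_Un compact_UN)
  obtain x0 where "x0 \<in> \<Omega>" using \<Omega>(3) by blast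
  then obtain s where s: "0 < s" "ball x0 s \<subseteq> \<Omega>" using \<Omega>(1) openE by blast
  define r where "r = s / 2"
  have r: "0 < r" "ball x0 (2 * r) \<subseteq> \<Omega>" using s by (auto simp: r_def)
  have r': "ball x0 r \<subseteq> \<Omega>" using r subset_ball[of r "2 * r" x0] by auto
  from compact_propagation[OF \<Omega>(1,2) r(1) r' KK, where 'b = 'b and 'c = 'c]
  obtain B where B: "B < top" and BB: "\<And>(f :: real^'n \<Rightarrow> 'b) (\<epsilon> :: real^'n \<Rightarrow> 'c). oscillation_bound \<Omega> f \<epsilon> \<Longrightarrow>
    energy KK f \<le> B * (energy \<Omega> \<epsilon> + energy (ball x0 r) f)" by blast
  define M where "M = B * 2 + (\<Sum>x\<in>D. C x * (1 + B * 2))"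
  show ?thesis
  proof (intro exI[of _ M] conjI allI impI)
    show "M < top" using B K(3) D(2) by (auto simp: M_def ennreal_mult_less_top less_top[symmetric] ennreal_mult_eq_top_iff)
    fix f0 :: "real^'n \<Rightarrow> 'b" and \<epsilon> :: "real^'n \<Rightarrow> 'c" assume o0: "oscillation_bound \<Omega> f0 \<epsilon>"
    then obtain c where c: "energy (ball x0 r) (\<lambda>x. f0 x - c) \<le> energy (ball x0 (2 * r)) \<epsilon>"
      using r unfolding oscillation_bound_def by blast
    define f where "f x = f0 x - c" for x
    have o: "oscillation_bound \<Omega> f \<epsilon>" unfolding f_def by (rule oscillation_bound_diff_const[OF o0])
    note [measurable] = oscillation_bound_measurable[OF o]
    have "energy (ball x0 r) f \<le> energy \<Omega> \<epsilon>"
      using order_trans[OF c energy_mono_set[OF r(2)]] by (simp add: f_def[abs_def])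
    then have "energy KK f \<le> B * (energy \<Omega> \<epsilon> + energy \<Omega> \<epsilon>)"
      by (intro order_trans[OF BB[OF o]] mult_left_mono add_left_mono) auto
    then have eKK: "energy KK f \<le> B * 2 * energy \<Omega> \<epsilon>" by (simp add: mult.assoc mult_2)
    have sub: "\<Omega> \<subseteq> KK \<union> (\<Union>x\<in>D. \<Omega> \<inter> V x)"
      using closure_subset[of \<Omega>] by (auto simp: KK_def K0_def)
    have "energy \<Omega> f \<le> energy (KK \<union> (\<Union>x\<in>D. \<Omega> \<inter> V x)) f" by (rule energy_mono_set[OF sub])
    also have "\<dots> \<le> energy KK f + (\<Sum>x\<in>D. energy (\<Omega> \<inter> V x) f)"
    proof -
      define S where "S i = (case i of None \<Rightarrow> KK | Some x \<Rightarrow> \<Omega> \<inter> V x)" for i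
      have "energy (KK \<union> (\<Union>x\<in>D. \<Omega> \<inter> V x)) f \<le> (\<Sum>i\<in>insert None (Some ` D). energy (S i) f)"
        by (rule energy_Union_le) (use D V KK \<Omega>(1) in \<open>auto simp: S_def intro: borel_compact\<close>)
      also have "\<dots> = energy KK f + (\<Sum>x\<in>D. energy (\<Omega> \<inter> V x) f)"
        using D(2) by (simp add: S_def sum.reindex)
      finally show ?thesis .
    qed
    also have "\<dots> \<le> B * 2 * energy \<Omega> \<epsilon> + (\<Sum>x\<in>D. C x * (1 * energy \<Omega> \<epsilon> + B * 2 * energy \<Omega> \<epsilon>))"
    proof (intro add_mono eKK sum_mono)
      fix x assume x: "x \<in> D"
      then have "energy (K x) f \<le> energy KK f" by (intro energy_mono_set) (auto simp: KK_def)
      then show "energy (\<Omega> \<inter> V x) f \<le> C x * (1 * energy \<Omega> \<epsilon> + B * 2 * energy \<Omega> \<epsilon>)"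
        by (intro order_trans[OF KC[OF x o]] mult_left_mono add_mono) (auto intro: order_trans[OF _ eKK])
    qed
    also have "\<dots> = M * energy \<Omega> \<epsilon>"
      unfolding M_def by (simp only: distrib_right[symmetric] mult.assoc[symmetric] sum_distrib_right[symmetric])
    finally show "\<exists>c. energy \<Omega> (\<lambda>x. f0 x - c) \<le> M * energy \<Omega> \<epsilon>" unfolding f_def by blast
  qed
qed

section \<open>Korn's second inequality modulo rigid motions\<close>

lemma energy_scaleR:
  fixes f :: "'a::euclidean_space \<Rightarrow> 'b::euclidean_space"
  assumes [measurable]: "f \<in> borel_measurable borel" "S \<in> sets borel"
  shows "energy S (\<lambda>x. k *\<^sub>R f x) = ennreal (k\<^sup>2) * energy S f"
proof -
  have "energy S (\<lambda>x. k *\<^sub>R f x) = (\<integral>\<^sup>+x. ennreal (k\<^sup>2) * (ennreal ((norm (f x))\<^sup>2) * indicator S x) \<partial>lborel)"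
    unfolding energy_def by (intro nn_integral_cong) (simp add: power_mult_distrib ennreal_mult mult.assoc)
  also have "\<dots> = ennreal (k\<^sup>2) * energy S f" unfolding energy_def by (rule nn_integral_cmult) measurable
  finally show ?thesis .
qed

lemma has_gradient_diff:
  assumes "has_gradient v G" "has_gradient w H"
  shows "has_gradient (\<lambda>x. v x - w x) (\<lambda>x. G x - H x)"
  using assms unfolding has_gradient_def
  by (auto intro!: continuous_intros has_derivative_eq_rhs[OF has_derivative_diff] simp: vector_matrix_mult_diff_rdistrib)

lemma has_gradient_affine: "has_gradient (\<lambda>x. b + x v* A) (\<lambda>x. A)"
  unfolding has_gradient_def
proof (intro conjI allI)
  fix x
  have "bounded_linear (\<lambda>x. x v* A)"
  proof -
    have "(\<lambda>x. x v* A) = (*v) (transpose A)" by auto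
    then show ?thesis by (simp only: matrix_vector_mul_bounded_linear)
  qed
  from has_derivative_add[OF has_derivative_const bounded_linear_imp_has_derivative[OF this]]
  show "((\<lambda>x. b + x v* A) has_derivative (\<lambda>h. h v* A)) (at x)" by simp
qed simp

text \<open>
  The constant matrix \<open>c\<close> that \<open>local_to_global\<close> provides for \<open>\<nabla>v\<close> need not be skew, but its symmetric part
  is \<open>sym G - sym (G - c)\<close> and hence small.
\<close>

theorem korn_modulo_rigid:
  fixes \<Omega> :: "(real^'n::finite) set"
  assumes \<Omega>: "open \<Omega>" "connected \<Omega>" "\<Omega> \<noteq> {}" "bounded \<Omega>" and lip: "strong_lipschitz_boundary \<Omega>"
  shows "\<exists>C<top. \<forall>v G. has_gradient v G \<longrightarrow> (\<exists>b S. sym_part S = 0 \<and>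
    energy \<Omega> (\<lambda>x. v x - (b + x v* S)) + energy \<Omega> (\<lambda>x. G x - S) \<le> C * energy \<Omega> (\<lambda>x. sym_part (G x)))"
proof -
  obtain K where K: "0 \<le> K" "\<And>(v :: real^'n \<Rightarrow> real^'n) G a r. has_gradient v G \<Longrightarrow> 0 < r \<Longrightarrow>
    \<exists>c. energy (ball a r) (\<lambda>x. G x - c) \<le> ennreal K * energy (ball a (2 * r)) (\<lambda>x. sym_part (G x))"
    by (rule korn_ball) blast
  obtain C1 where C1: "C1 < top" "\<And>(f :: real^'n \<Rightarrow> real^'n^'n) (\<epsilon> :: real^'n \<Rightarrow> real^'n^'n).
    oscillation_bound \<Omega> f \<epsilon> \<Longrightarrow> \<exists>c. energy \<Omega> (\<lambda>x. f x - c) \<le> C1 * energy \<Omega> \<epsilon>"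
    using local_to_global[OF \<Omega> lip, where 'b = "real^'n^'n" and 'c = "real^'n^'n"] by blast
  obtain C2 where C2: "C2 < top" "\<And>(f :: real^'n \<Rightarrow> real^'n) (\<epsilon> :: real^'n \<Rightarrow> real^'n^'n).
    oscillation_bound \<Omega> f \<epsilon> \<Longrightarrow> \<exists>c. energy \<Omega> (\<lambda>x. f x - c) \<le> C2 * energy \<Omega> \<epsilon>"
    using local_to_global[OF \<Omega> lip, where 'b = "real^'n" and 'c = "real^'n^'n"] by blast
  obtain R where R: "0 < R" "\<Omega> \<subseteq> cball 0 R"
    using \<Omega>(4) by (auto simp: bounded_pos subset_iff)
  have [measurable]: "\<Omega> \<in> sets borel" using \<Omega>(1) by simp
  define D1 where "D1 = 8 * (C1 * ennreal K) + 2"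
  define P where "P = sqrt (2 ^ CARD('n)) * R"
  define D2 where "D2 = C2 * ennreal (P\<^sup>2) * D1"
  show ?thesis
  proof (intro exI[of _ "D2 + D1"] conjI allI impI)
    show "D2 + D1 < top" using C1(1) C2(1) by (simp add: D1_def D2_def ennreal_mult_less_top)
    fix v G assume v: "has_gradient (v :: real^'n \<Rightarrow> real^'n) G"
    have cG: "continuous_on UNIV G" using v by (simp add: has_gradient_def)
    have [measurable]: "G \<in> borel_measurable borel" by (rule borel_measurable_continuous_onI[OF cG])
    have cs: "continuous_on UNIV (\<lambda>x. sym_part (G x))" by (rule continuous_on_sym_part_gradient[OF v])
    have [measurable]: "(\<lambda>x. sym_part (G x)) \<in> borel_measurable borel" by (rule borel_measurable_continuous_onI[OF cs])
    have [measurable]: "sym_part \<in> borel_measurable (borel :: (real^'n^'n) measure)"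
      by (intro borel_measurable_continuous_onI linear_continuous_on bounded_linear_sym_part)
    have "oscillation_bound \<Omega> G (\<lambda>x. sqrt K *\<^sub>R sym_part (G x))"
      unfolding oscillation_bound_def
    proof (intro conjI allI impI cG)
      show "continuous_on UNIV (\<lambda>x. sqrt K *\<^sub>R sym_part (G x))" by (intro continuous_intros cs)
      fix x and r :: real assume "0 < r"
      from K(2)[OF v this] show "\<exists>c. energy (ball x r) (\<lambda>y. G y - c) \<le> energy (ball x (2 * r)) (\<lambda>x. sqrt K *\<^sub>R sym_part (G x))"
        using K(1) by (simp add: energy_scaleR)
    qed
    from C1(2)[OF this] obtain c where "energy \<Omega> (\<lambda>x. G x - c) \<le> C1 * energy \<Omega> (\<lambda>x. sqrt K *\<^sub>R sym_part (G x))" by blast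
    then have c: "energy \<Omega> (\<lambda>x. G x - c) \<le> C1 * ennreal K * energy \<Omega> (\<lambda>x. sym_part (G x))"
      using K(1) by (simp add: energy_scaleR mult.assoc)
    define S where "S = c - sym_part c"
    have idem: "sym_part (sym_part A) = sym_part A" for A :: "real^'n^'n"
      by (simp add: sym_part_def vec_eq_iff transpose_def field_simps)
    have S: "sym_part S = 0" by (simp add: S_def sym_part_diff idem)
    have eS: "G x - S = ((G x - c) - sym_part (G x - c)) + sym_part (G x)" for x by (simp add: S_def sym_part_diff)
    have "energy \<Omega> (\<lambda>x. G x - S) \<le> 2 * energy \<Omega> (\<lambda>x. (G x - c) - sym_part (G x - c)) + 2 * energy \<Omega> (\<lambda>x. sym_part (G x))"
      unfolding eS by (rule energy_add_le) measurable
    also have "energy \<Omega> (\<lambda>x. (G x - c) - sym_part (G x - c)) \<le> ennreal (2\<^sup>2) * energy \<Omega> (\<lambda>x. G x - c)"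
    proof (rule energy_le_cmult)
      fix x
      show "norm (G x - c - sym_part (G x - c)) \<le> 2 * norm (G x - c)"
        using norm_triangle_ineq4[of "G x - c" "sym_part (G x - c)"] norm_sym_part_le[of "G x - c"] by linarith
    qed auto
    also have "\<dots> \<le> ennreal (2\<^sup>2) * (C1 * ennreal K * energy \<Omega> (\<lambda>x. sym_part (G x)))" by (rule mult_left_mono[OF c]) simp
    finally have GS: "energy \<Omega> (\<lambda>x. G x - S) \<le> D1 * energy \<Omega> (\<lambda>x. sym_part (G x))"
      by (simp add: D1_def distrib_right mult.assoc[symmetric] mult_left_mono)
    have w: "has_gradient (\<lambda>x. v x - (0 + x v* S)) (\<lambda>x. G x - S)"
      by (rule has_gradient_diff[OF v has_gradient_affine])
    have "oscillation_bound \<Omega> (\<lambda>x. v x - (0 + x v* S)) (\<lambda>x. P *\<^sub>R (G x - S))"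
      unfolding oscillation_bound_def
    proof (intro conjI allI impI)
      show "continuous_on UNIV (\<lambda>x. v x - (0 + x v* S))" by (rule has_gradient_continuous[OF w])
      show "continuous_on UNIV (\<lambda>x. P *\<^sub>R (G x - S))" by (intro continuous_intros cG)
      fix x and r :: real assume r: "0 < r" "ball x (2 * r) \<subseteq> \<Omega>"
      have "ball x (2 * r) \<subseteq> cball 0 R" using r R by blast
      then have "dist x 0 + 2 * r \<le> R" using r by (simp add: ball_subset_cball_iff)
      then have "2 * r \<le> R" using zero_le_dist[of x 0] by linarith
      then have "(2 * r)\<^sup>2 \<le> R\<^sup>2" by (rule power_mono) (use r in simp)
      then have "2 ^ CARD('n) * (2 * r)\<^sup>2 \<le> 2 ^ CARD('n) * R\<^sup>2" by (rule mult_left_mono) simp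
      also have "\<dots> = P\<^sup>2" by (simp add: P_def power_mult_distrib[of "sqrt _"])
      finally have "2 ^ CARD('n) * (2 * r)\<^sup>2 \<le> P\<^sup>2" .
      then have le: "ennreal (2 ^ CARD('n) * (2 * r)\<^sup>2) \<le> ennreal (P\<^sup>2)" by (rule ennreal_leI)
      from poincare_ball[OF w r(1), of x] obtain c where
        "energy (ball x r) (\<lambda>y. v y - (0 + y v* S) - c) \<le> ennreal (2 ^ CARD('n) * (2 * r)\<^sup>2) * energy (ball x r) (\<lambda>x. G x - S)" by blast
      also have "\<dots> \<le> ennreal (P\<^sup>2) * energy (ball x (2 * r)) (\<lambda>x. G x - S)"
        using r by (intro mult_mono le energy_mono_set subset_ball) auto
      also have "\<dots> = energy (ball x (2 * r)) (\<lambda>x. P *\<^sub>R (G x - S))" by (simp add: energy_scaleR)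
      finally show "\<exists>c. energy (ball x r) (\<lambda>y. v y - (0 + y v* S) - c) \<le> energy (ball x (2 * r)) (\<lambda>x. P *\<^sub>R (G x - S))" by blast
    qed
    from C2(2)[OF this] obtain b where "energy \<Omega> (\<lambda>x. v x - (0 + x v* S) - b) \<le> C2 * energy \<Omega> (\<lambda>x. P *\<^sub>R (G x - S))" by blast
    also have "\<dots> = C2 * ennreal (P\<^sup>2) * energy \<Omega> (\<lambda>x. G x - S)" by (simp add: energy_scaleR mult.assoc)
    also have "\<dots> \<le> C2 * ennreal (P\<^sup>2) * (D1 * energy \<Omega> (\<lambda>x. sym_part (G x)))" by (rule mult_left_mono[OF GS]) simp
    finally have vb: "energy \<Omega> (\<lambda>x. v x - (b + x v* S)) \<le> D2 * energy \<Omega> (\<lambda>x. sym_part (G x))"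
      by (simp add: D2_def mult.assoc algebra_simps)
    show "\<exists>b S. sym_part S = 0 \<and>
      energy \<Omega> (\<lambda>x. v x - (b + x v* S)) + energy \<Omega> (\<lambda>x. G x - S) \<le> (D2 + D1) * energy \<Omega> (\<lambda>x. sym_part (G x))"
      using S add_mono[OF vb GS] by (auto simp: distrib_right)
  qed
qed

section \<open>Test functions and the fundamental lemma of the calculus of variations\<close>

lemma partial_deriv_eq: "(f has_derivative f') (at x) \<Longrightarrow> partial_deriv i f x = f' (axis i 1)"
  unfolding partial_deriv_def using frechet_derivative_at by metis

lemma C_k_Suc_imp: "C_k (Suc k) f \<Longrightarrow> C_k k f"
proof (induction k arbitrary: f)
  case 0
  then show ?case
    by (auto intro!: continuous_at_imp_continuous_on differentiable_imp_continuous_within)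
next
  case (Suc k)
  show ?case
    unfolding C_k.simps(2)[of k f]
  proof (intro conjI allI)
    show "f differentiable at x" for x using Suc.prems by simp
    show "C_k k (partial_deriv i f)" for i
      by (rule Suc.IH) (use Suc.prems C_k.simps(2)[of "Suc k" f] in blast)
  qed
qed

lemma C_k_bounded_linear: "bounded_linear L \<Longrightarrow> C_k k f \<Longrightarrow> C_k k (\<lambda>x. L (f x))"
proof (induction k arbitrary: f)
  case 0
  then show ?case by (auto intro: bounded_linear.continuous_on)
next
  case (Suc k)
  have d: "(f has_derivative frechet_derivative f (at x)) (at x)" for x
    using Suc.prems by (simp flip: frechet_derivative_works)
  have dL: "((\<lambda>x. L (f x)) has_derivative (\<lambda>h. L (frechet_derivative f (at x) h))) (at x)" for x
    by (rule bounded_linear.has_derivative[OF Suc.prems(1) d])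
  have "partial_deriv i (\<lambda>x. L (f x)) = (\<lambda>x. L (partial_deriv i f x))" for i
    using partial_deriv_eq[OF dL] by (auto simp: partial_deriv_def)
  then show ?case using Suc differentiableI[OF dL] unfolding C_k.simps by auto
qed

lemma C_k_add: "C_k k f \<Longrightarrow> C_k k g \<Longrightarrow> C_k k (\<lambda>x. f x + g x)"
proof (induction k arbitrary: f g)
  case 0
  then show ?case by (auto intro: continuous_intros)
next
  case (Suc k)
  have d: "(f has_derivative frechet_derivative f (at x)) (at x)" "(g has_derivative frechet_derivative g (at x)) (at x)" for x
    using Suc.prems by (simp_all flip: frechet_derivative_works)
  note dd = has_derivative_add[OF d]
  have "partial_deriv i (\<lambda>x. f x + g x) = (\<lambda>x. partial_deriv i f x + partial_deriv i g x)" for i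
    using partial_deriv_eq[OF dd] by (auto simp: partial_deriv_def)
  then show ?case using Suc differentiableI[OF dd] unfolding C_k.simps by auto
qed

lemma C_k_mult:
  fixes f g :: "real^'n::finite \<Rightarrow> real"
  shows "C_k k f \<Longrightarrow> C_k k g \<Longrightarrow> C_k k (\<lambda>x. f x * g x)"
proof (induction k arbitrary: f g)
  case 0
  then show ?case by (auto intro: continuous_intros)
next
  case (Suc k)
  have d: "(f has_derivative frechet_derivative f (at x)) (at x)" "(g has_derivative frechet_derivative g (at x)) (at x)" for x
    using Suc.prems by (simp_all flip: frechet_derivative_works)
  note dd = has_derivative_mult[OF d]
  have "partial_deriv i (\<lambda>x. f x * g x) = (\<lambda>x. f x * partial_deriv i g x + partial_deriv i f x * g x)" for i
    using partial_deriv_eq[OF dd] by (auto simp: partial_deriv_def)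
  moreover have "C_k k (\<lambda>x. f x * partial_deriv i g x + partial_deriv i f x * g x)" for i
    using Suc.prems by (intro C_k_add Suc.IH) (auto intro: C_k_Suc_imp)
  ultimately show ?case using differentiableI[OF dd] unfolding C_k.simps by auto
qed

lemma C_k_const: "C_k k (\<lambda>x::real^'n::finite. c :: 'b::real_normed_vector)"
proof (induction k arbitrary: c)
  case (Suc k)
  have "partial_deriv i (\<lambda>x::real^'n. c) = (\<lambda>x. 0)" for i
    using partial_deriv_eq[OF has_derivative_const] by auto
  then show ?case using Suc by simp
qed simp

lemma C_k_prod:
  fixes f :: "'i \<Rightarrow> real^'n::finite \<Rightarrow> real"
  assumes "\<And>i. i \<in> I \<Longrightarrow> C_k k (f i)"
  shows "C_k k (\<lambda>x. \<Prod>i\<in>I. f i x)"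
  using assms by (induction I rule: infinite_finite_induct) (auto intro: C_k_const C_k_mult)

text \<open>
  The family is closed under differentiation up to linear combinations, so smoothness needs no
  polynomials in \<open>1 / t\<close>.
\<close>

definition flat_exp :: "nat \<Rightarrow> real \<Rightarrow> real" where
  "flat_exp m t = (if 0 < t then exp (- 1 / t) / t ^ m else 0)"

lemma flat_exp_tendsto_0: "(flat_exp m \<longlongrightarrow> 0) (at 0)"
proof -
  have "((\<lambda>t. (inverse t) ^ m / exp (inverse t)) \<longlongrightarrow> 0) (at_right (0::real))"
    by (rule filterlim_compose[OF tendsto_power_div_exp_0 filterlim_inverse_at_top_right])
  then have "(flat_exp m \<longlongrightarrow> 0) (at_right 0)"
  proof (rule Lim_transform_eventually)
    show "\<forall>\<^sub>F t in at_right 0. inverse t ^ m / exp (inverse t) = flat_exp m t"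
      unfolding eventually_at_right_field
      by (intro exI[of _ 1]) (auto simp: flat_exp_def exp_minus field_simps)
  qed
  moreover have "(flat_exp m \<longlongrightarrow> 0) (at_left 0)"
  proof (rule Lim_transform_eventually[OF tendsto_const])
    show "\<forall>\<^sub>F t in at_left 0. 0 = flat_exp m t"
      unfolding eventually_at_left_field
      by (intro exI[of _ "-1"]) (auto simp: flat_exp_def)
  qed
  ultimately show ?thesis by (simp add: filterlim_at_split)
qed

lemma DERIV_flat_exp: "(flat_exp m has_real_derivative flat_exp (m + 2) t - real m * flat_exp (m + 1) t) (at t)"
proof (cases t "0 :: real" rule: linorder_cases)
  case less
  have "((\<lambda>t. 0) has_real_derivative flat_exp (m + 2) t - real m * flat_exp (m + 1) t) (at t)"
    using less by (simp add: flat_exp_def)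
  then show ?thesis
    by (rule has_field_derivative_transform_within_open[where S = "{..<0}"]) (use less in \<open>auto simp: flat_exp_def\<close>)
next
  case greater
  have "((\<lambda>t. exp (- 1 / t) / t ^ m) has_real_derivative flat_exp (m + 2) t - real m * flat_exp (m + 1) t) (at t)"
    using greater
    apply (auto intro!: derivative_eq_intros simp: flat_exp_def)
    apply (cases m)
    apply (auto simp: field_simps power2_eq_square)
    done
  then show ?thesis
    by (rule has_field_derivative_transform_within_open[where S = "{0<..}"]) (use greater in \<open>auto simp: flat_exp_def\<close>)
next
  case equal
  have "((\<lambda>h. flat_exp m (0 + h) / h) \<longlongrightarrow> 0) (at 0)"
  proof (rule Lim_transform_eventually[OF flat_exp_tendsto_0[of "Suc m"]])
    show "\<forall>\<^sub>F h in at 0. flat_exp (Suc m) h = flat_exp m (0 + h) / h"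
      by (intro always_eventually) (auto simp: flat_exp_def field_simps)
  qed
  then show ?thesis using equal by (simp add: DERIV_def flat_exp_def)
qed

lemma C_k_flat_exp: "C_k k (\<lambda>x::real^'n::finite. flat_exp m (c * x $ i + d))"
proof (induction k arbitrary: m)
  case 0
  have "continuous_on UNIV (flat_exp m)"
    by (intro continuous_at_imp_continuous_on ballI DERIV_isCont[OF DERIV_flat_exp])
  then show ?case by (auto intro!: continuous_on_compose2[of UNIV "flat_exp m"] continuous_intros)
next
  case (Suc k)
  have d: "((\<lambda>x::real^'n. flat_exp m (c * x $ i + d)) has_derivative
    (\<lambda>h. (flat_exp (m + 2) (c * x $ i + d) - real m * flat_exp (m + 1) (c * x $ i + d)) * (c * h $ i))) (at x)" for x
  proof -
    have "((\<lambda>x::real^'n. c * x $ i + d) has_derivative (\<lambda>h. c * h $ i)) (at x)"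
      by (auto intro!: derivative_eq_intros bounded_linear_imp_has_derivative bounded_linear_vec_nth)
    from has_derivative_compose[OF this DERIV_flat_exp[THEN has_field_derivative_imp_has_derivative]]
    show ?thesis by simp
  qed
  have "partial_deriv j (\<lambda>x::real^'n. flat_exp m (c * x $ i + d)) =
    (\<lambda>x. (c * axis j 1 $ i) *\<^sub>R (flat_exp (m + 2) (c * x $ i + d) + (- real m) *\<^sub>R flat_exp (m + 1) (c * x $ i + d)))" for j
    using partial_deriv_eq[OF d] by (auto simp: algebra_simps)
  moreover have "C_k k (\<lambda>x::real^'n. (c * axis j 1 $ i) *\<^sub>R (flat_exp (m + 2) (c * x $ i + d) + (- real m) *\<^sub>R flat_exp (m + 1) (c * x $ i + d)))" for j
    by (intro C_k_bounded_linear[OF bounded_linear_scaleR_right] C_k_add Suc.IH)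
  ultimately show ?case using differentiableI[OF d] unfolding C_k.simps by auto
qed

text \<open>
  As \<open>c\<close> grows, these smooth functions increase to the indicator of the box.
\<close>

definition box_bump :: "real^'n::finite \<Rightarrow> real^'n \<Rightarrow> real \<Rightarrow> real^'n \<Rightarrow> real" where
  "box_bump a b c x = (\<Prod>i\<in>UNIV. flat_exp 0 (c * x $ i + (- c * a $ i)) * flat_exp 0 ((- c) * x $ i + c * b $ i))"

lemma box_bump_bounds: "0 \<le> box_bump a b c x" "box_bump a b c x \<le> 1"
proof -
  have "0 \<le> flat_exp 0 t" "flat_exp 0 t \<le> 1" for t by (auto simp: flat_exp_def)
  then show "0 \<le> box_bump a b c x" "box_bump a b c x \<le> 1"
    unfolding box_bump_def by (auto intro!: prod_nonneg prod_le_1 mult_le_one)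
qed

lemma box_bump_eq_0: "0 < c \<Longrightarrow> x \<notin> box a b \<Longrightarrow> box_bump a b c x = 0"
proof -
  assume c: "0 < c" and "x \<notin> box a b"
  then obtain i where i: "x $ i \<le> a $ i \<or> b $ i \<le> x $ i" by (auto simp: mem_box_cart not_less)
  have "c * x $ i + (- c * a $ i) = c * (x $ i - a $ i)" "(- c) * x $ i + c * b $ i = c * (b $ i - x $ i)"
    by (auto simp: algebra_simps)
  then have "flat_exp 0 (c * x $ i + (- c * a $ i)) * flat_exp 0 ((- c) * x $ i + c * b $ i) = 0"
    using i c by (auto simp: flat_exp_def zero_less_mult_iff)
  then show ?thesis unfolding box_bump_def by (intro prod_zero) auto
qed

lemma box_bump_Cc_infinity:
  assumes "0 < c" "cbox a b \<subseteq> \<Omega>"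
  shows "box_bump a b c \<in> Cc_infinity \<Omega>"
proof -
  have "{x. box_bump a b c x \<noteq> 0} \<subseteq> cbox a b" using box_bump_eq_0[OF assms(1)] box_subset_cbox[of a b] by blast
  then have s: "supp (box_bump a b c) \<subseteq> cbox a b" unfolding supp_def by (rule closure_minimal[OF _ closed_cbox])
  then have "compact (supp (box_bump a b c))"
    unfolding supp_def by (intro compact_closure[THEN iffD2]) (meson bounded_cbox bounded_subset closure_subset order_trans)
  moreover have "C_infinity (box_bump a b c)"
    unfolding C_infinity_def box_bump_def by (intro allI C_k_prod C_k_mult C_k_flat_exp)
  ultimately show ?thesis using s assms(2) by (auto simp: Cc_infinity_def)
qed

lemma box_bump_tendsto: "(\<lambda>n. box_bump a b (real (Suc n)) x) \<longlonglongrightarrow> indicator (box a b) x"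
proof (cases "x \<in> box a b")
  case True
  have lim: "(\<lambda>n. flat_exp 0 (real (Suc n) * t)) \<longlonglongrightarrow> 1" if "0 < t" for t
  proof -
    have "(\<lambda>n. exp (- ((1 / real (Suc n)) * (1 / t)))) \<longlonglongrightarrow> exp (- (0 * (1 / t)))"
      by (intro tendsto_intros LIMSEQ_Suc[OF lim_1_over_n])
    moreover have "flat_exp 0 (real (Suc n) * t) = exp (- ((1 / real (Suc n)) * (1 / t)))" for n
      using that by (simp add: flat_exp_def zero_less_mult_iff)
    ultimately show ?thesis by simp
  qed
  have "(\<lambda>n. \<Prod>i\<in>UNIV. flat_exp 0 (real (Suc n) * (x $ i - a $ i)) * flat_exp 0 (real (Suc n) * (b $ i - x $ i))) \<longlonglongrightarrow> (\<Prod>i\<in>(UNIV :: 'a set). 1 * 1)"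
    using True by (intro tendsto_prod tendsto_mult lim) (auto simp: mem_box_cart)
  moreover have "real (Suc n) * x $ i + (- real (Suc n) * a $ i) = real (Suc n) * (x $ i - a $ i)"
    "(- real (Suc n)) * x $ i + real (Suc n) * b $ i = real (Suc n) * (b $ i - x $ i)" for n i
    by (auto simp: algebra_simps)
  ultimately show ?thesis using True unfolding box_bump_def by simp
next
  case False
  then show ?thesis by (simp add: box_bump_eq_0)
qed

lemma C_infinity_continuous: "C_infinity f \<Longrightarrow> continuous_on UNIV f"
  unfolding C_infinity_def using C_k.simps(1) by blast

text \<open>
  Testing with \<open>box_bump\<close> shows that the integral of \<open>g\<close> vanishes over every box in \<open>\<Omega>\<close>; by Lebesgue's
  differentiation theorem \<open>g\<close> vanishes almost everywhere.
\<close>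

lemma fundamental_lemma_calculus_of_variations:
  fixes g :: "real^'n::finite \<Rightarrow> real"
  assumes "open \<Omega>" and g: "integrable (lebesgue_on \<Omega>) g"
    and zero: "\<And>\<phi>. \<phi> \<in> Cc_infinity \<Omega> \<Longrightarrow> integral\<^sup>L (lebesgue_on \<Omega>) (\<lambda>x. g x * \<phi> x) = 0"
  shows "AE x in lebesgue_on \<Omega>. g x = 0"
proof -
  have \<Omega>: "\<Omega> \<in> sets lebesgue" using \<open>open \<Omega>\<close> by (simp add: lborelD)
  define f where "f x = indicator \<Omega> x *\<^sub>R g x" for x
  have f: "integrable lebesgue f"
    unfolding f_def using g \<Omega> by (simp add: integrable_restrict_space)
  have ai: "f absolutely_integrable_on S" if "S \<in> sets lebesgue" for S
    unfolding set_integrable_def using integrable_mult_indicator[OF that f] .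
  have box0: "integral (cbox a b) f = 0" if ab: "cbox a b \<subseteq> \<Omega>" for a b
  proof -
    have "(\<lambda>n. integral\<^sup>L lebesgue (\<lambda>x. f x * box_bump a b (real (Suc n)) x)) \<longlonglongrightarrow> integral\<^sup>L lebesgue (\<lambda>x. f x * indicator (box a b) x)"
    proof (rule integral_dominated_convergence)
      show "integrable lebesgue (\<lambda>x. \<bar>f x\<bar>)" using f by (rule integrable_abs)
      show "AE x in lebesgue. (\<lambda>n. f x * box_bump a b (real (Suc n)) x) \<longlonglongrightarrow> f x * indicator (box a b) x"
        by (intro AE_I2 tendsto_mult tendsto_const box_bump_tendsto)
      have m: "box_bump a b (real (Suc n)) \<in> borel_measurable lebesgue" for n
      proof -
        have "box_bump a b (real (Suc n)) \<in> Cc_infinity \<Omega>" by (rule box_bump_Cc_infinity[OF _ ab]) simp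
        then have "box_bump a b (real (Suc n)) \<in> borel_measurable borel"
          by (intro borel_measurable_continuous_onI C_infinity_continuous) (simp add: Cc_infinity_def)
        then show ?thesis by (simp add: measurable_completion)
      qed
      show "(\<lambda>x. f x * box_bump a b (real (Suc n)) x) \<in> borel_measurable lebesgue" for n
        using f m by (intro borel_measurable_times) auto
      show "(\<lambda>x. f x * indicator (box a b) x) \<in> borel_measurable lebesgue"
        using f by (intro borel_measurable_times borel_measurable_indicator) auto
      show "AE x in lebesgue. norm (f x * box_bump a b (real (Suc n)) x) \<le> \<bar>f x\<bar>" for n
        by (intro AE_I2) (simp add: abs_mult box_bump_bounds mult_left_le)
    qed
    moreover have "integral\<^sup>L lebesgue (\<lambda>x. f x * box_bump a b (real (Suc n)) x) = 0" for n
      using zero[OF box_bump_Cc_infinity[OF _ ab], of "real (Suc n)"] \<Omega>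
      by (simp add: integral_restrict_space f_def mult.assoc)
    ultimately have "integral\<^sup>L lebesgue (\<lambda>x. f x * indicator (box a b) x) = 0"
      by (simp add: LIMSEQ_const_iff)
    then have "(LINT x:box a b|lebesgue. f x) = 0"
      by (simp add: set_lebesgue_integral_def mult.commute)
    then have "integral (box a b) f = 0"
      using set_lebesgue_integral_eq_integral(2)[OF ai, of "box a b"] by simp
    then show ?thesis by (simp add: integral_open_interval)
  qed
  have ii: "f integrable_on cbox a b" for a b
    using set_lebesgue_integral_eq_integral(1)[OF ai, of "cbox a b"] by simp
  obtain N where N: "negligible N" and lim: "\<And>x e. \<lbrakk>x \<notin> N; 0 < e\<rbrakk> \<Longrightarrow>
      \<exists>d>0. \<forall>h. 0 < h \<and> h < d \<longrightarrow> norm (integral (cbox x (x + h *\<^sub>R One)) f /\<^sub>R h ^ DIM(real^'n) - f x) < e"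
    using integrable_ccontinuous_explicit[OF ii] by blast
  have "f x = 0" if x: "x \<in> \<Omega>" "x \<notin> N" for x
  proof (rule ccontr)
    assume "f x \<noteq> 0"
    then obtain d where d: "0 < d" "\<And>h. 0 < h \<Longrightarrow> h < d \<Longrightarrow> norm (integral (cbox x (x + h *\<^sub>R One)) f /\<^sub>R h ^ DIM(real^'n) - f x) < norm (f x)"
      using lim[OF x(2), of "norm (f x)"] by auto
    obtain s where s: "0 < s" "cball x s \<subseteq> \<Omega>" using \<open>open \<Omega>\<close> x(1) open_contains_cball by blast
    define h where "h = min (d / 2) (s / norm (One :: real^'n))"
    have One: "norm (One :: real^'n) > 0" by simp
    have h: "0 < h" "h < d" using d s One by (auto simp: h_def)
    have "cbox x (x + h *\<^sub>R One) \<subseteq> cball x s"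
    proof
      fix y assume y: "y \<in> cbox x (x + h *\<^sub>R One)"
      have "norm (y - x) \<le> norm (h *\<^sub>R (One :: real^'n))"
        by (rule norm_le_componentwise) (use y h in \<open>auto simp: mem_box inner_diff_left inner_add_left\<close>)
      also have "\<dots> \<le> s"
      proof -
        have "h \<le> s / norm (One :: real^'n)" by (simp add: h_def)
        then show ?thesis using h(1) One by (simp add: pos_le_divide_eq)
      qed
      finally show "y \<in> cball x s" by (simp add: dist_norm norm_minus_commute)
    qed
    then have "integral (cbox x (x + h *\<^sub>R One)) f = 0" using s by (intro box0) auto
    then show False using d(2)[OF h] by simp
  qed
  then have "{x \<in> \<Omega>. g x \<noteq> 0} \<subseteq> N" by (auto simp: f_def)
  then have "negligible {x \<in> \<Omega>. g x \<noteq> 0}" using N negligible_subset by blast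
  then have "{x \<in> \<Omega>. g x \<noteq> 0} \<in> null_sets lebesgue" by (simp add: negligible_iff_null_sets)
  then have "AE x in lebesgue. x \<in> \<Omega> \<longrightarrow> g x = 0" by (rule AE_I'[of "{x \<in> \<Omega>. g x \<noteq> 0}"]) auto
  then show ?thesis using \<Omega> by (simp add: AE_restrict_space_iff)
qed

section \<open>Weak gradients and square integrable fields\<close>

lemma C_infinity_has_derivative:
  assumes "C_infinity (f :: real^'n::finite \<Rightarrow> 'b::real_normed_vector)"
  shows "(f has_derivative (\<lambda>h. \<Sum>i\<in>UNIV. (h $ i) *\<^sub>R partial_deriv i f x)) (at x)"
    and "continuous_on UNIV (partial_deriv i f)"
proof -
  have 1: "C_k (Suc 0) f" using assms by (auto simp: C_infinity_def)
  then show "continuous_on UNIV (partial_deriv i f)" by simp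
  have d: "(f has_derivative frechet_derivative f (at x)) (at x)"
    using 1 by (simp flip: frechet_derivative_works)
  then have lin: "linear (frechet_derivative f (at x))" by (simp add: has_derivative_linear)
  have "frechet_derivative f (at x) h = (\<Sum>i\<in>UNIV. (h $ i) *\<^sub>R partial_deriv i f x)" for h
  proof -
    have "h = (\<Sum>i\<in>UNIV. (h $ i) *\<^sub>R axis i 1)" using basis_expansion[of h] by (simp add: scalar_mult_eq_scaleR)
    then have "frechet_derivative f (at x) h = frechet_derivative f (at x) (\<Sum>i\<in>UNIV. (h $ i) *\<^sub>R axis i 1)" by simp
    also have "\<dots> = (\<Sum>i\<in>UNIV. (h $ i) *\<^sub>R partial_deriv i f x)"
      using lin by (simp add: linear_sum linear_scale partial_deriv_def)
    finally show ?thesis .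
  qed
  then show "(f has_derivative (\<lambda>h. \<Sum>i\<in>UNIV. (h $ i) *\<^sub>R partial_deriv i f x)) (at x)"
    using d by (metis (no_types, lifting) ext)
qed

lemma C_infinity_has_gradient:
  assumes "C_infinity v"
  shows "has_gradient v (\<lambda>x. \<chi> i. partial_deriv i v x)"
  unfolding has_gradient_def
proof (intro conjI allI)
  show "continuous_on UNIV (\<lambda>x. \<chi> i. partial_deriv i v x)"
    by (intro continuous_on_vec_lambda C_infinity_has_derivative assms)
  fix x
  have "(\<Sum>i\<in>UNIV. (h $ i) *\<^sub>R partial_deriv i v x) = h v* (\<chi> i. partial_deriv i v x)" for h
    by (simp add: vec_eq_iff vector_matrix_mult_def)
  then show "(v has_derivative (\<lambda>h. h v* (\<chi> i. partial_deriv i v x))) (at x)"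
    using C_infinity_has_derivative(1)[OF assms, of x] by simp
qed

lemma C_infinity_scalar_gradient:
  assumes "C_infinity \<phi>"
  shows "scalar_gradient \<phi> (\<lambda>x. \<chi> i. partial_deriv i \<phi> x)"
  unfolding scalar_gradient_def
proof (intro conjI allI)
  show "continuous_on UNIV (\<lambda>x. \<chi> i. partial_deriv i \<phi> x)"
    by (intro continuous_on_vec_lambda C_infinity_has_derivative assms)
  fix x
  have "(\<Sum>i\<in>UNIV. (h $ i) *\<^sub>R partial_deriv i \<phi> x) = (\<chi> i. partial_deriv i \<phi> x) \<bullet> h" for h
    by (simp add: inner_vec_def mult.commute)
  then show "(\<phi> has_derivative (\<lambda>h. (\<chi> i. partial_deriv i \<phi> x) \<bullet> h)) (at x)"
    using C_infinity_has_derivative(1)[OF assms, of x] by simp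
qed

lemma outside_supp: "x \<notin> supp f \<Longrightarrow> f x = 0"
  unfolding supp_def using closure_subset[of "{x. f x \<noteq> 0}"] by blast

lemma partial_deriv_outside_supp:
  assumes "x \<notin> supp f"
  shows "partial_deriv i f x = 0"
proof -
  have "open (- supp f)" by (simp add: supp_def open_Compl)
  then have "(f has_derivative (\<lambda>h. 0)) (at x)"
    by (rule has_derivative_transform_within_open[OF has_derivative_const[of 0]]) (use assms outside_supp in auto)
  then show ?thesis by (rule partial_deriv_eq)
qed

lemma integral_lebesgue_on_borel:
  fixes F :: "'a::euclidean_space \<Rightarrow> real"
  assumes [measurable]: "F \<in> borel_measurable borel" "S \<in> sets borel"
  shows "integral\<^sup>L (lebesgue_on S) F = integral\<^sup>L lborel (\<lambda>x. indicator S x * F x)"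
  by (simp add: integral_restrict_space integral_completion)

lemma has_gradient_imp_has_weak_gradient:
  fixes v :: "real^'n::finite \<Rightarrow> real^'n"
  assumes v: "has_gradient v G" and \<Omega>: "open \<Omega>"
  shows "has_weak_gradient \<Omega> v G"
  unfolding has_weak_gradient_def
proof (intro allI impI)
  fix \<phi> :: "real^'n \<Rightarrow> real" and i j assume \<phi>: "\<phi> \<in> Cc_infinity \<Omega>"
  then have smooth: "C_infinity \<phi>" and cpt: "compact (supp \<phi>)" and sub: "supp \<phi> \<subseteq> \<Omega>" by (auto simp: Cc_infinity_def)
  obtain R where R: "supp \<phi> \<subseteq> cball 0 R" using compact_imp_bounded[OF cpt] by (auto simp: bounded_iff subset_iff)
  have out: "\<phi> x = 0" "partial_deriv i \<phi> x = 0" if "R < norm x" for x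
    using that R outside_supp[of x \<phi>] partial_deriv_outside_supp[of x \<phi>] by force+
  have out\<Omega>: "\<phi> x = 0" "partial_deriv i \<phi> x = 0" if "x \<notin> \<Omega>" for x
    using that sub outside_supp[of x \<phi>] partial_deriv_outside_supp[of x \<phi>] by auto
  note s\<phi> = C_infinity_scalar_gradient[OF smooth]
  note sv = has_gradient_component[OF v, of j]
  have c: "continuous_on UNIV \<phi>" "continuous_on UNIV (partial_deriv i \<phi>)" "continuous_on UNIV v" "continuous_on UNIV G"
    using C_infinity_has_derivative(2)[OF smooth] C_infinity_continuous[OF smooth] has_gradient_continuous[OF v] v
    by (auto simp: has_gradient_def)
  have i1: "integrable lborel (\<lambda>x. v x $ j * partial_deriv i \<phi> x)"
    by (rule integrable_continuous_cball_support[of _ R]) (intro continuous_intros c, simp add: out)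
  have i2: "integrable lborel (\<lambda>x. G x $ i $ j * \<phi> x)"
    by (rule integrable_continuous_cball_support[of _ R]) (intro continuous_intros c, simp add: out)
  have "(\<integral>x. (\<phi> x *\<^sub>R (\<chi> i. G x $ i $ j) + v x $ j *\<^sub>R (\<chi> i. partial_deriv i \<phi> x)) \<bullet> axis i 1 \<partial>lborel) = 0"
    by (rule integral_directional_derivative_eq_0[OF scalar_gradient_mult[OF s\<phi> sv], of R]) (simp add: out)
  then have "(\<integral>x. v x $ j * partial_deriv i \<phi> x + G x $ i $ j * \<phi> x \<partial>lborel) = 0"
    by (simp add: inner_axis algebra_simps)
  then have 0: "integral\<^sup>L lborel (\<lambda>x. v x $ j * partial_deriv i \<phi> x) = - integral\<^sup>L lborel (\<lambda>x. G x $ i $ j * \<phi> x)"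
    using Bochner_Integration.integral_add[OF i1 i2] by simp
  have [measurable]: "\<Omega> \<in> sets borel" using \<Omega> by simp
  have restrict: "integral\<^sup>L (lebesgue_on \<Omega>) F = integral\<^sup>L lborel F" if "integrable lborel F" "\<And>x. x \<notin> \<Omega> \<Longrightarrow> F x = 0" for F :: "real^'n \<Rightarrow> real"
  proof -
    have "(\<lambda>x. indicator \<Omega> x * F x) = F" using that(2) by (auto simp: indicator_def fun_eq_iff)
    then show ?thesis using that(1) by (subst integral_lebesgue_on_borel) auto
  qed
  show "integral\<^sup>L (lebesgue_on \<Omega>) (\<lambda>x. v x $ j * partial_deriv i \<phi> x) = - integral\<^sup>L (lebesgue_on \<Omega>) (\<lambda>x. G x $ i $ j * \<phi> x)"
    using 0 out\<Omega> by (simp add: restrict[OF i1] restrict[OF i2])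
qed

lemma L2_inner_integrable:
  assumes f: "f \<in> L2 \<Omega>" and g: "g \<in> L2 \<Omega>"
  shows "integrable (lebesgue_on \<Omega>) (\<lambda>x. f x \<bullet> g x)"
proof (rule Bochner_Integration.integrable_bound)
  show "integrable (lebesgue_on \<Omega>) (\<lambda>x. (norm (f x))\<^sup>2 + (norm (g x))\<^sup>2)"
    using f g by (auto simp: L2_def)
  show "(\<lambda>x. f x \<bullet> g x) \<in> borel_measurable (lebesgue_on \<Omega>)"
    using f g by (intro borel_measurable_inner) (auto simp: L2_def)
  show "AE x in lebesgue_on \<Omega>. norm (f x \<bullet> g x) \<le> norm ((norm (f x))\<^sup>2 + (norm (g x))\<^sup>2)"
  proof (rule AE_I2)
    fix x
    have "\<bar>f x \<bullet> g x\<bar> \<le> norm (f x) * norm (g x)" by (rule Cauchy_Schwarz_ineq2)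
    also have "\<dots> \<le> (norm (f x))\<^sup>2 + (norm (g x))\<^sup>2"
    proof -
      have "2 * (norm (f x) * norm (g x)) \<le> (norm (f x))\<^sup>2 + (norm (g x))\<^sup>2"
        using zero_le_power2[of "norm (f x) - norm (g x)"] by (simp add: power2_eq_square algebra_simps)
      moreover have "0 \<le> norm (f x) * norm (g x)" by simp
      ultimately show ?thesis by linarith
    qed
    finally show "norm (f x \<bullet> g x) \<le> norm ((norm (f x))\<^sup>2 + (norm (g x))\<^sup>2)" by simp
  qed
qed

lemma L2_add: 
  assumes f: "f \<in> L2 \<Omega>" and g: "g \<in> L2 \<Omega>"
  shows "(\<lambda>x. f x + g x) \<in> L2 \<Omega>"
proof -
  have "(norm (f x + g x))\<^sup>2 = (norm (f x))\<^sup>2 + 2 * (f x \<bullet> g x) + (norm (g x))\<^sup>2" for x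
    by (simp add: power2_norm_eq_inner inner_add_left inner_add_right inner_commute)
  then show ?thesis
    using f g L2_inner_integrable[OF f g] by (auto simp: L2_def)
qed

lemma L2_bounded_linear:
  fixes L :: "'b::euclidean_space \<Rightarrow> 'c::euclidean_space"
  assumes L: "bounded_linear L" and f: "f \<in> L2 \<Omega>"
  shows "(\<lambda>x. L (f x)) \<in> L2 \<Omega>"
proof -
  obtain K where K: "\<And>x. norm (L x) \<le> norm x * K" "K \<ge> 0" using bounded_linear.nonneg_bounded[OF L] by blast
  have [measurable]: "f \<in> borel_measurable (lebesgue_on \<Omega>)" "integrable (lebesgue_on \<Omega>) (\<lambda>x. (norm (f x))\<^sup>2)"
    using f by (auto simp: L2_def)
  have [measurable]: "L \<in> borel_measurable borel"
    by (intro borel_measurable_continuous_onI linear_continuous_on L)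
  have "integrable (lebesgue_on \<Omega>) (\<lambda>x. (norm (L (f x)))\<^sup>2)"
  proof (rule Bochner_Integration.integrable_bound[of _ "\<lambda>x. K\<^sup>2 * (norm (f x))\<^sup>2"])
    show "AE x in lebesgue_on \<Omega>. norm ((norm (L (f x)))\<^sup>2) \<le> norm (K\<^sup>2 * (norm (f x))\<^sup>2)"
      using power_mono[OF K(1) norm_ge_zero, of _ 2] by (intro AE_I2) (simp add: power_mult_distrib mult.commute)
  qed (auto intro: \<open>integrable _ _\<close>)
  then show ?thesis by (simp add: L2_def)
qed

lemma L2_scaleR: "f \<in> L2 \<Omega> \<Longrightarrow> (\<lambda>x. c *\<^sub>R f x) \<in> L2 \<Omega>"
  by (rule L2_bounded_linear[OF bounded_linear_scaleR_right])

lemma L2_diff: "f \<in> L2 \<Omega> \<Longrightarrow> g \<in> L2 \<Omega> \<Longrightarrow> (\<lambda>x. f x - g x) \<in> L2 \<Omega>"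
  using L2_add[of f \<Omega> "\<lambda>x. (-1) *\<^sub>R g x"] L2_scaleR[of g \<Omega> "-1"] by simp

lemma L2_continuous:
  fixes f :: "real^'n::finite \<Rightarrow> 'b::euclidean_space"
  assumes f: "continuous_on UNIV f" and \<Omega>: "open \<Omega>" "bounded \<Omega>"
  shows "f \<in> L2 \<Omega>"
proof -
  have [measurable]: "\<Omega> \<in> sets borel" using \<Omega> by simp
  have [measurable]: "f \<in> borel_measurable borel" by (rule borel_measurable_continuous_onI[OF f])
  have m: "f \<in> borel_measurable (lebesgue_on \<Omega>)"
    by (intro measurable_restrict_space1 measurable_completion) measurable
  have "(\<integral>\<^sup>+x. ennreal (norm ((norm (f x))\<^sup>2)) \<partial>lebesgue_on \<Omega>) = energy \<Omega> f"
    by (simp add: nn_integral_restrict_space nn_integral_completion energy_def)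
  also have "\<dots> < top" by (rule energy_bounded_finite[OF f \<Omega>(2)])
  finally show ?thesis using m by (simp add: L2_def integrable_iff_bounded)
qed

abbreviation l2_square :: "(real^'n::finite) set \<Rightarrow> (real^'n \<Rightarrow> 'b::euclidean_space) \<Rightarrow> real" where
  "l2_square \<Omega> f \<equiv> l2_inner \<Omega> f f"

lemma l2_inner_commute: "l2_inner \<Omega> f g = l2_inner \<Omega> g f"
  by (simp add: l2_inner_def inner_commute)

lemma l2_inner_add_left:
  "f \<in> L2 \<Omega> \<Longrightarrow> g \<in> L2 \<Omega> \<Longrightarrow> h \<in> L2 \<Omega> \<Longrightarrow> l2_inner \<Omega> (\<lambda>x. f x + g x) h = l2_inner \<Omega> f h + l2_inner \<Omega> g h"
  unfolding l2_inner_def inner_add_left by (intro Bochner_Integration.integral_add L2_inner_integrable)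

lemma l2_inner_diff_left:
  "f \<in> L2 \<Omega> \<Longrightarrow> g \<in> L2 \<Omega> \<Longrightarrow> h \<in> L2 \<Omega> \<Longrightarrow> l2_inner \<Omega> (\<lambda>x. f x - g x) h = l2_inner \<Omega> f h - l2_inner \<Omega> g h"
  unfolding l2_inner_def inner_diff_left by (intro Bochner_Integration.integral_diff L2_inner_integrable)

lemma l2_inner_scaleR_left: "l2_inner \<Omega> (\<lambda>x. c *\<^sub>R f x) h = c * l2_inner \<Omega> f h"
  unfolding l2_inner_def by simp

lemma l2_inner_self_nonneg: "0 \<le> l2_square \<Omega> f"
  unfolding l2_inner_def by simp

lemma l2_inner_self_cong:
  assumes "AE x in lebesgue_on \<Omega>. f x = g x" "f \<in> L2 \<Omega>" "g \<in> L2 \<Omega>"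
  shows "l2_square \<Omega> f = l2_square \<Omega> g"
  unfolding l2_inner_def
  by (rule integral_cong_AE) (use assms in \<open>auto simp: L2_def intro!: borel_measurable_inner elim: eventually_mono\<close>)

lemma l2_inner_cong_right:
  assumes "AE x in lebesgue_on \<Omega>. g x = h x" "f \<in> L2 \<Omega>" "g \<in> L2 \<Omega>" "h \<in> L2 \<Omega>"
  shows "l2_inner \<Omega> f g = l2_inner \<Omega> f h"
  unfolding l2_inner_def
  by (rule integral_cong_AE) (use assms in \<open>auto simp: L2_def intro!: borel_measurable_inner elim: eventually_mono\<close>)

lemma l2_inner_self_mono:
  assumes "f \<in> L2 \<Omega>" "g \<in> L2 \<Omega>" "\<And>x. norm (f x) \<le> norm (g x)"
  shows "l2_square \<Omega> f \<le> l2_square \<Omega> g"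
  unfolding l2_inner_def
proof (intro integral_mono L2_inner_integrable assms)
  show "f x \<bullet> f x \<le> g x \<bullet> g x" for x
    using power_mono[OF assms(3), of x 2] by (simp add: power2_norm_eq_inner)
qed

lemma l2_inner_self_add_le:
  assumes f: "f \<in> L2 \<Omega>" and g: "g \<in> L2 \<Omega>"
  shows "l2_square \<Omega> (\<lambda>x. f x + g x) \<le> 2 * l2_square \<Omega> f + 2 * l2_square \<Omega> g"
proof -
  have "0 \<le> l2_square \<Omega> (\<lambda>x. f x - g x)" by (rule l2_inner_self_nonneg)
  also have "\<dots> = l2_square \<Omega> f - 2 * l2_inner \<Omega> f g + l2_square \<Omega> g"
    using f g L2_diff[OF f g]
    by (simp add: l2_inner_diff_left l2_inner_commute[of \<Omega> f "\<lambda>x. f x - g x"] l2_inner_commute[of \<Omega> g "\<lambda>x. f x - g x"] l2_inner_commute[of \<Omega> g f])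
  finally have "2 * l2_inner \<Omega> f g \<le> l2_square \<Omega> f + l2_square \<Omega> g" by simp
  moreover have "l2_square \<Omega> (\<lambda>x. f x + g x) = l2_square \<Omega> f + 2 * l2_inner \<Omega> f g + l2_square \<Omega> g"
    using f g L2_add[OF f g]
    by (simp add: l2_inner_add_left l2_inner_commute[of \<Omega> f "\<lambda>x. f x + g x"] l2_inner_commute[of \<Omega> g "\<lambda>x. f x + g x"] l2_inner_commute[of \<Omega> g f])
  ultimately show ?thesis by simp
qed

lemma energy_eq_l2_inner:
  fixes f :: "real^'n::finite \<Rightarrow> 'b::euclidean_space"
  assumes f: "continuous_on UNIV f" and \<Omega>: "open \<Omega>" "bounded \<Omega>"
  shows "energy \<Omega> f = ennreal (l2_square \<Omega> f)"
proof -
  have [measurable]: "\<Omega> \<in> sets borel" using \<Omega> by simp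
  have "energy \<Omega> f = (\<integral>\<^sup>+x. ennreal ((norm (f x))\<^sup>2) \<partial>lebesgue_on \<Omega>)"
    by (simp add: nn_integral_restrict_space nn_integral_completion energy_def)
  also have "\<dots> = ennreal (integral\<^sup>L (lebesgue_on \<Omega>) (\<lambda>x. (norm (f x))\<^sup>2))"
    using L2_continuous[OF assms] by (intro nn_integral_eq_integral) (auto simp: L2_def)
  finally show ?thesis by (simp add: l2_inner_def power2_norm_eq_inner)
qed

lemma has_weak_gradient_integrable:
  assumes \<Omega>: "open \<Omega>" "bounded \<Omega>" and v: "(v :: real^'n::finite \<Rightarrow> real^'n) \<in> L2 \<Omega>" and G: "G \<in> L2 \<Omega>" and \<phi>: "\<phi> \<in> Cc_infinity \<Omega>"
  shows "integrable (lebesgue_on \<Omega>) (\<lambda>x. v x $ j * partial_deriv i \<phi> x)"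
    and "integrable (lebesgue_on \<Omega>) (\<lambda>x. G x $ i $ j * \<phi> x)"
proof -
  have smooth: "C_infinity \<phi>" using \<phi> by (simp add: Cc_infinity_def)
  have "\<phi> \<in> L2 \<Omega>" "partial_deriv i \<phi> \<in> L2 \<Omega>"
    using C_infinity_continuous[OF smooth] C_infinity_has_derivative(2)[OF smooth] \<Omega> by (auto intro: L2_continuous)
  moreover have "(\<lambda>x. v x $ j) \<in> L2 \<Omega>" by (rule L2_bounded_linear[OF bounded_linear_vec_nth v])
  moreover have "(\<lambda>x. G x $ i $ j) \<in> L2 \<Omega>"
    by (rule L2_bounded_linear[OF bounded_linear_vec_nth L2_bounded_linear[OF bounded_linear_vec_nth G]])
  ultimately show "integrable (lebesgue_on \<Omega>) (\<lambda>x. v x $ j * partial_deriv i \<phi> x)" "integrable (lebesgue_on \<Omega>) (\<lambda>x. G x $ i $ j * \<phi> x)"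
    using L2_inner_integrable[where 'b = real] by (metis (no_types, lifting) inner_real_def Bochner_Integration.integrable_cong)+
qed

lemma has_weak_gradient_add:
  fixes v w :: "real^'n::finite \<Rightarrow> real^'n"
  assumes \<Omega>: "open \<Omega>" "bounded \<Omega>" and v: "v \<in> L2 \<Omega>" "G \<in> L2 \<Omega>" "has_weak_gradient \<Omega> v G"
    and w: "w \<in> L2 \<Omega>" "H \<in> L2 \<Omega>" "has_weak_gradient \<Omega> w H"
  shows "has_weak_gradient \<Omega> (\<lambda>x. v x + w x) (\<lambda>x. G x + H x)"
  unfolding has_weak_gradient_def
proof (intro allI impI)
  fix \<phi> :: "real^'n \<Rightarrow> real" and i j assume \<phi>: "\<phi> \<in> Cc_infinity \<Omega>"
  note i = has_weak_gradient_integrable[OF \<Omega> v(1,2) \<phi>] has_weak_gradient_integrable[OF \<Omega> w(1,2) \<phi>]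
  show "integral\<^sup>L (lebesgue_on \<Omega>) (\<lambda>x. (v x + w x) $ j * partial_deriv i \<phi> x) = - integral\<^sup>L (lebesgue_on \<Omega>) (\<lambda>x. (G x + H x) $ i $ j * \<phi> x)"
    using i v(3) w(3) \<phi> by (simp add: distrib_right has_weak_gradient_def)
qed

lemma has_weak_gradient_scaleR:
  assumes "has_weak_gradient \<Omega> v G"
  shows "has_weak_gradient \<Omega> (\<lambda>x. c *\<^sub>R v x) (\<lambda>x. c *\<^sub>R G x)"
  using assms by (simp add: has_weak_gradient_def mult.assoc)

text \<open>
  The choice in \<open>weak_grad\<close> becomes linear up to null sets by uniqueness, so the gradient of a difference
  of Sobolev fields is the difference of the chosen gradients.
\<close>

lemma has_weak_gradient_unique:
  fixes v :: "real^'n::finite \<Rightarrow> real^'n"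
  assumes \<Omega>: "open \<Omega>" "bounded \<Omega>" and v: "v \<in> L2 \<Omega>"
    and G: "G \<in> L2 \<Omega>" "has_weak_gradient \<Omega> v G" and H: "H \<in> L2 \<Omega>" "has_weak_gradient \<Omega> v H"
  shows "AE x in lebesgue_on \<Omega>. G x = H x"
proof -
  have D: "(\<lambda>x. G x - H x) \<in> L2 \<Omega>" by (rule L2_diff[OF G(1) H(1)])
  have one: "(\<lambda>x. 1 :: real) \<in> L2 \<Omega>" by (rule L2_continuous[OF _ \<Omega>]) simp
  have "AE x in lebesgue_on \<Omega>. (G x - H x) $ i $ j = 0" for i j
  proof (rule fundamental_lemma_calculus_of_variations[OF \<Omega>(1)])
    have "(\<lambda>x. (G x - H x) $ i $ j) \<in> L2 \<Omega>"
      by (rule L2_bounded_linear[OF bounded_linear_vec_nth L2_bounded_linear[OF bounded_linear_vec_nth D]])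
    from L2_inner_integrable[OF this one] show "integrable (lebesgue_on \<Omega>) (\<lambda>x. (G x - H x) $ i $ j)" by simp
    fix \<phi> :: "real^'n \<Rightarrow> real" assume \<phi>: "\<phi> \<in> Cc_infinity \<Omega>"
    note i = has_weak_gradient_integrable[OF \<Omega> v G(1) \<phi>] has_weak_gradient_integrable[OF \<Omega> v H(1) \<phi>]
    show "integral\<^sup>L (lebesgue_on \<Omega>) (\<lambda>x. (G x - H x) $ i $ j * \<phi> x) = 0"
      using i G(2) H(2) \<phi> by (simp add: left_diff_distrib has_weak_gradient_def)
  qed
  then have "AE x in lebesgue_on \<Omega>. \<forall>i\<in>UNIV. \<forall>j\<in>UNIV. (G x - H x) $ i $ j = 0"
    by (intro AE_finite_allI) auto
  then show ?thesis by eventually_elim (simp add: vec_eq_iff)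
qed

lemma hausdorff_outer_mono: "A \<subseteq> B \<Longrightarrow> hausdorff_outer s A \<le> hausdorff_outer s B"
  unfolding hausdorff_outer_def by (intro SUP_mono' INF_superset_mono) auto

text \<open>
  Interleave two coverings with small sums. Together with monotonicity this makes the boundary conditions
  linear.
\<close>

lemma hausdorff_null_Un:
  assumes A: "hausdorff_outer s A = 0" and B: "hausdorff_outer s B = 0"
  shows "hausdorff_outer s (A \<union> B) = 0"
proof -
  define w where "w C = (\<Sum>i. ennreal (unit_ball_vol (real s) * (diameter (C i) / 2) ^ s))" for C :: "nat \<Rightarrow> 'a set"
  define cov where "cov \<delta> A = {C :: nat \<Rightarrow> 'a set. A \<subseteq> (\<Union>i. C i) \<and> (\<forall>i. bounded (C i) \<and> diameter (C i) \<le> \<delta>)}" for \<delta> A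
  have H: "hausdorff_outer s A = (SUP \<delta>\<in>{0::real<..}. INF C\<in>cov \<delta> A. w C)" for A
    by (simp add: hausdorff_outer_def cov_def w_def)
  have "(INF C\<in>cov \<delta> (A \<union> B). w C) \<le> 0" if \<delta>: "0 < \<delta>" for \<delta>
  proof (rule ennreal_le_epsilon)
    fix \<epsilon> :: real assume \<epsilon>: "0 < \<epsilon>"
    have small: "\<exists>C\<in>cov \<delta> A. w C < ennreal (\<epsilon> / 2)" if "hausdorff_outer s A = 0" for A
    proof -
      have "(INF C\<in>cov \<delta> A. w C) \<le> hausdorff_outer s A" unfolding H by (rule SUP_upper) (use \<delta> in simp)
      then have "(INF C\<in>cov \<delta> A. w C) < ennreal (\<epsilon> / 2)" using that \<epsilon> by simp
      then show ?thesis by (simp add: INF_less_iff)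
    qed
    obtain C D where C: "C \<in> cov \<delta> A" "w C < ennreal (\<epsilon> / 2)" and D: "D \<in> cov \<delta> B" "w D < ennreal (\<epsilon> / 2)"
      using small[OF A] small[OF B] by blast
    define E where "E i = (if even i then C (i div 2) else D (i div 2))" for i
    have "E \<in> cov \<delta> (A \<union> B)"
    proof -
      have "C i \<subseteq> (\<Union>i. E i)" "D i \<subseteq> (\<Union>i. E i)" for i
        using UN_upper[of "2 * i" UNIV E] UN_upper[of "2 * i + 1" UNIV E] by (auto simp: E_def)
      then show ?thesis using C(1) D(1) unfolding cov_def by (auto simp: E_def subset_iff) blast+
    qed
    then have "(INF C\<in>cov \<delta> (A \<union> B). w C) \<le> w E" by (rule INF_lower)
    also have "w E = w C + w D"
    proof -
      let ?f = "\<lambda>S. ennreal (unit_ball_vol (real s) * (diameter S / 2) ^ s)"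
      have "w E = (\<integral>\<^sup>+i. ?f (E i) \<partial>count_space UNIV)" by (simp add: w_def nn_integral_count_space_nat)
      also have "\<dots> = (\<integral>\<^sup>+i. ?f (E i) * indicator {i. even i} i + ?f (E i) * indicator {i. odd i} i \<partial>count_space UNIV)"
        by (intro nn_integral_cong) (auto simp: indicator_def)
      also have "\<dots> = (\<integral>\<^sup>+i. ?f (E i) * indicator {i. even i} i \<partial>count_space UNIV) + (\<integral>\<^sup>+i. ?f (E i) * indicator {i. odd i} i \<partial>count_space UNIV)"
        by (rule nn_integral_add) auto
      also have "(\<integral>\<^sup>+i. ?f (E i) * indicator {i. even i} i \<partial>count_space UNIV) = (\<integral>\<^sup>+i. ?f (E i) \<partial>count_space {i. even i})"
        by (rule nn_integral_count_space_indicator[symmetric]) simp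
      also have "\<dots> = (\<integral>\<^sup>+i. ?f (E (2 * i)) \<partial>count_space UNIV)"
        by (rule nn_integral_bij_count_space[symmetric])
           (auto simp: bij_betw_def inj_on_def elim!: evenE)
      also have "(\<integral>\<^sup>+i. ?f (E i) * indicator {i. odd i} i \<partial>count_space UNIV) = (\<integral>\<^sup>+i. ?f (E i) \<partial>count_space {i. odd i})"
        by (rule nn_integral_count_space_indicator[symmetric]) simp
      also have "\<dots> = (\<integral>\<^sup>+i. ?f (E (2 * i + 1)) \<partial>count_space UNIV)"
        by (rule nn_integral_bij_count_space[symmetric])
           (auto simp: bij_betw_def inj_on_def image_iff elim!: oddE)
      finally show ?thesis by (simp add: w_def E_def nn_integral_count_space_nat)
    qed
    also have "\<dots> \<le> ennreal (\<epsilon> / 2) + ennreal (\<epsilon> / 2)" using C(2) D(2) by (intro add_mono) auto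
    also have "\<dots> = 0 + ennreal \<epsilon>" using \<epsilon> by (simp add: ennreal_plus[symmetric] del: ennreal_plus)
    finally show "(INF C\<in>cov \<delta> (A \<union> B). w C) \<le> 0 + ennreal \<epsilon>" .
  qed
  then have "hausdorff_outer s (A \<union> B) \<le> 0" unfolding H by (intro SUP_least) auto
  then show ?thesis by simp
qed

lemma hausdorff_outer_empty:
  assumes "0 < s"
  shows "hausdorff_outer s {} = 0"
proof -
  have "(INF C\<in>{C :: nat \<Rightarrow> 'a set. {} \<subseteq> (\<Union>i. C i) \<and> (\<forall>i. bounded (C i) \<and> diameter (C i) \<le> \<delta>)}.
      (\<Sum>i. ennreal (unit_ball_vol (real s) * (diameter (C i) / 2) ^ s))) \<le> 0" if "0 < \<delta>" for \<delta>
    by (rule INF_lower2[of "\<lambda>_. {}"]) (use that assms in \<open>auto simp: zero_power\<close>)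
  then have "hausdorff_outer s ({} :: 'a set) \<le> 0"
    unfolding hausdorff_outer_def by (intro SUP_least) auto
  then show ?thesis by simp
qed

lemma weak_grad_spec:
  assumes "v \<in> H1 \<Omega>"
  shows "v \<in> L2 \<Omega>" "weak_grad \<Omega> v \<in> L2 \<Omega>" "has_weak_gradient \<Omega> v (weak_grad \<Omega> v)"
proof -
  show "v \<in> L2 \<Omega>" using assms by (simp add: H1_def)
  have "\<exists>G. G \<in> L2 \<Omega> \<and> has_weak_gradient \<Omega> v G" using assms by (auto simp: H1_def)
  from someI_ex[OF this] show "weak_grad \<Omega> v \<in> L2 \<Omega>" "has_weak_gradient \<Omega> v (weak_grad \<Omega> v)"
    by (simp_all add: weak_grad_def)
qed

text \<open>
  The square of \<open>h1_norm\<close>, for which \<open>\<parallel>a + b\<parallel>\<^sup>2 \<le> 2 \<parallel>a\<parallel>\<^sup>2 + 2 \<parallel>b\<parallel>\<^sup>2\<close> serves as triangle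
  inequality; the constants do not matter.
\<close>

definition h1_square :: "(real^'n::finite) set \<Rightarrow> (real^'n \<Rightarrow> real^'n) \<Rightarrow> real" where
  "h1_square \<Omega> v = l2_square \<Omega> v + l2_square \<Omega> (weak_grad \<Omega> v)"

lemma h1_square_nonneg: "0 \<le> h1_square \<Omega> v"
  by (simp add: h1_square_def l2_inner_self_nonneg)

lemma h1_norm_eq: "h1_norm \<Omega> v = sqrt (h1_square \<Omega> v)"
  by (simp add: h1_norm_def h1_square_def l2_norm_def l2_inner_self_nonneg)

context
  fixes \<Omega> :: "(real^'n::finite) set"
  assumes \<Omega>: "open \<Omega>" "bounded \<Omega>"
begin

lemma weak_grad_unique:
  assumes "v \<in> L2 \<Omega>" "G \<in> L2 \<Omega>" "has_weak_gradient \<Omega> v G"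
  shows "v \<in> H1 \<Omega>" "AE x in lebesgue_on \<Omega>. weak_grad \<Omega> v x = G x"
    "h1_square \<Omega> v = l2_square \<Omega> v + l2_square \<Omega> G"
proof -
  show v: "v \<in> H1 \<Omega>" using assms by (auto simp: H1_def)
  show ae: "AE x in lebesgue_on \<Omega>. weak_grad \<Omega> v x = G x"
    using weak_grad_spec[OF v] assms by (intro has_weak_gradient_unique[OF \<Omega>, of v])
  show "h1_square \<Omega> v = l2_square \<Omega> v + l2_square \<Omega> G"
    using l2_inner_self_cong[OF ae weak_grad_spec(2)[OF v] assms(2)] by (simp add: h1_square_def)
qed

lemma H1_add:
  assumes v: "v \<in> H1 \<Omega>" and w: "w \<in> H1 \<Omega>"
  shows "(\<lambda>x. v x + w x) \<in> H1 \<Omega>" "h1_square \<Omega> (\<lambda>x. v x + w x) \<le> 2 * h1_square \<Omega> v + 2 * h1_square \<Omega> w"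
proof -
  note sv = weak_grad_spec[OF v] and sw = weak_grad_spec[OF w]
  note u = weak_grad_unique[OF L2_add[OF sv(1) sw(1)] L2_add[OF sv(2) sw(2)] has_weak_gradient_add[OF \<Omega> sv sw]]
  show "(\<lambda>x. v x + w x) \<in> H1 \<Omega>" by (rule u(1))
  show "h1_square \<Omega> (\<lambda>x. v x + w x) \<le> 2 * h1_square \<Omega> v + 2 * h1_square \<Omega> w"
    using add_mono[OF l2_inner_self_add_le[OF sv(1) sw(1)] l2_inner_self_add_le[OF sv(2) sw(2)]]
    unfolding u(3) h1_square_def[of \<Omega> v] h1_square_def[of \<Omega> w] by (simp add: distrib_left add_ac)
qed

lemma H1_scaleR:
  assumes v: "v \<in> H1 \<Omega>"
  shows "(\<lambda>x. c *\<^sub>R v x) \<in> H1 \<Omega>" "h1_square \<Omega> (\<lambda>x. c *\<^sub>R v x) = c\<^sup>2 * h1_square \<Omega> v"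
proof -
  note sv = weak_grad_spec[OF v]
  note u = weak_grad_unique[OF L2_scaleR[OF sv(1)] L2_scaleR[OF sv(2)] has_weak_gradient_scaleR[OF sv(3), of c]]
  show "(\<lambda>x. c *\<^sub>R v x) \<in> H1 \<Omega>" by (rule u(1))
  have sq: "l2_square \<Omega> (\<lambda>x. c *\<^sub>R f x) = c\<^sup>2 * l2_square \<Omega> f" for f :: "real^'n \<Rightarrow> 'b::euclidean_space"
    by (simp only: l2_inner_scaleR_left l2_inner_commute[of \<Omega> f "\<lambda>x. c *\<^sub>R f x"] power2_eq_square mult.assoc)
  show "h1_square \<Omega> (\<lambda>x. c *\<^sub>R v x) = c\<^sup>2 * h1_square \<Omega> v"
    unfolding u(3) h1_square_def[of \<Omega> v] sq by (simp add: distrib_left)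
qed

lemma H1_diff:
  assumes v: "v \<in> H1 \<Omega>" and w: "w \<in> H1 \<Omega>"
  shows "(\<lambda>x. v x - w x) \<in> H1 \<Omega>" "h1_square \<Omega> (\<lambda>x. v x - w x) = h1_square \<Omega> (\<lambda>x. w x - v x)"
proof -
  have d: "(\<lambda>x. v x - w x) \<in> H1 \<Omega>" if "v \<in> H1 \<Omega>" "w \<in> H1 \<Omega>" for v w
    using H1_add(1)[OF that(1) H1_scaleR(1)[OF that(2), of "-1"]] by simp
  show "(\<lambda>x. v x - w x) \<in> H1 \<Omega>" by (rule d[OF v w])
  show "h1_square \<Omega> (\<lambda>x. v x - w x) = h1_square \<Omega> (\<lambda>x. w x - v x)"
    using H1_scaleR(2)[OF d[OF w v], of "-1"] by simp
qed

lemma h1_square_triangle: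
  assumes "v \<in> H1 \<Omega>" "u \<in> H1 \<Omega>" "w \<in> H1 \<Omega>"
  shows "h1_square \<Omega> (\<lambda>x. v x - w x) \<le> 2 * h1_square \<Omega> (\<lambda>x. v x - u x) + 2 * h1_square \<Omega> (\<lambda>x. u x - w x)"
  using H1_add(2)[OF H1_diff(1)[OF assms(1,2)] H1_diff(1)[OF assms(2,3)]] by simp

lemma weak_grad_diff:
  assumes v: "v \<in> H1 \<Omega>" and w: "w \<in> L2 \<Omega>" "H \<in> L2 \<Omega>" "has_weak_gradient \<Omega> w H"
  shows "l2_square \<Omega> (\<lambda>x. weak_grad \<Omega> v x - H x) \<le> h1_square \<Omega> (\<lambda>x. v x - w x)"
proof -
  note sv = weak_grad_spec[OF v]
  have "has_weak_gradient \<Omega> (\<lambda>x. v x + (-1) *\<^sub>R w x) (\<lambda>x. weak_grad \<Omega> v x + (-1) *\<^sub>R H x)"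
    by (rule has_weak_gradient_add[OF \<Omega> sv L2_scaleR[OF w(1)] L2_scaleR[OF w(2)] has_weak_gradient_scaleR[OF w(3)]])
  then have "has_weak_gradient \<Omega> (\<lambda>x. v x - w x) (\<lambda>x. weak_grad \<Omega> v x - H x)" by simp
  from weak_grad_unique(3)[OF L2_diff[OF sv(1) w(1)] L2_diff[OF sv(2) w(2)] this] show ?thesis
    using l2_inner_self_nonneg[of \<Omega> "\<lambda>x. v x - w x"] by simp
qed

lemma has_gradient_H1:
  assumes "has_gradient v G"
  shows "v \<in> L2 \<Omega>" "G \<in> L2 \<Omega>" "has_weak_gradient \<Omega> v G" "v \<in> H1 \<Omega>"
    "h1_square \<Omega> v = l2_square \<Omega> v + l2_square \<Omega> G"
proof -
  show 1: "v \<in> L2 \<Omega>" "G \<in> L2 \<Omega>" "has_weak_gradient \<Omega> v G"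
    using assms has_gradient_continuous[OF assms] has_gradient_imp_has_weak_gradient[OF assms \<Omega>(1)] \<Omega>
    by (auto simp: has_gradient_def intro: L2_continuous)
  show "v \<in> H1 \<Omega>" "h1_square \<Omega> v = l2_square \<Omega> v + l2_square \<Omega> G" using weak_grad_unique[OF 1] by auto
qed

end

lemma Cc_infinity_add:
  assumes f: "f \<in> Cc_infinity UNIV" and g: "g \<in> Cc_infinity UNIV"
  shows "(\<lambda>x. f x + g x) \<in> Cc_infinity UNIV"
proof -
  have "supp (\<lambda>x. f x + g x) \<subseteq> supp f \<union> supp g"
    unfolding supp_def closure_Un[symmetric] by (rule closure_mono) auto
  moreover have "compact (supp f \<union> supp g)" using f g by (auto simp: Cc_infinity_def)
  ultimately have "compact (supp (\<lambda>x. f x + g x))"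
    by (metis supp_def closed_closure compact_Int_closed inf.absorb2 )
  then show ?thesis using f g by (auto simp: Cc_infinity_def C_infinity_def intro: C_k_add)
qed

lemma Cc_infinity_scaleR:
  assumes f: "f \<in> Cc_infinity UNIV"
  shows "(\<lambda>x. c *\<^sub>R f x) \<in> Cc_infinity UNIV"
proof -
  have "supp (\<lambda>x. c *\<^sub>R f x) \<subseteq> supp f"
    unfolding supp_def by (rule closure_mono) auto
  moreover have "compact (supp f)" using f by (auto simp: Cc_infinity_def)
  ultimately have "compact (supp (\<lambda>x. c *\<^sub>R f x))"
    by (metis supp_def closed_closure compact_Int_closed inf.absorb2)
  then show ?thesis using f by (auto simp: Cc_infinity_def C_infinity_def intro: C_k_bounded_linear[OF bounded_linear_scaleR_right])
qed

lemma surface_ae_add: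
  assumes "surface_ae S (\<lambda>x. P x)" "surface_ae S (\<lambda>x. Q x)" "\<And>x. P x \<Longrightarrow> Q x \<Longrightarrow> R x"
  shows "surface_ae (S :: (real^'n::finite) set) (\<lambda>x. R x)"
proof -
  have "{x \<in> S. \<not> R x} \<subseteq> {x \<in> S. \<not> P x} \<union> {x \<in> S. \<not> Q x}" using assms(3) by blast
  from hausdorff_outer_mono[OF this, of "CARD('n) - 1"] hausdorff_null_Un[OF assms(1,2)[unfolded surface_ae_def]]
  show ?thesis by (simp add: surface_ae_def)
qed

lemma smooth_tn_add:
  assumes "v \<in> smooth_tn \<Omega> \<Gamma>t \<Gamma>n" "w \<in> smooth_tn \<Omega> \<Gamma>t \<Gamma>n"
  shows "(\<lambda>x. v x + w x) \<in> smooth_tn \<Omega> \<Gamma>t \<Gamma>n"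
proof -
  have t: "tangential_part \<Omega> (\<lambda>x. v x + w x) x = tangential_part \<Omega> v x + tangential_part \<Omega> w x" for x
    by (simp add: tangential_part_def normal_part_def inner_add_right scaleR_add_left)
  have n: "normal_part \<Omega> (\<lambda>x. v x + w x) x = normal_part \<Omega> v x + normal_part \<Omega> w x" for x
    by (simp add: normal_part_def inner_add_right)
  show ?thesis
    using assms unfolding smooth_tn_def
  proof (intro CollectI conjI; elim CollectE conjE)
    assume v: "surface_ae \<Gamma>t (\<lambda>x. tangential_part \<Omega> v x = 0)" "surface_ae \<Gamma>n (\<lambda>x. normal_part \<Omega> v x = 0)"
      and w: "surface_ae \<Gamma>t (\<lambda>x. tangential_part \<Omega> w x = 0)" "surface_ae \<Gamma>n (\<lambda>x. normal_part \<Omega> w x = 0)"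
    show "surface_ae \<Gamma>t (\<lambda>x. tangential_part \<Omega> (\<lambda>x. v x + w x) x = 0)"
      by (rule surface_ae_add[OF v(1) w(1)]) (simp add: t)
    show "surface_ae \<Gamma>n (\<lambda>x. normal_part \<Omega> (\<lambda>x. v x + w x) x = 0)"
      by (rule surface_ae_add[OF v(2) w(2)]) (simp add: n)
  qed (rule Cc_infinity_add)
qed

lemma smooth_tn_scaleR:
  fixes \<Omega> :: "(real^'n::finite) set"
  assumes "v \<in> smooth_tn \<Omega> \<Gamma>t \<Gamma>n"
  shows "(\<lambda>x. c *\<^sub>R v x) \<in> smooth_tn \<Omega> \<Gamma>t \<Gamma>n"
proof -
  have t: "tangential_part \<Omega> (\<lambda>x. c *\<^sub>R v x) x = c *\<^sub>R tangential_part \<Omega> v x" for x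
    by (simp add: tangential_part_def normal_part_def scaleR_diff_right)
  have n: "normal_part \<Omega> (\<lambda>x. c *\<^sub>R v x) x = c * normal_part \<Omega> v x" for x
    by (simp add: normal_part_def)
  have mono: "surface_ae S Q" if "surface_ae S P" "\<And>x. P x \<Longrightarrow> Q x" for S :: "(real^'n) set" and P Q
    by (rule surface_ae_add[OF that(1) that(1)]) (rule that(2))
  show ?thesis
    using assms unfolding smooth_tn_def
    by (auto simp: t n intro: Cc_infinity_scaleR elim!: mono)
qed

lemma smooth_tn_zero:
  fixes \<Omega> :: "(real^'n::finite) set"
  assumes "2 \<le> CARD('n)"
  shows "(\<lambda>x. 0) \<in> smooth_tn \<Omega> \<Gamma>t \<Gamma>n"
proof -
  have "hausdorff_outer (CARD('n) - 1) ({} :: (real^'n) set) = 0" using assms by (intro hausdorff_outer_empty) simp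
  moreover have "(\<lambda>x::real^'n. 0 :: real^'n) \<in> Cc_infinity UNIV"
    by (auto simp: Cc_infinity_def C_infinity_def supp_def C_k_const)
  ultimately show ?thesis by (simp add: smooth_tn_def surface_ae_def tangential_part_def normal_part_def)
qed

context
  fixes \<Omega> :: "(real^'n::finite) set" and \<Gamma>t \<Gamma>n :: "(real^'n) set"
  assumes \<Omega>: "open \<Omega>" "bounded \<Omega>"
begin

lemma smooth_tn_H1: "w \<in> smooth_tn \<Omega> \<Gamma>t \<Gamma>n \<Longrightarrow> w \<in> H1 \<Omega>"
  by (rule has_gradient_H1(4)[OF \<Omega> C_infinity_has_gradient]) (simp add: smooth_tn_def Cc_infinity_def)

lemma H1_tn_iff:
  "v \<in> H1_tn \<Omega> \<Gamma>t \<Gamma>n \<longleftrightarrow> v \<in> H1 \<Omega> \<and> (\<forall>\<epsilon>>0. \<exists>w\<in>smooth_tn \<Omega> \<Gamma>t \<Gamma>n. h1_square \<Omega> (\<lambda>x. v x - w x) < \<epsilon>)"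
proof -
  have "(\<forall>\<epsilon>>0. \<exists>w\<in>smooth_tn \<Omega> \<Gamma>t \<Gamma>n. h1_norm \<Omega> (\<lambda>x. v x - w x) < \<epsilon>)
    \<longleftrightarrow> (\<forall>\<epsilon>>0. \<exists>w\<in>smooth_tn \<Omega> \<Gamma>t \<Gamma>n. h1_square \<Omega> (\<lambda>x. v x - w x) < \<epsilon>)" (is "?A \<longleftrightarrow> ?B")
  proof
    assume A: ?A
    show ?B
    proof (intro allI impI)
      fix \<epsilon> :: real assume "0 < \<epsilon>"
      then obtain w where w: "w \<in> smooth_tn \<Omega> \<Gamma>t \<Gamma>n" "h1_norm \<Omega> (\<lambda>x. v x - w x) < sqrt \<epsilon>"
        using A by (meson real_sqrt_gt_zero)
      then have "h1_square \<Omega> (\<lambda>x. v x - w x) < \<epsilon>" by (simp add: h1_norm_eq)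
      with w show "\<exists>w\<in>smooth_tn \<Omega> \<Gamma>t \<Gamma>n. h1_square \<Omega> (\<lambda>x. v x - w x) < \<epsilon>" by blast
    qed
  next
    assume B: ?B
    show ?A
    proof (intro allI impI)
      fix \<epsilon> :: real assume \<epsilon>: "0 < \<epsilon>"
      then obtain w where w: "w \<in> smooth_tn \<Omega> \<Gamma>t \<Gamma>n" "h1_square \<Omega> (\<lambda>x. v x - w x) < \<epsilon>\<^sup>2"
        using B by (meson zero_less_power)
      then have "h1_norm \<Omega> (\<lambda>x. v x - w x) < \<epsilon>" using \<epsilon> by (simp add: h1_norm_eq real_less_lsqrt real_sqrt_less_iff h1_square_nonneg)
      with w show "\<exists>w\<in>smooth_tn \<Omega> \<Gamma>t \<Gamma>n. h1_norm \<Omega> (\<lambda>x. v x - w x) < \<epsilon>" by blast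
    qed
  qed
  then show ?thesis by (auto simp: H1_tn_def)
qed

lemma H1_tn_H1: "v \<in> H1_tn \<Omega> \<Gamma>t \<Gamma>n \<Longrightarrow> v \<in> H1 \<Omega>"
  by (simp add: H1_tn_def)

lemma H1_tn_add:
  assumes v: "v \<in> H1_tn \<Omega> \<Gamma>t \<Gamma>n" and w: "w \<in> H1_tn \<Omega> \<Gamma>t \<Gamma>n"
  shows "(\<lambda>x. v x + w x) \<in> H1_tn \<Omega> \<Gamma>t \<Gamma>n"
  unfolding H1_tn_iff
proof (intro conjI allI impI)
  show "(\<lambda>x. v x + w x) \<in> H1 \<Omega>" by (rule H1_add(1)[OF \<Omega> H1_tn_H1[OF v] H1_tn_H1[OF w]])
  fix \<epsilon> :: real assume "0 < \<epsilon>"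
  then have "0 < \<epsilon> / 4" by simp
  then obtain a b where ab: "a \<in> smooth_tn \<Omega> \<Gamma>t \<Gamma>n" "b \<in> smooth_tn \<Omega> \<Gamma>t \<Gamma>n"
    "h1_square \<Omega> (\<lambda>x. v x - a x) < \<epsilon> / 4" "h1_square \<Omega> (\<lambda>x. w x - b x) < \<epsilon> / 4"
    using v w unfolding H1_tn_iff by meson
  have "h1_square \<Omega> (\<lambda>x. (v x - a x) + (w x - b x)) \<le> 2 * h1_square \<Omega> (\<lambda>x. v x - a x) + 2 * h1_square \<Omega> (\<lambda>x. w x - b x)"
    by (intro H1_add(2)[OF \<Omega>] H1_diff(1)[OF \<Omega>] smooth_tn_H1 H1_tn_H1 v w ab)
  then have "h1_square \<Omega> (\<lambda>x. (v x + w x) - (a x + b x)) < \<epsilon>" using ab(3,4) by (simp add: algebra_simps)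
  then show "\<exists>u\<in>smooth_tn \<Omega> \<Gamma>t \<Gamma>n. h1_square \<Omega> (\<lambda>x. (v x + w x) - u x) < \<epsilon>"
    by (rule bexI[of _ "\<lambda>x. a x + b x"]) (rule smooth_tn_add[OF ab(1,2)])
qed

lemma H1_tn_scaleR:
  assumes v: "v \<in> H1_tn \<Omega> \<Gamma>t \<Gamma>n"
  shows "(\<lambda>x. c *\<^sub>R v x) \<in> H1_tn \<Omega> \<Gamma>t \<Gamma>n"
  unfolding H1_tn_iff
proof (intro conjI allI impI)
  show "(\<lambda>x. c *\<^sub>R v x) \<in> H1 \<Omega>" by (rule H1_scaleR(1)[OF \<Omega> H1_tn_H1[OF v]])
  fix \<epsilon> :: real assume \<epsilon>: "0 < \<epsilon>"
  have c: "0 < c\<^sup>2 + 1" by (simp add: add_nonneg_pos)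
  then obtain a where a: "a \<in> smooth_tn \<Omega> \<Gamma>t \<Gamma>n" "h1_square \<Omega> (\<lambda>x. v x - a x) < \<epsilon> / (c\<^sup>2 + 1)"
    using v divide_pos_pos[OF \<epsilon> c] unfolding H1_tn_iff by blast
  have "h1_square \<Omega> (\<lambda>x. c *\<^sub>R (v x - a x)) = c\<^sup>2 * h1_square \<Omega> (\<lambda>x. v x - a x)"
    by (intro H1_scaleR(2)[OF \<Omega>] H1_diff(1)[OF \<Omega>] smooth_tn_H1 H1_tn_H1 v a)
  also have "\<dots> \<le> (c\<^sup>2 + 1) * h1_square \<Omega> (\<lambda>x. v x - a x)" by (intro mult_right_mono h1_square_nonneg) simp
  also have "\<dots> < \<epsilon>" using a(2) c by (simp add: field_simps)
  finally have "h1_square \<Omega> (\<lambda>x. c *\<^sub>R v x - c *\<^sub>R a x) < \<epsilon>" by (simp add: scaleR_diff_right)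
  then show "\<exists>u\<in>smooth_tn \<Omega> \<Gamma>t \<Gamma>n. h1_square \<Omega> (\<lambda>x. c *\<^sub>R v x - u x) < \<epsilon>"
    by (rule bexI[of _ "\<lambda>x. c *\<^sub>R a x"]) (rule smooth_tn_scaleR[OF a(1)])
qed

lemma H1_tn_closed:
  assumes v: "v \<in> H1 \<Omega>" and ap: "\<And>\<epsilon>. 0 < \<epsilon> \<Longrightarrow> \<exists>u\<in>H1_tn \<Omega> \<Gamma>t \<Gamma>n. h1_square \<Omega> (\<lambda>x. v x - u x) < \<epsilon>"
  shows "v \<in> H1_tn \<Omega> \<Gamma>t \<Gamma>n"
  unfolding H1_tn_iff
proof (intro conjI allI impI v)
  fix \<epsilon> :: real assume "0 < \<epsilon>"
  then have e: "0 < \<epsilon> / 4" by simp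
  obtain u where u: "u \<in> H1_tn \<Omega> \<Gamma>t \<Gamma>n" "h1_square \<Omega> (\<lambda>x. v x - u x) < \<epsilon> / 4" using ap[OF e] by blast
  obtain w where w: "w \<in> smooth_tn \<Omega> \<Gamma>t \<Gamma>n" "h1_square \<Omega> (\<lambda>x. u x - w x) < \<epsilon> / 4" using u(1) e unfolding H1_tn_iff by blast
  have "h1_square \<Omega> (\<lambda>x. v x - w x) \<le> 2 * h1_square \<Omega> (\<lambda>x. v x - u x) + 2 * h1_square \<Omega> (\<lambda>x. u x - w x)"
    by (intro h1_square_triangle[OF \<Omega>] v smooth_tn_H1 H1_tn_H1 u w)
  then have "h1_square \<Omega> (\<lambda>x. v x - w x) < \<epsilon>" using u(2) w(2) by simp
  then show "\<exists>w\<in>smooth_tn \<Omega> \<Gamma>t \<Gamma>n. h1_square \<Omega> (\<lambda>x. v x - w x) < \<epsilon>" using w(1) by blast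
qed

lemma H1_tn_zero:
  assumes "2 \<le> CARD('n)"
  shows "(\<lambda>x. 0) \<in> H1_tn \<Omega> \<Gamma>t \<Gamma>n"
proof -
  note s = smooth_tn_zero[OF assms, of \<Omega> \<Gamma>t \<Gamma>n]
  have "h1_square \<Omega> (\<lambda>x. 0 - (0::real^'n)) = 0" using H1_scaleR(2)[OF \<Omega> smooth_tn_H1[OF s], of 0] by simp
  then show ?thesis unfolding H1_tn_iff using s smooth_tn_H1[OF s] by (auto intro!: bexI[of _ "\<lambda>x. 0"])
qed

end

section \<open>Rigid motions and boundary conditions\<close>

definition affine_field :: "(real^'n::finite) \<times> (real^'n^'n) \<Rightarrow> real^'n \<Rightarrow> real^'n" where
  "affine_field p = (\<lambda>x. fst p + x v* snd p)"

lemma affine_field_add: "affine_field (p + q) = (\<lambda>x. affine_field p x + affine_field q x)"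
  by (simp add: affine_field_def fun_eq_iff vector_matrix_mult_add_rdistrib)

lemma affine_field_scaleR: "affine_field (c *\<^sub>R p) = (\<lambda>x. c *\<^sub>R affine_field p x)"
  by (simp add: affine_field_def fun_eq_iff vector_scaleR_matrix_ac scaleR_add_right)

lemma affine_field_diff: "affine_field (p - q) = (\<lambda>x. affine_field p x - affine_field q x)"
  by (simp add: affine_field_def fun_eq_iff vector_matrix_mult_diff_rdistrib)

lemma affine_field_zero: "affine_field 0 = (\<lambda>x. 0)"
  by (simp add: affine_field_def fun_eq_iff)

lemma has_gradient_affine_field: "has_gradient (affine_field p) (\<lambda>x. snd p)"
  unfolding affine_field_def by (rule has_gradient_affine)

text \<open>
  Rigid motions are represented by their coefficients, which puts the compactness argument below
  into a Euclidean space.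
\<close>

definition rigid_params :: "((real^'n::finite) \<times> (real^'n^'n)) set" where
  "rigid_params = {p. sym_part (snd p) = 0}"

definition admissible_rigid :: "(real^'n::finite) set \<Rightarrow> (real^'n) set \<Rightarrow> (real^'n) set \<Rightarrow> ((real^'n) \<times> (real^'n^'n)) set" where
  "admissible_rigid \<Omega> \<Gamma>t \<Gamma>n = {p \<in> rigid_params. affine_field p \<in> H1_tn \<Omega> \<Gamma>t \<Gamma>n}"

lemma subspace_rigid_params: "subspace rigid_params"
  by (rule subspaceI) (auto simp: rigid_params_def sym_part_add sym_part_scaleR linear_0[OF linear_sym_part])

lemma h1_square_affine_field_le:
  fixes \<Omega> :: "(real^'n::finite) set"
  assumes \<Omega>: "open \<Omega>" "bounded \<Omega>"
  shows "\<exists>B>0. \<forall>p. h1_square \<Omega> (affine_field p) \<le> B * (norm p)\<^sup>2"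
proof -
  obtain R where R: "0 < R" "\<And>x. x \<in> \<Omega> \<Longrightarrow> norm x \<le> R" using \<Omega>(2) by (auto simp: bounded_pos)
  define I where "I = l2_inner \<Omega> (\<lambda>x. 1 :: real) (\<lambda>x. 1)"
  have I: "0 \<le> I" by (simp add: I_def l2_inner_self_nonneg)
  have bound: "l2_square \<Omega> f \<le> (1 + R)\<^sup>2 * I * (norm p)\<^sup>2"
    if f: "continuous_on UNIV f" and le: "\<And>x. x \<in> \<Omega> \<Longrightarrow> norm (f x) \<le> (1 + R) * norm p"
    for f :: "real^'n \<Rightarrow> 'b::euclidean_space" and p :: "(real^'n) \<times> (real^'n^'n)"
  proof -
    have L: "f \<in> L2 \<Omega>" "(\<lambda>x. (1 + R) * norm p) \<in> L2 \<Omega>" by (intro L2_continuous f \<Omega> continuous_intros)+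
    have "l2_square \<Omega> f \<le> l2_square \<Omega> (\<lambda>x. (1 + R) * norm p)"
      unfolding l2_inner_def
    proof (intro integral_mono L2_inner_integrable L)
      fix x assume "x \<in> space (lebesgue_on \<Omega>)"
      then have "norm (f x) \<le> (1 + R) * norm p" by (intro le) simp
      from power_mono[OF this norm_ge_zero, of 2]
      show "f x \<bullet> f x \<le> ((1 + R) * norm p) \<bullet> ((1 + R) * norm p)"
        by (simp only: power2_norm_eq_inner inner_real_def power2_eq_square[of "(1 + R) * norm p"])
    qed
    also have "\<dots> = ((1 + R) * norm p)\<^sup>2 * I"
      unfolding l2_inner_def I_def by (simp add: power2_eq_square)
    finally show ?thesis by (simp add: power_mult_distrib mult_ac)
  qed
  have np: "norm (fst p) \<le> norm p" "norm (snd p) \<le> norm p" for p :: "(real^'n) \<times> (real^'n^'n)"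
    by (metis prod.collapse norm_fst_le, metis prod.collapse norm_snd_le)
  have 1: "l2_square \<Omega> (affine_field p) \<le> (1 + R)\<^sup>2 * I * (norm p)\<^sup>2" for p
  proof (rule bound[OF has_gradient_continuous[OF has_gradient_affine_field]])
    fix x assume x: "x \<in> \<Omega>"
    have "norm (affine_field p x) \<le> norm (fst p) + norm (x v* snd p)" unfolding affine_field_def by (rule norm_triangle_ineq)
    also have "norm (x v* snd p) \<le> R * norm p"
      by (rule order_trans[OF norm_vector_matrix_mult_le]) (use mult_mono[OF R(2)[OF x] np(2)[of p]] R(1) in simp)
    finally show "norm (affine_field p x) \<le> (1 + R) * norm p" using np(1)[of p] by (simp add: distrib_right)
  qed
  have 2: "l2_square \<Omega> (\<lambda>x. snd p) \<le> (1 + R)\<^sup>2 * I * (norm p)\<^sup>2" for p :: "(real^'n) \<times> (real^'n^'n)"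
  proof (rule bound)
    fix x
    have "norm (snd p) \<le> 1 * norm p" using np by simp
    also have "\<dots> \<le> (1 + R) * norm p" using R by (intro mult_right_mono) auto
    finally show "norm (snd p) \<le> (1 + R) * norm p" .
  qed simp
  show ?thesis
  proof (intro exI[of _ "2 * ((1 + R)\<^sup>2 * I) + 1"] conjI allI)
    show "0 < 2 * ((1 + R)\<^sup>2 * I) + 1" using I by (intro add_nonneg_pos) auto
    fix p
    show "h1_square \<Omega> (affine_field p) \<le> (2 * ((1 + R)\<^sup>2 * I) + 1) * (norm p)\<^sup>2"
    proof -
      have "(2 * ((1 + R)\<^sup>2 * I) + 1) * (norm p)\<^sup>2 = 2 * ((1 + R)\<^sup>2 * I * (norm p)\<^sup>2) + (norm p)\<^sup>2"
        by (simp add: algebra_simps)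
      then show ?thesis
        using 1[of p] 2[of p] zero_le_power2[of "norm p"]
        unfolding has_gradient_H1(5)[OF \<Omega> has_gradient_affine_field] by linarith
    qed
  qed
qed

context
  fixes \<Omega> :: "(real^'n::finite) set" and \<Gamma>t \<Gamma>n :: "(real^'n) set"
  assumes card: "2 \<le> CARD('n)" and \<Omega>: "open \<Omega>" "bounded \<Omega>"
begin

private abbreviation "V \<equiv> H1_tn \<Omega> \<Gamma>t \<Gamma>n"
private abbreviation "A \<equiv> admissible_rigid \<Omega> \<Gamma>t \<Gamma>n"
private abbreviation "K \<equiv> rigid_gradients \<Omega> \<Gamma>t \<Gamma>n"

lemma affine_field_H1: "affine_field p \<in> H1 \<Omega>"
  by (rule has_gradient_H1(4)[OF \<Omega> has_gradient_affine_field])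

lemma subspace_admissible_rigid: "subspace (A)"
proof (rule subspaceI)
  show "0 \<in> A"
    using subspace_0[OF subspace_rigid_params[where 'a = 'n]] H1_tn_zero[OF \<Omega> card] by (simp add: admissible_rigid_def affine_field_zero)
  show "x + y \<in> A" if "x \<in> A" "y \<in> A" for x y
    using that subspace_add[OF subspace_rigid_params[where 'a = 'n]] H1_tn_add[OF \<Omega>] by (simp add: admissible_rigid_def affine_field_add)
  show "c *\<^sub>R x \<in> A" if "x \<in> A" for c x
    using that subspace_scale[OF subspace_rigid_params[where 'a = 'n]] H1_tn_scaleR[OF \<Omega>] by (simp add: admissible_rigid_def affine_field_scaleR)
qed

text \<open>
  Otherwise unit vectors \<open>q k\<close> orthogonal to the admissible rigid motions come arbitrarily close to \<open>V\<close>. A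
  limit of a subsequence lies in \<open>V\<close>, because \<open>V\<close> is closed, hence is admissible and orthogonal
  to itself.
\<close>

lemma rigid_coercive:
  defines "W \<equiv> {p \<in> rigid_params. \<forall>q\<in>A. orthogonal q p}"
  shows "\<exists>m>0. \<forall>p\<in>W. \<forall>v\<in>V. m * (norm p)\<^sup>2 \<le> h1_square \<Omega> (\<lambda>x. affine_field p x - v x)"
proof (rule ccontr)
  assume neg: "\<not> ?thesis"
  obtain B where B: "0 < B" "\<And>p. h1_square \<Omega> (affine_field p) \<le> B * (norm p)\<^sup>2" using h1_square_affine_field_le[OF \<Omega>] by blast
  have W: "subspace W"
    unfolding W_def using subspace_rigid_params[where 'a = 'n]
    by (intro subspaceI) (simp_all add: subspace_0 subspace_add subspace_scale orthogonal_def inner_add_right)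
  have "\<exists>q v. q \<in> W \<and> norm q = 1 \<and> v \<in> V \<and> h1_square \<Omega> (\<lambda>x. affine_field q x - v x) < 1 / real (Suc k)" for k
  proof -
    have "\<not> (\<forall>p\<in>W. \<forall>v\<in>V. 1 / real (Suc k) * (norm p)\<^sup>2 \<le> h1_square \<Omega> (\<lambda>x. affine_field p x - v x))"
    proof
      assume "\<forall>p\<in>W. \<forall>v\<in>V. 1 / real (Suc k) * (norm p)\<^sup>2 \<le> h1_square \<Omega> (\<lambda>x. affine_field p x - v x)"
      moreover have "0 < 1 / real (Suc k)" by simp
      ultimately show False using neg by blast
    qed
    then obtain p v where p: "p \<in> W" "v \<in> V"
      and lt: "h1_square \<Omega> (\<lambda>x. affine_field p x - v x) < 1 / real (Suc k) * (norm p)\<^sup>2" by (auto simp: not_le)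
    have p0: "p \<noteq> 0" using lt h1_square_nonneg[of \<Omega> "\<lambda>x. affine_field p x - v x"] by auto
    define c where "c = 1 / norm p"
    have "h1_square \<Omega> (\<lambda>x. c *\<^sub>R (affine_field p x - v x)) = c\<^sup>2 * h1_square \<Omega> (\<lambda>x. affine_field p x - v x)"
      by (intro H1_scaleR(2)[OF \<Omega>] H1_diff(1)[OF \<Omega>] affine_field_H1 H1_tn_H1[OF \<Omega> p(2)])
    also have "\<dots> < c\<^sup>2 * (1 / real (Suc k) * (norm p)\<^sup>2)" using lt p0 by (intro mult_strict_left_mono) (auto simp: c_def)
    also have "\<dots> = 1 / real (Suc k)" using p0 by (simp add: c_def power_divide)
    finally have "h1_square \<Omega> (\<lambda>x. affine_field (c *\<^sub>R p) x - c *\<^sub>R v x) < 1 / real (Suc k)"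
      by (simp add: affine_field_scaleR scaleR_diff_right)
    moreover have "c *\<^sub>R p \<in> W" "norm (c *\<^sub>R p) = 1" using subspace_scale[OF W p(1)] p0 by (auto simp: c_def)
    ultimately show ?thesis using H1_tn_scaleR[OF \<Omega> p(2), of c] by blast
  qed
  then have "\<forall>k. \<exists>q v. q \<in> W \<and> norm q = 1 \<and> v \<in> V \<and> h1_square \<Omega> (\<lambda>x. affine_field q x - v x) < 1 / real (Suc k)" by blast
  from choice[OF this] obtain q where
    "\<forall>k. \<exists>v. q k \<in> W \<and> norm (q k) = 1 \<and> v \<in> V \<and> h1_square \<Omega> (\<lambda>x. affine_field (q k) x - v x) < 1 / real (Suc k)" by blast
  from choice[OF this] obtain v where
    "\<forall>k. q k \<in> W \<and> norm (q k) = 1 \<and> v k \<in> V \<and> h1_square \<Omega> (\<lambda>x. affine_field (q k) x - v k x) < 1 / real (Suc k)" by blast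
  then have q: "q k \<in> W" "norm (q k) = 1" "v k \<in> V"
    and lt: "h1_square \<Omega> (\<lambda>x. affine_field (q k) x - v k x) < 1 / real (Suc k)" for k by blast+
  have cpt: "compact (W \<inter> sphere 0 1)" by (intro closed_Int_compact closed_subspace W) simp
  have "\<forall>k. q k \<in> W \<inter> sphere 0 1" using q by simp
  from seq_compactE[OF compact_imp_seq_compact[OF cpt] this]
  obtain a s where a: "a \<in> W \<inter> sphere 0 1" "strict_mono s" "(q \<circ> s) \<longlonglongrightarrow> a" by blast
  have "affine_field a \<in> V"
  proof (rule H1_tn_closed[OF \<Omega> affine_field_H1])
    fix \<epsilon> :: real assume "0 < \<epsilon>"
    have "(\<lambda>k. 2 * (B * (norm (a - q (s k)))\<^sup>2) + 2 * (1 / real (Suc (s k)))) \<longlonglongrightarrow> 2 * (B * (norm (a - a))\<^sup>2) + 2 * 0"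
      using a(3) LIMSEQ_subseq_LIMSEQ[OF LIMSEQ_Suc[OF lim_1_over_n] a(2)]
      by (intro tendsto_intros) (simp_all add: o_def)
    then have "\<forall>\<^sub>F k in sequentially. 2 * (B * (norm (a - q (s k)))\<^sup>2) + 2 * (1 / real (Suc (s k))) < \<epsilon>"
      using \<open>0 < \<epsilon>\<close> by (intro order_tendstoD(2)) auto
    then obtain k where k: "2 * (B * (norm (a - q (s k)))\<^sup>2) + 2 * (1 / real (Suc (s k))) < \<epsilon>"
      by (auto simp: eventually_sequentially)
    have "h1_square \<Omega> (\<lambda>x. affine_field a x - v (s k) x)
      \<le> 2 * h1_square \<Omega> (\<lambda>x. affine_field a x - affine_field (q (s k)) x) + 2 * h1_square \<Omega> (\<lambda>x. affine_field (q (s k)) x - v (s k) x)"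
      by (intro h1_square_triangle[OF \<Omega>] affine_field_H1 H1_tn_H1[OF \<Omega> q(3)])
    also have "\<dots> < \<epsilon>" using k B(2)[of "a - q (s k)"] lt[of "s k"] by (simp add: affine_field_diff)
    finally show "\<exists>u\<in>V. h1_square \<Omega> (\<lambda>x. affine_field a x - u x) < \<epsilon>" using q(3) by blast
  qed
  then have "a \<in> A" using a(1) by (simp add: admissible_rigid_def W_def)
  then have "orthogonal a a" using a(1) by (simp add: W_def)
  then show False using a(1) by (simp add: orthogonal_def)
qed

text \<open>
  Split the coefficients of \<open>p\<close> into an admissible part, which may be moved into \<open>v\<close>, and a part orthogonal to
  the admissible ones, to which \<open>rigid_coercive\<close> applies.
\<close>

lemma rigid_distance:
  "\<exists>M\<ge>0. \<forall>p\<in>rigid_params. \<forall>v\<in>V. \<exists>p0\<in>A.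
    h1_square \<Omega> (\<lambda>x. affine_field p x - affine_field p0 x) \<le> M * h1_square \<Omega> (\<lambda>x. affine_field p x - v x)"
proof -
  obtain B where B: "0 < B" "\<And>p. h1_square \<Omega> (affine_field p) \<le> B * (norm p)\<^sup>2" using h1_square_affine_field_le[OF \<Omega>] by blast
  obtain m where m: "0 < m" and coercive: "\<And>p v. p \<in> rigid_params \<Longrightarrow> \<forall>q\<in>A. orthogonal q p \<Longrightarrow> v \<in> V \<Longrightarrow>
    m * (norm p)\<^sup>2 \<le> h1_square \<Omega> (\<lambda>x. affine_field p x - v x)"
    using rigid_coercive by blast
  show ?thesis
  proof (intro exI[of _ "B / m"] conjI ballI)
    show "0 \<le> B / m" using B m by simp
    fix p :: "(real^'n) \<times> (real^'n^'n)" and v assume p: "p \<in> rigid_params" and v: "v \<in> V"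
    have span: "span (A) = A"
      using subspace_admissible_rigid by (simp add: span_eq_iff)
    obtain y z where y: "y \<in> A" and z: "\<And>w. w \<in> A \<Longrightarrow> orthogonal z w" and p_eq: "p = y + z"
      using orthogonal_subspace_decomp_exists[of "A" p] unfolding span by blast
    have yt: "affine_field y \<in> V" "y \<in> rigid_params" using y by (auto simp: admissible_rigid_def)
    have "z = p - y" using p_eq by simp
    then have zr: "z \<in> rigid_params" using subspace_diff[OF subspace_rigid_params[where 'a = 'n] p yt(2)] by simp
    have zo: "\<forall>q\<in>A. orthogonal q z" using z by (auto simp: orthogonal_commute)
    have vy: "(\<lambda>x. v x + (-1) *\<^sub>R affine_field y x) \<in> V"
      by (rule H1_tn_add[OF \<Omega> v H1_tn_scaleR[OF \<Omega> yt(1)]])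
    have "h1_square \<Omega> (\<lambda>x. affine_field p x - affine_field y x) = h1_square \<Omega> (affine_field z)"
      by (simp add: \<open>z = p - y\<close> affine_field_diff)
    also have "\<dots> \<le> B * (norm z)\<^sup>2" by (rule B(2))
    also have "\<dots> = B / m * (m * (norm z)\<^sup>2)" using m by simp
    also have "\<dots> \<le> B / m * h1_square \<Omega> (\<lambda>x. affine_field z x - (v x + (-1) *\<^sub>R affine_field y x))"
      using B m by (intro mult_left_mono coercive zr zo vy) auto
    also have "(\<lambda>x. affine_field z x - (v x + (-1) *\<^sub>R affine_field y x)) = (\<lambda>x. affine_field p x - v x)"
      by (simp add: p_eq affine_field_add fun_eq_iff algebra_simps)
    finally show "\<exists>p0\<in>A. h1_square \<Omega> (\<lambda>x. affine_field p x - affine_field p0 x) \<le> B / m * h1_square \<Omega> (\<lambda>x. affine_field p x - v x)"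
      using y by blast
  qed
qed

text \<open>
  Approximate \<open>v\<close> by a smooth \<open>w\<close> in the defining space, choose a rigid motion \<open>p\<close> for \<open>w\<close>, and
  replace it by an admissible one; \<open>p\<close> is close to \<open>V\<close> because \<open>v\<close> lies in \<open>V\<close>.
\<close>

lemma korn_modulo_admissible:
  assumes conn: "connected \<Omega>" "\<Omega> \<noteq> {}" and lip: "strong_lipschitz_boundary \<Omega>"
  shows "\<exists>M\<ge>0. \<forall>v\<in>V. \<forall>\<epsilon>>0. \<exists>p\<in>A.
    l2_square \<Omega> (\<lambda>x. weak_grad \<Omega> v x - snd p)
    \<le> M * (l2_square \<Omega> (\<lambda>x. sym_part (weak_grad \<Omega> v x)) + \<epsilon>)"
proof -
  obtain C0 where C0: "C0 < top" and korn0: "\<And>v G. has_gradient v G \<Longrightarrow> \<exists>b S. sym_part S = 0 \<and>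
    energy \<Omega> (\<lambda>x. v x - (b + x v* S)) + energy \<Omega> (\<lambda>x. G x - S) \<le> C0 * energy \<Omega> (\<lambda>x. sym_part (G x))"
    using korn_modulo_rigid[OF \<Omega>(1) conn \<Omega>(2) lip] by blast
  define C where "C = enn2real C0"
  have C: "0 \<le> C" "C0 = ennreal C" using C0 by (auto simp: C_def)
  have korn: "\<exists>p\<in>rigid_params. h1_square \<Omega> (\<lambda>x. v x - affine_field p x) \<le> C * l2_square \<Omega> (\<lambda>x. sym_part (G x))"
    if v: "has_gradient v G" for v G
  proof -
    from korn0[OF v] obtain b S where S: "sym_part S = 0" and le: "energy \<Omega> (\<lambda>x. v x - (b + x v* S)) + energy \<Omega> (\<lambda>x. G x - S) \<le> C0 * energy \<Omega> (\<lambda>x. sym_part (G x))" by blast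
    note w = has_gradient_diff[OF v has_gradient_affine, of b S]
    have cw: "continuous_on UNIV (\<lambda>x. v x - (b + x v* S))" "continuous_on UNIV (\<lambda>x. G x - S)"
      using has_gradient_continuous[OF w] w by (auto simp: has_gradient_def)
    have "ennreal (l2_square \<Omega> (\<lambda>x. v x - (b + x v* S)) + l2_square \<Omega> (\<lambda>x. G x - S))
      \<le> ennreal (C * l2_square \<Omega> (\<lambda>x. sym_part (G x)))"
      using le C unfolding energy_eq_l2_inner[OF cw(1) \<Omega>] energy_eq_l2_inner[OF cw(2) \<Omega>] energy_eq_l2_inner[OF continuous_on_sym_part_gradient[OF v] \<Omega>]
      by (simp add: ennreal_mult l2_inner_self_nonneg)
    then have "l2_square \<Omega> (\<lambda>x. v x - (b + x v* S)) + l2_square \<Omega> (\<lambda>x. G x - S)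
      \<le> C * l2_square \<Omega> (\<lambda>x. sym_part (G x))"
      by (subst (asm) ennreal_le_iff) (use C in \<open>auto simp: l2_inner_self_nonneg\<close>)
    then show ?thesis
      using S has_gradient_H1(5)[OF \<Omega> w] by (intro bexI[of _ "(b, S)"]) (auto simp: rigid_params_def affine_field_def)
  qed
  obtain M1 where M1: "0 \<le> M1" and dist: "\<And>p v. p \<in> rigid_params \<Longrightarrow> v \<in> V \<Longrightarrow> \<exists>p0\<in>A.
    h1_square \<Omega> (\<lambda>x. affine_field p x - affine_field p0 x) \<le> M1 * h1_square \<Omega> (\<lambda>x. affine_field p x - v x)"
    using rigid_distance by blast
  show ?thesis
  proof (intro exI[of _ "2 * (1 + M1) * (2 + 4 * C)"] conjI ballI allI impI)
    show "0 \<le> 2 * (1 + M1) * (2 + 4 * C)" using M1 C by simp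
    fix v and \<epsilon> :: real assume v: "v \<in> V" and \<epsilon>: "0 < \<epsilon>"
    have vH: "v \<in> H1 \<Omega>" by (rule H1_tn_H1[OF \<Omega> v])
    note sv = weak_grad_spec[OF vH]
    define \<sigma> where "\<sigma> = l2_square \<Omega> (\<lambda>x. sym_part (weak_grad \<Omega> v x))"
    obtain w where w: "w \<in> smooth_tn \<Omega> \<Gamma>t \<Gamma>n" "h1_square \<Omega> (\<lambda>x. v x - w x) < \<epsilon>"
      using v \<epsilon> unfolding H1_tn_iff[OF \<Omega>] by blast
    obtain G where G: "has_gradient w G" using C_infinity_has_gradient[of w] w(1) by (auto simp: smooth_tn_def Cc_infinity_def)
    note sw = has_gradient_H1[OF \<Omega> G]
    obtain p where p: "p \<in> rigid_params" "h1_square \<Omega> (\<lambda>x. w x - affine_field p x) \<le> C * l2_square \<Omega> (\<lambda>x. sym_part (G x))"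
      using korn[OF G] by blast
    obtain p0 where p0: "p0 \<in> A"
      "h1_square \<Omega> (\<lambda>x. affine_field p x - affine_field p0 x) \<le> M1 * h1_square \<Omega> (\<lambda>x. affine_field p x - v x)"
      using dist[OF p(1) v] by blast
    have "l2_square \<Omega> (\<lambda>x. sym_part (G x)) \<le> 2 * \<sigma> + 2 * \<epsilon>"
    proof -
      have D: "(\<lambda>x. (-1) *\<^sub>R (weak_grad \<Omega> v x - G x)) \<in> L2 \<Omega>" by (intro L2_scaleR L2_diff sv sw)
      have L: "(\<lambda>x. sym_part (weak_grad \<Omega> v x)) \<in> L2 \<Omega>" "(\<lambda>x. sym_part ((-1) *\<^sub>R (weak_grad \<Omega> v x - G x))) \<in> L2 \<Omega>"
        using L2_bounded_linear[OF bounded_linear_sym_part] sv(2) D by auto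
      have eq: "(\<lambda>x. sym_part (G x)) = (\<lambda>x. sym_part (weak_grad \<Omega> v x) + sym_part ((-1) *\<^sub>R (weak_grad \<Omega> v x - G x)))"
        by (simp add: sym_part_diff fun_eq_iff sym_part_scaleR)
      have "l2_square \<Omega> (\<lambda>x. sym_part (G x)) \<le> 2 * \<sigma> + 2 * l2_square \<Omega> (\<lambda>x. sym_part ((-1) *\<^sub>R (weak_grad \<Omega> v x - G x)))"
        unfolding eq \<sigma>_def by (rule l2_inner_self_add_le[OF L])
      moreover have "l2_square \<Omega> (\<lambda>x. sym_part ((-1) *\<^sub>R (weak_grad \<Omega> v x - G x)))
        \<le> l2_square \<Omega> (\<lambda>x. (-1) *\<^sub>R (weak_grad \<Omega> v x - G x))"
        by (rule l2_inner_self_mono[OF L(2) D norm_sym_part_le])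
      moreover have "l2_square \<Omega> (\<lambda>x. (-1) *\<^sub>R (weak_grad \<Omega> v x - G x))
        = l2_square \<Omega> (\<lambda>x. weak_grad \<Omega> v x - G x)"
        unfolding l2_inner_def by (simp only: inner_scaleR_left inner_scaleR_right) simp
      moreover have "l2_square \<Omega> (\<lambda>x. weak_grad \<Omega> v x - G x) \<le> h1_square \<Omega> (\<lambda>x. v x - w x)"
        by (rule weak_grad_diff[OF \<Omega> vH sw(1,2,3)])
      ultimately show ?thesis using w(2) by linarith
    qed
    from mult_left_mono[OF this C(1)] p(2)
    have wp: "h1_square \<Omega> (\<lambda>x. w x - affine_field p x) \<le> C * (2 * \<sigma> + 2 * \<epsilon>)" by linarith
    have "h1_square \<Omega> (\<lambda>x. v x - affine_field p x) \<le> 2 * h1_square \<Omega> (\<lambda>x. v x - w x) + 2 * h1_square \<Omega> (\<lambda>x. w x - affine_field p x)"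
      by (rule h1_square_triangle[OF \<Omega> vH sw(4) affine_field_H1])
    also have "\<dots> \<le> 2 * \<epsilon> + 2 * (C * (2 * \<sigma> + 2 * \<epsilon>))" using w(2) wp by linarith
    also have "\<dots> \<le> 2 * (\<sigma> + \<epsilon>) + 2 * (C * (2 * \<sigma> + 2 * \<epsilon>))" by (simp add: \<sigma>_def l2_inner_self_nonneg)
    also have "\<dots> = (2 + 4 * C) * (\<sigma> + \<epsilon>)" by (simp add: algebra_simps)
    finally have vp: "h1_square \<Omega> (\<lambda>x. v x - affine_field p x) \<le> (2 + 4 * C) * (\<sigma> + \<epsilon>)" .
    have p0H: "affine_field p0 \<in> H1 \<Omega>" by (rule affine_field_H1)
    have "l2_square \<Omega> (\<lambda>x. weak_grad \<Omega> v x - snd p0) \<le> h1_square \<Omega> (\<lambda>x. v x - affine_field p0 x)"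
      by (rule weak_grad_diff[OF \<Omega> vH has_gradient_H1(1,2,3)[OF \<Omega> has_gradient_affine_field]])
    also have "\<dots> \<le> 2 * h1_square \<Omega> (\<lambda>x. v x - affine_field p x) + 2 * h1_square \<Omega> (\<lambda>x. affine_field p x - affine_field p0 x)"
      by (rule h1_square_triangle[OF \<Omega> vH affine_field_H1 affine_field_H1])
    also have "\<dots> \<le> 2 * h1_square \<Omega> (\<lambda>x. v x - affine_field p x) + 2 * (M1 * h1_square \<Omega> (\<lambda>x. v x - affine_field p x))"
      using p0(2) H1_diff(2)[OF \<Omega> vH affine_field_H1] by simp
    also have "\<dots> = 2 * (1 + M1) * h1_square \<Omega> (\<lambda>x. v x - affine_field p x)" by (simp add: algebra_simps)
    also have "\<dots> \<le> 2 * (1 + M1) * ((2 + 4 * C) * (\<sigma> + \<epsilon>))" using M1 by (intro mult_left_mono vp) auto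
    finally show "\<exists>p\<in>A.
      l2_square \<Omega> (\<lambda>x. weak_grad \<Omega> v x - snd p) \<le> 2 * (1 + M1) * (2 + 4 * C) * (l2_square \<Omega> (\<lambda>x. sym_part (weak_grad \<Omega> v x)) + \<epsilon>)"
      using p0(1) by (intro bexI[of _ p0]) (simp_all add: \<sigma>_def mult.assoc)
  qed
qed

lemma admissible_rigid_gradient:
  assumes "p \<in> A"
  shows "(\<lambda>x. snd p) \<in> K"
proof -
  note g = has_gradient_H1[OF \<Omega> has_gradient_affine_field[of p]]
  have ae: "AE x in lebesgue_on \<Omega>. weak_grad \<Omega> (affine_field p) x = snd p" by (rule weak_grad_unique(2)[OF \<Omega> g(1,2,3)])
  have s: "sym_part (snd p) = 0" "affine_field p \<in> V" using assms by (auto simp: admissible_rigid_def rigid_params_def)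
  have "AE x in lebesgue_on \<Omega>. snd p = weak_grad \<Omega> (affine_field p) x" "AE x in lebesgue_on \<Omega>. sym_part (weak_grad \<Omega> (affine_field p) x) = 0"
    using ae s(1) by (auto elim: eventually_mono)
  then show ?thesis using g(2) s(2) by (auto simp: rigid_gradients_def)
qed

text \<open>
  Project the mean value of \<open>f\<close> onto the finite-dimensional space of gradients of admissible rigid
  motions. By \<open>korn_modulo_admissible\<close> with vanishing symmetric part, constants in this space approximate
  every element of \<open>K\<close>, so orthogonality to them suffices.
\<close>

lemma rigid_gradients_projection_exists:
  assumes conn: "connected \<Omega>" "\<Omega> \<noteq> {}" and lip: "strong_lipschitz_boundary \<Omega>" and f: "f \<in> L2 \<Omega>"
  shows "\<exists>p. is_l2_projection \<Omega> K f p"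
proof -
  define S where "S = snd ` A"
  have S: "subspace S" unfolding S_def by (rule linear_subspace_image[OF linear_snd subspace_admissible_rigid])
  have one: "(\<lambda>x. 1 :: real) \<in> L2 \<Omega>" by (rule L2_continuous[OF _ \<Omega>]) simp
  have const: "(\<lambda>x. A) \<in> L2 \<Omega>" for A :: "real^'n^'n" by (rule L2_continuous[OF _ \<Omega>]) simp
  define m where "m = measure lebesgue \<Omega>"
  have mpos: "0 < m"
  proof -
    have "\<not> negligible \<Omega>" using open_not_negligible[OF \<Omega>(1) conn(2)] .
    moreover have "\<Omega> \<in> lmeasurable" by (rule lmeasurable_open[OF \<Omega>(2,1)])
    ultimately have "m \<noteq> 0" unfolding m_def by (simp add: negligible_iff_measure0)
    then show ?thesis using measure_nonneg[of lebesgue \<Omega>] by (simp add: m_def order_less_le)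
  qed
  have fint: "integrable (lebesgue_on \<Omega>) f"
  proof (rule integrableI_bounded)
    show "f \<in> borel_measurable (lebesgue_on \<Omega>)" using f by (simp add: L2_def)
    have fin: "integrable (lebesgue_on \<Omega>) (\<lambda>x. 1 + (norm (f x))\<^sup>2)"
      using f L2_inner_integrable[OF one one] by (auto simp: L2_def)
    have "(\<integral>\<^sup>+x. ennreal (norm (f x)) \<partial>lebesgue_on \<Omega>) \<le> (\<integral>\<^sup>+x. ennreal (norm (1 + (norm (f x))\<^sup>2)) \<partial>lebesgue_on \<Omega>)"
    proof (intro nn_integral_mono ennreal_leI)
      fix x
      have "2 * norm (f x) \<le> 1 + (norm (f x))\<^sup>2" using zero_le_power2[of "norm (f x) - 1"] by (simp add: power2_eq_square algebra_simps)
      then have "norm (f x) \<le> 1 + (norm (f x))\<^sup>2" using norm_ge_zero[of "f x"] by linarith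
      then show "norm (f x) \<le> norm (1 + (norm (f x))\<^sup>2)" by simp
    qed
    also have "\<dots> < \<infinity>" using fin by (simp add: integrable_iff_bounded)
    finally show "(\<integral>\<^sup>+x. ennreal (norm (f x)) \<partial>lebesgue_on \<Omega>) < \<infinity>" .
  qed
  define a where "a = (1 / m) *\<^sub>R integral\<^sup>L (lebesgue_on \<Omega>) f"
  have span: "span S = S" using S by (simp add: span_eq_iff)
  obtain y z where y: "y \<in> S" and z: "\<And>w. w \<in> S \<Longrightarrow> orthogonal z w" and a_eq: "a = y + z"
    using orthogonal_subspace_decomp_exists[of S a] unfolding span by blast
  have fy: "(\<lambda>x. f x - y) \<in> L2 \<Omega>" by (rule L2_diff[OF f const])
  have orth: "l2_inner \<Omega> (\<lambda>x. f x - y) (\<lambda>x. B) = 0" if B: "B \<in> S" for B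
  proof -
    have "l2_inner \<Omega> f (\<lambda>x. B) = integral\<^sup>L (lebesgue_on \<Omega>) f \<bullet> B"
      unfolding l2_inner_def using fint by simp
    also have "\<dots> = m * (a \<bullet> B)" using mpos by (simp add: a_def)
    finally have 1: "l2_inner \<Omega> f (\<lambda>x. B) = m * (a \<bullet> B)" .
    have 2: "l2_inner \<Omega> (\<lambda>x. y) (\<lambda>x. B) = m * (y \<bullet> B)"
      using \<Omega>(1) by (simp add: l2_inner_def m_def measure_restrict_space)
    have "z \<bullet> B = 0" using z[OF B] by (simp add: orthogonal_def)
    then show ?thesis by (simp add: l2_inner_diff_left[OF f const const] 1 2 a_eq inner_add_left)
  qed
  obtain M where M: "0 \<le> M" and korn: "\<And>v \<epsilon>. v \<in> V \<Longrightarrow> 0 < \<epsilon> \<Longrightarrow> \<exists>p\<in>A.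
    l2_square \<Omega> (\<lambda>x. weak_grad \<Omega> v x - snd p)
    \<le> M * (l2_square \<Omega> (\<lambda>x. sym_part (weak_grad \<Omega> v x)) + \<epsilon>)"
    using korn_modulo_admissible[OF conn lip] by blast
  have "l2_inner \<Omega> (\<lambda>x. f x - y) F = 0" if F: "F \<in> K" for F
  proof -
    obtain u where u: "u \<in> V" "AE x in lebesgue_on \<Omega>. F x = weak_grad \<Omega> u x" "AE x in lebesgue_on \<Omega>. sym_part (weak_grad \<Omega> u x) = 0"
      and FL: "F \<in> L2 \<Omega>" using F by (auto simp: rigid_gradients_def)
    note su = weak_grad_spec[OF H1_tn_H1[OF \<Omega> u(1)]]
    have sym0: "l2_square \<Omega> (\<lambda>x. sym_part (weak_grad \<Omega> u x)) = 0"
      using l2_inner_self_cong[OF u(3) L2_bounded_linear[OF bounded_linear_sym_part su(2)] const] by (simp add: l2_inner_def)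
    define \<alpha> where "\<alpha> = l2_square \<Omega> (\<lambda>x. f x - y)"
    define t where "t = l2_inner \<Omega> (\<lambda>x. f x - y) F"
    have \<alpha>: "0 \<le> \<alpha>" by (simp add: \<alpha>_def l2_inner_self_nonneg)
    have bound: "2 * \<bar>t\<bar> \<le> \<delta> * (\<alpha> + 1)" if \<delta>: "0 < \<delta>" for \<delta>
    proof -
      \<comment> \<open>With this error the distance of \<open>weak_grad \<Omega> u\<close> to a constant admissible gradient is at most \<open>\<delta>\<close>.\<close>
      have "0 < \<delta>\<^sup>2 / (M + 1)" using \<delta> M by simp
      from korn[OF u(1) this] obtain p where p: "p \<in> A"
        and le: "l2_square \<Omega> (\<lambda>x. weak_grad \<Omega> u x - snd p) \<le> M * (\<delta>\<^sup>2 / (M + 1))"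
        by (auto simp: sym0)
      define D where "D x = weak_grad \<Omega> u x - snd p" for x
      have DL: "D \<in> L2 \<Omega>" unfolding D_def by (rule L2_diff[OF su(2) const])
      have "M * (\<delta>\<^sup>2 / (M + 1)) \<le> \<delta>\<^sup>2" using M \<delta> by (simp add: field_simps)
      then have D: "l2_square \<Omega> D \<le> \<delta>\<^sup>2" using le unfolding D_def by linarith
      have "t = l2_inner \<Omega> (\<lambda>x. f x - y) (weak_grad \<Omega> u)"
        unfolding t_def by (rule l2_inner_cong_right[OF u(2) fy FL su(2)])
      also have "\<dots> = l2_inner \<Omega> (weak_grad \<Omega> u) (\<lambda>x. f x - y) - l2_inner \<Omega> (\<lambda>x. snd p) (\<lambda>x. f x - y)"
        using orth[of "snd p"] p by (simp add: S_def l2_inner_commute)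
      also have "\<dots> = l2_inner \<Omega> D (\<lambda>x. f x - y)"
        unfolding D_def by (rule l2_inner_diff_left[OF su(2) const fy, symmetric])
      finally have t: "t = l2_inner \<Omega> D (\<lambda>x. f x - y)" .
      have sq: "0 \<le> \<delta>\<^sup>2 * \<alpha> + 2 * (s * \<delta>) * t + l2_square \<Omega> D" if "s\<^sup>2 = 1" for s
      proof -
        define h where "h x = (s * \<delta>) *\<^sub>R (f x - y)" for x
        have hL: "h \<in> L2 \<Omega>" unfolding h_def by (rule L2_scaleR[OF fy])
        have hh: "l2_inner \<Omega> h g = s * \<delta> * l2_inner \<Omega> (\<lambda>x. f x - y) g" for g unfolding h_def by (rule l2_inner_scaleR_left)
        have h1: "l2_square \<Omega> h = \<delta>\<^sup>2 * \<alpha>"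
          using that hh[of h] hh[of "\<lambda>x. f x - y"] by (simp add: l2_inner_commute[of \<Omega> "\<lambda>x. f x - y" h] \<alpha>_def power2_eq_square)
        have h2: "l2_inner \<Omega> h D = s * \<delta> * t" by (simp only: hh[of D] t l2_inner_commute[of \<Omega> D "\<lambda>x. f x - y"])
        have "0 \<le> l2_square \<Omega> (\<lambda>x. h x + D x)" by (rule l2_inner_self_nonneg)
        also have "\<dots> = l2_inner \<Omega> h (\<lambda>x. h x + D x) + l2_inner \<Omega> D (\<lambda>x. h x + D x)"
          by (rule l2_inner_add_left[OF hL DL L2_add[OF hL DL]])
        also have "\<dots> = (l2_square \<Omega> h + l2_inner \<Omega> D h) + (l2_inner \<Omega> h D + l2_square \<Omega> D)"
          by (simp only: l2_inner_commute[of \<Omega> _ "\<lambda>x. h x + D x"] l2_inner_add_left[OF hL DL hL] l2_inner_add_left[OF hL DL DL])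
        also have "\<dots> = \<delta>\<^sup>2 * \<alpha> + 2 * (s * \<delta>) * t + l2_square \<Omega> D"
          by (simp add: h1 h2 l2_inner_commute[of \<Omega> D h])
        finally show ?thesis .
      qed
      have "\<delta> * (2 * \<bar>t\<bar>) \<le> \<delta> * (\<delta> * (\<alpha> + 1))"
        using sq[of 1] sq[of "-1"] D by (auto simp: abs_if power2_eq_square algebra_simps)
      then show ?thesis using \<delta> by simp
    qed
    have "\<bar>t\<bar> \<le> 0"
    proof (rule field_le_epsilon)
      fix \<epsilon> :: real assume "0 < \<epsilon>"
      then have "2 * \<bar>t\<bar> \<le> \<epsilon> / (\<alpha> + 1) * (\<alpha> + 1)" using \<alpha> by (intro bound) auto
      also have "\<dots> = \<epsilon>" using \<alpha> by simp
      finally show "\<bar>t\<bar> \<le> 0 + \<epsilon>" using \<open>0 < \<epsilon>\<close> by simp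
    qed
    then show ?thesis by (simp add: t_def)
  qed
  moreover have "(\<lambda>x. y) \<in> K" using y admissible_rigid_gradient by (auto simp: S_def)
  ultimately show ?thesis unfolding is_l2_projection_def by (intro exI[of _ "\<lambda>x. y"]) auto
qed

end

text \<open>
  The projection onto a subspace is the best approximation.
\<close>

lemma l2_inner_pythagoras_le:
  assumes f: "f \<in> L2 \<Omega>" and p: "p \<in> L2 \<Omega>" and q: "q \<in> L2 \<Omega>"
    and orth: "l2_inner \<Omega> (\<lambda>x. f x - p x) p = 0" "l2_inner \<Omega> (\<lambda>x. f x - p x) q = 0"
  shows "l2_square \<Omega> (\<lambda>x. f x - p x) \<le> l2_square \<Omega> (\<lambda>x. f x - q x)"
proof -
  define a where "a x = f x - p x" for x
  define b where "b x = p x - q x" for x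
  have L: "a \<in> L2 \<Omega>" "b \<in> L2 \<Omega>" unfolding a_def b_def using f p q by (auto intro: L2_diff)
  have "l2_inner \<Omega> b a = 0"
    unfolding b_def l2_inner_diff_left[OF p q L(1)] l2_inner_commute[of \<Omega> p a] l2_inner_commute[of \<Omega> q a]
    using orth by (simp add: a_def[abs_def])
  then have ab: "l2_inner \<Omega> b a = 0" "l2_inner \<Omega> a b = 0" by (simp_all add: l2_inner_commute[of \<Omega> a b])
  have "l2_square \<Omega> (\<lambda>x. a x + b x) = l2_inner \<Omega> a (\<lambda>x. a x + b x) + l2_inner \<Omega> b (\<lambda>x. a x + b x)"
    by (rule l2_inner_add_left[OF L L2_add[OF L]])
  also have "\<dots> = (l2_square \<Omega> a + l2_inner \<Omega> b a) + (l2_inner \<Omega> a b + l2_square \<Omega> b)"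
    by (simp only: l2_inner_commute[of \<Omega> _ "\<lambda>x. a x + b x"] l2_inner_add_left[OF L L(1)] l2_inner_add_left[OF L L(2)])
  finally have "l2_square \<Omega> a \<le> l2_square \<Omega> (\<lambda>x. a x + b x)" by (simp add: ab l2_inner_self_nonneg)
  then show ?thesis by (simp add: a_def[abs_def] b_def)
qed

section \<open>Korn's inequality with mixed boundary conditions\<close>

theorem theorem11:
  fixes \<Omega> \<Gamma>t \<Gamma>n :: "(real^'n::finite) set"
  assumes "CARD('n) \<ge> 2"
    and "open \<Omega>" "connected \<Omega>" "\<Omega> \<noteq> {}" "bounded \<Omega>"
    and "strong_lipschitz_boundary \<Omega>"
    and "openin (top_of_set (frontier \<Omega>)) \<Gamma>t"
    and "\<Gamma>n = frontier \<Omega> - closure \<Gamma>t"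
  shows "(\<exists>c>0. \<forall>v\<in>H1_tn \<Omega> \<Gamma>t \<Gamma>n.
           (\<forall>F\<in>rigid_gradients \<Omega> \<Gamma>t \<Gamma>n. l2_inner \<Omega> (weak_grad \<Omega> v) F = 0) \<longrightarrow>
           l2_norm \<Omega> (weak_grad \<Omega> v) \<le> c * l2_norm \<Omega> (\<lambda>x. sym_part (weak_grad \<Omega> v x))) \<and>
         (\<exists>c>0. \<forall>v\<in>H1_tn \<Omega> \<Gamma>t \<Gamma>n.
           l2_norm \<Omega> (\<lambda>x. weak_grad \<Omega> v x
               - l2_proj \<Omega> (rigid_gradients \<Omega> \<Gamma>t \<Gamma>n) (weak_grad \<Omega> v) x)
           \<le> c * l2_norm \<Omega> (\<lambda>x. sym_part (weak_grad \<Omega> v x)))"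
proof -
  note \<Omega> = assms(2,5) and conn = assms(3,4) and lip = assms(6) and card = assms(1)
  let ?K = "rigid_gradients \<Omega> \<Gamma>t \<Gamma>n"
  obtain M where M: "0 \<le> M" and korn: "\<And>v \<epsilon>. v \<in> H1_tn \<Omega> \<Gamma>t \<Gamma>n \<Longrightarrow> 0 < \<epsilon> \<Longrightarrow> \<exists>p\<in>admissible_rigid \<Omega> \<Gamma>t \<Gamma>n.
    l2_square \<Omega> (\<lambda>x. weak_grad \<Omega> v x - snd p)
    \<le> M * (l2_square \<Omega> (\<lambda>x. sym_part (weak_grad \<Omega> v x)) + \<epsilon>)"
    using korn_modulo_admissible[OF card \<Omega> conn lip] by blast
  have main: "l2_norm \<Omega> (\<lambda>x. weak_grad \<Omega> v x - P x) \<le> (sqrt M + 1) * l2_norm \<Omega> (\<lambda>x. sym_part (weak_grad \<Omega> v x))"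
    if v: "v \<in> H1_tn \<Omega> \<Gamma>t \<Gamma>n" and P: "P \<in> L2 \<Omega>"
      and orth: "\<And>q. q \<in> insert P ?K \<Longrightarrow> l2_inner \<Omega> (\<lambda>x. weak_grad \<Omega> v x - P x) q = 0" for v P
  proof -
    define \<sigma> where "\<sigma> = l2_square \<Omega> (\<lambda>x. sym_part (weak_grad \<Omega> v x))"
    have wL: "weak_grad \<Omega> v \<in> L2 \<Omega>" by (rule weak_grad_spec(2)[OF H1_tn_H1[OF \<Omega> v]])
    define d where "d = l2_square \<Omega> (\<lambda>x. weak_grad \<Omega> v x - P x)"
    have step: "d \<le> M * (\<sigma> + \<epsilon>)" if \<epsilon>: "0 < \<epsilon>" for \<epsilon>
    proof -
      obtain p where p: "p \<in> admissible_rigid \<Omega> \<Gamma>t \<Gamma>n"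
        "l2_square \<Omega> (\<lambda>x. weak_grad \<Omega> v x - snd p) \<le> M * (\<sigma> + \<epsilon>)"
        using korn[OF v \<epsilon>] unfolding \<sigma>_def by blast
      have S: "(\<lambda>x. snd p) \<in> ?K" by (rule admissible_rigid_gradient[OF card \<Omega> p(1)])
      then have SL: "(\<lambda>x. snd p) \<in> L2 \<Omega>" by (simp add: rigid_gradients_def)
      have "d \<le> l2_square \<Omega> (\<lambda>x. weak_grad \<Omega> v x - snd p)"
        unfolding d_def by (rule l2_inner_pythagoras_le[OF wL P SL]) (use orth S in auto)
      then show ?thesis using p(2) by linarith
    qed
    have "d \<le> M * \<sigma>"
    proof (rule field_le_epsilon)
      fix \<epsilon> :: real assume \<epsilon>: "0 < \<epsilon>"
      then have "d \<le> M * (\<sigma> + \<epsilon> / (M + 1))" using M by (intro step) simp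
      also have "\<dots> = M * \<sigma> + (M / (M + 1)) * \<epsilon>" by (simp add: distrib_left)
      also have "\<dots> \<le> M * \<sigma> + 1 * \<epsilon>" using M \<epsilon> by (intro add_left_mono mult_right_mono) (auto simp: divide_le_eq)
      finally show "d \<le> M * \<sigma> + \<epsilon>" by simp
    qed
    then have "sqrt d \<le> sqrt M * sqrt \<sigma>" by (simp flip: real_sqrt_mult)
    also have "\<dots> \<le> (sqrt M + 1) * sqrt \<sigma>" by (intro mult_right_mono) (auto simp: \<sigma>_def l2_inner_self_nonneg)
    finally show ?thesis by (simp add: l2_norm_def d_def \<sigma>_def)
  qed
  have pos: "0 < sqrt M + 1" using M by (simp add: add_nonneg_pos)
  show ?thesis
  proof (intro conjI exI[of _ "sqrt M + 1"] pos ballI impI)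
    fix v assume v: "v \<in> H1_tn \<Omega> \<Gamma>t \<Gamma>n" and orth: "\<forall>F\<in>?K. l2_inner \<Omega> (weak_grad \<Omega> v) F = 0"
    have 0: "(\<lambda>x. 0 :: real^'n^'n) \<in> L2 \<Omega>" by (rule L2_continuous[OF _ \<Omega>]) simp
    have "l2_norm \<Omega> (\<lambda>x. weak_grad \<Omega> v x - 0) \<le> (sqrt M + 1) * l2_norm \<Omega> (\<lambda>x. sym_part (weak_grad \<Omega> v x))"
    proof (rule main[OF v 0])
      fix q assume "q \<in> insert (\<lambda>x. 0) ?K"
      then have "l2_inner \<Omega> (weak_grad \<Omega> v) q = 0" using orth by (auto simp: l2_inner_def)
      then show "l2_inner \<Omega> (\<lambda>x. weak_grad \<Omega> v x - 0) q = 0" by (simp add: l2_inner_def)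
    qed
    then show "l2_norm \<Omega> (weak_grad \<Omega> v) \<le> (sqrt M + 1) * l2_norm \<Omega> (\<lambda>x. sym_part (weak_grad \<Omega> v x))"
      by simp
  next
    fix v assume v: "v \<in> H1_tn \<Omega> \<Gamma>t \<Gamma>n"
    have wL: "weak_grad \<Omega> v \<in> L2 \<Omega>" by (rule weak_grad_spec(2)[OF H1_tn_H1[OF \<Omega> v]])
    define P where "P = l2_proj \<Omega> ?K (weak_grad \<Omega> v)"
    have "is_l2_projection \<Omega> ?K (weak_grad \<Omega> v) P"
      unfolding P_def l2_proj_def by (rule someI_ex[OF rigid_gradients_projection_exists[OF card \<Omega> conn lip wL]])
    then have P: "P \<in> ?K" "\<And>q. q \<in> ?K \<Longrightarrow> l2_inner \<Omega> (\<lambda>x. weak_grad \<Omega> v x - P x) q = 0"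
      by (auto simp: is_l2_projection_def)
    then have "P \<in> L2 \<Omega>" by (simp add: rigid_gradients_def)
    from main[OF v this] P
    show "l2_norm \<Omega> (\<lambda>x. weak_grad \<Omega> v x - P x) \<le> (sqrt M + 1) * l2_norm \<Omega> (\<lambda>x. sym_part (weak_grad \<Omega> v x))"
      by blast
  qed
qed

end
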